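(* Let $N\ge2$ and let $\mathcal{D}(\bar u)=\bigl(P^-(\tilde{\mathcal{S}}^N(u_1,\ldots,u_{N-1}))\bigr)^{-1}$ be the $\star$-inverse of the generating series of negative projections of dual strings of type $N-1$. For every $\bar n=(n_1,\ldots,n_{N-1})\ne\bar0$ with $n_1\ge n_2\ge\cdots\ge n_{N-1}\ge0$, the coefficient of $\mathcal{D}(\bar u)$ at $u_1^{n_1}\cdots u_{N-1}^{n_{N-1}}$ is $$\mathcal{D}(\bar t_{[\bar n]})=\sum_{\bar\chi}(-1)^{h(\bar\chi)}\ \overline{\mathrm{Sym}}_{\,\bar t_{[\bar n]}}\Bigl(Z_{\bar\chi}(\bar t_{[\bar n]})\cdot\mathcal{E}_{\bar\chi}(\bar t_{[\bar n]})\Bigr),$$ where the sum is over all connected tableaux $\bar\chi$ of weight $\bar n(\bar\chi)=\bar n$ and $h(\bar\chi)$ is the height of $\bar\chi$.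
   Context: The parameter $q\in\mathbb{C}$ is generic (nonzero, not a root of unity). Rational functions are understood as formal series, $\frac1{1-x}=\sum_{n\ge0}x^n$ in the displayed ratio $x$. Algebra. $U_q(\widehat{\mathfrak{gl}}_N)$ (zero central charge, no gradation operator) is generated by the modes of $E_i(z)=\sum_{n\in\mathbb{Z}}E_i[n]z^{-n}$, $F_i(z)=\sum_{n\in\mathbb{Z}}F_i[n]z^{-n}$ ($1\le i\le N-1$), $k^\pm_j(z)=\sum_{n\ge0}k^\pm_j[\pm n]z^{\mp n}$ ($1\le j\le N$); the Cartan currents $k^\pm_j$ mutually commute and have invertible zero modes, and $(q^{-1}z-qw)E_i(z)E_i(w)=E_i(w)E_i(z)(qz-q^{-1}w)$; $(z-w)E_i(z)E_{i+1}(w)=E_{i+1}(w)E_i(z)(q^{-1}z-qw)$; $k_i^\pm(z)E_i(w)k_i^\pm(z)^{-1}=\frac{z-w}{q^{-1}z-qw}E_i(w)$; $k_{i+1}^\pm(z)E_i(w)k_{i+1}^\pm(z)^{-1}=\frac{z-w}{qz-q^{-1}w}E_i(w)$; $(qz-q^{-1}w)F_i(z)F_i(w)=F_i(w)F_i(z)(q^{-1}z-qw)$; $(q^{-1}z-qw)F_i(z)F_{i+1}(w)=F_{i+1}(w)F_i(z)(z-w)$; $k_i^\pm(z)F_i(w)k_i^\pm(z)^{-1}=\frac{q^{-1}z-qw}{z-w}F_i(w)$; $k_{i+1}^\pm(z)F_i(w)k_{i+1}^\pm(z)^{-1}=\frac{qz-q^{-1}w}{z-w}F_i(w)$; $k_i^\pm(z)$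 commutes with $E_j(w),F_j(w)$ for $i\ne j,j+1$; $[E_i(z),F_j(w)]=\delta_{ij}\,\delta(z/w)(q-q^{-1})\bigl(k_i^+(z)/k_{i+1}^+(z)-k_i^-(w)/k_{i+1}^-(w)\bigr)$ with $\delta(z)=\sum_{n\in\mathbb{Z}}z^n$; and the Serre relations $\mathrm{Sym}_{z_1,z_2}\bigl(X_i(z_1)X_i(z_2)X_{i\pm1}(w)-(q+q^{-1})X_i(z_1)X_{i\pm1}(w)X_i(z_2)+X_{i\pm1}(w)X_i(z_1)X_i(z_2)\bigr)=0$ for $X=E$ and $X=F$. Composed currents. $F_{i+1,i}(t)=F_i(t)$ and, for $i<a<j$, $F_{j,i}(t)=F_{j,a}(t)F_{a,i}[0]-q^{-1}F_{a,i}[0]F_{j,a}(t)+(q-q^{-1})\sum_{k<0}F_{a,i}[k]F_{j,a}(t)t^{-k}$ (independent of $a$), where $X[k]$ is the coefficient of $t^{-k}$ in $X(t)$. Equivalently $F_{j,i}(t)=(q-q^{-1})^{j-i-1}F_i(t)F_{i+1}(t)\cdots F_{j-1}(t)$ (analytically continued product). Composed currents $E_{a,b}(t)$ are defined analogously from the $E_i$. Borel subalgebras and projections. $U_q(\mathfrak{b}^\pm)$ are the standard Borel subalgebras, i.e. those generated by the modes of the dual $\mathrm{L}$-operators $L^\pm(z)$ of $U_q(\widehat{\mathfrak{gl}}_N)$; in current terms $U_q(\mathfrak{b}^+)$ is generated by $E_i[m]$ ($m>0$), $F_i[n],k_j^+[n]$ ($n\ge0$), $E_{a,b}[1]$ ($a<b-1$),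 and $U_q(\mathfrak{b}^-)$ by $F_i[m]$ ($m<0$), $E_i[n],k_j^-[n]$ ($n\le0$), $F_{b,a}[-1]$ ($a<b-1$). $U_F$ is the subalgebra generated by $F_i[n]$ ($n\in\mathbb{Z}$), $k_j^+[m]$ ($m\ge0$), and $U'_F\subset U_F$ the one generated by $F_i[n]$ ($n\in\mathbb{Z}$), $k_j^+[m]$ ($m>0$). Put $U_f^-=U'_F\cap U_q(\mathfrak{b}^-)$, $U_F^+=U_F\cap U_q(\mathfrak{b}^+)$. Multiplication gives a vector space isomorphism $U_f^-\otimes U_F^+\to U_F$. With $\varepsilon$ the counit ($\varepsilon(E_i(z))=\varepsilon(F_i(z))=0$, $\varepsilon(k_j^\pm(z))=1$), the projection $P^-$ is defined by $P^-(f_-f_+)=f_-\varepsilon(f_+)$ for $f_-\in U_f^-$, $f_+\in U_F^+$. It extends to the completion $\overline U_F$ of $U_F$ formed by linear combinations of infinite sums of monomials $a_{i_1}[n_1]\cdots a_{i_k}[n_k]$ with $n_1\le\cdots\le n_k$ and $n_1+\cdots+n_k$ fixed, each $a_{i_l}[n_l]$ being $F_{i_l}[n_l]$ or $k^+_{i_l}[n_l]$. Projections are applied to generating series coefficientwise. $q$-symmetric series and $\star$-product. For multi-indices $\bar l\le\bar r$ (componentwise) of length $N-1$ put $\bar t_{[\bar l,\bar r]}=\{t^a_i:1\le a\le N-1,\ l_a<i\le r_a\}$ and $\bar t_{[\bar n]}=\bar t_{[\bar0,\bar n]}$. Define $$\overline{\mathrm{Sym}}_{\,\bar t_{[\bar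 l,\bar r]}}G=\sum_{\sigma}\prod_{a=1}^{N-1}\frac1{(r_a-l_a)!}\prod_{\substack{\ell<\ell'\\ \sigma^a(\ell)>\sigma^a(\ell')}}\frac{q^{-1}-q\,t^a_{\sigma^a(\ell')}/t^a_{\sigma^a(\ell)}}{q-q^{-1}t^a_{\sigma^a(\ell')}/t^a_{\sigma^a(\ell)}}\,G({}^\sigma\bar t_{[\bar l,\bar r]}),$$ $\sigma=(\sigma^a)$ running over tuples of permutations of $\{l_a+1,\ldots,r_a\}$, with ${}^\sigma\bar t$ obtained by $t^a_i\mapsto t^a_{\sigma^a(i)}$. A $q$-symmetric generating series is $\mathcal{A}(\bar u)=1+\sum_{\bar n\ne\bar0}\mathcal{A}(\bar t_{[\bar n]})u_1^{n_1}\cdots u_{N-1}^{n_{N-1}}$ with $\overline{\mathrm{Sym}}\,\mathcal{A}(\bar t_{[\bar n]})=\mathcal{A}(\bar t_{[\bar n]})$; $\mathcal{A}(\bar t_{[\bar s,\bar n]})$ is the coefficient of index $\bar n-\bar s$ in the variables $\bar t_{[\bar s,\bar n]}$. The coefficient of $\mathcal{A}\star\mathcal{B}$ at $u_1^{n_1}\cdots u_{N-1}^{n_{N-1}}$ is $$\sum_{\bar0\le\bar s\le\bar n}\overline{\mathrm{Sym}}_{\,\bar t_{[\bar n]}}\bigl(Z_{\bar s}(\bar t_{[\bar n]})\,\mathcal{A}(\bar t_{[\bar s,\bar n]})\,\mathcal{B}(\bar t_{[\bar0,\bar s]})\bigr),\qquad Z_{\bar s}(\bar t_{[\bar n]})=\prod_{a=1}^{N-2}\prod_{\substack{s_a<\ell\le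 n_a\\0<\ell'\le s_{a+1}}}\frac{q-q^{-1}t^a_\ell/t^{a+1}_{\ell'}}{1-t^a_\ell/t^{a+1}_{\ell'}}.$$ Every $q$-symmetric generating series has a unique two-sided $\star$-inverse, which is a $q$-symmetric generating series. Dual strings. Let $$\tilde V(t^2_l,\ldots,t^2_1;t^1_l,\ldots,t^1_1)=\prod_{m=1}^l\frac1{1-t^1_m/t^2_m}\prod_{m'=m+1}^l\frac{q-q^{-1}t^1_{m'}/t^2_m}{1-t^1_{m'}/t^2_m}.$$ For integers $s_1\ge s_2\ge\cdots\ge s_{N-1}\ge s_N=0$, the dual string of type $N-1$ is $$\tilde{\mathcal{S}}^N(\bar t_{[\bar s]})=\prod_{a=1}^{N-2}\tilde V(t^{a+1}_{s_{a+1}},\ldots,t^{a+1}_1;t^a_{s_a},\ldots,t^a_{s_a-s_{a+1}+1})\ \prod^{\longleftarrow}_{N\ge a>1}\Bigl(\frac1{(s_{a-1}-s_a)!}\prod^{\longleftarrow}_{s_1-s_a\ge\ell>s_1-s_{a-1}}F_{a,1}(t^1_\ell)\Bigr),$$ where in $\prod^{\longleftarrow}$ factors with larger index stand to the left, and $$\tilde{\mathcal{S}}^N(u_1,\ldots,u_{N-1})=\sum_{s_1\ge\cdots\ge s_{N-1}\ge0}\overline{\mathrm{Sym}}_{\,\bar t_{[\bar s]}}\bigl(\tilde{\mathcal{S}}^N(\bar t_{[\bar s]})\bigr)u_1^{s_1}\cdots u_{N-1}^{s_{N-1}}.$$ The coefficients of $P^-(\tilde{\mathcal{S}}^N(\bar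 u))$ are $\mathcal{E}(\bar t_{[\bar s]})=P^-\bigl(\overline{\mathrm{Sym}}_{\,\bar t_{[\bar s]}}(\tilde{\mathcal{S}}^N(\bar t_{[\bar s]}))\bigr)$ for $s_1\ge\cdots\ge s_{N-1}\ge 0$. Tableaux. A diagram of size $n\ge1$ and height $p$ is an ordered decomposition $n=\chi_1+\cdots+\chi_p$ into nonnegative integers, drawn as $p$ rows numbered from bottom to top with $\chi_i$ boxes in row $i$; it is connected if all $\chi_i\ne0$. A (connected) tableau $\bar\chi$ is a filling of the boxes of a (connected) diagram by elements ("types") of $\{1,\ldots,N-1\}$, non-increasing from left to right along each row. Its height $h(\bar\chi)$ is the height of the diagram. Its weight is $\bar n(\bar\chi)=(n_1,\ldots,n_{N-1})$, where $n_a$ is the number of boxes of type $\ge a$. Let $d^i_a$ be the number of boxes of type $\ge a$ in row $i$ and $h^i_a=d^1_a+\cdots+d^i_a$, $h^0_a=0$. The variables $\bar t_{[\bar n]}$, $\bar n=\bar n(\bar\chi)$, are split among rows: row $i$ gets $$\bar t_{\bar\chi^i}=\{t^a_\ell:\ 1\le a\le N-1,\ h^{i-1}_a<\ell\le h^i_a\}.$$ Set $$Z_{\bar\chi}(\bar t_{[\bar n]})=\prod_{1\le i<j\le h(\bar\chi)}\ \prod_{a=1}^{N-2}\ \prod_{\ell=h^{j-1}_a+1}^{h^j_a}\ \prod_{\ell'=h^{i-1}_{a+1}+1}^{h^i_{a+1}}\frac{q-q^{-1}t^a_\ell/t^{a+1}_{\ell'}}{1-t^a_\ell/t^{a+1}_{\ell'}},\qquad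 \mathcal{E}_{\bar\chi}(\bar t_{[\bar n]})=\mathcal{E}(\bar t_{\bar\chi^{h(\bar\chi)}})\cdots\mathcal{E}(\bar t_{\bar\chi^2})\,\mathcal{E}(\bar t_{\bar\chi^1}),$$ where $\mathcal{E}(\bar t_{\bar\chi^i})$ is the coefficient of $P^-(\tilde{\mathcal{S}}^N(\bar u))$ with multi-index $(d^i_1,\ldots,d^i_{N-1})$ evaluated at the variables $\bar t_{\bar\chi^i}$ (in increasing order of lower index). *)

theory Defs
  imports
    Complex_Main
    "HOL-Library.Poly_Mapping"
    "HOL-Library.Function_Algebras"
    "HOL-Library.Product_Lexorder"
    "HOL-Combinatorics.Permutations"
begin

section \<open>The current algebra as an algebra with generators and relations\<close>

text \<open>
  The free unital complex algebra on the generators is the monoid algebra of the free monoid.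
  \<^term>\<open>Poly_Mapping.single\<close> needs the monoid of words to be additive, hence the wrapper.
\<close>

datatype 'g word = Word (letters: "'g list")

instantiation word :: (type) monoid_add
begin
definition zero_word :: "'a word" where "zero_word = Word []"
definition plus_word :: "'a word \<Rightarrow> 'a word \<Rightarrow> 'a word"
  where "plus_word u v = Word (letters u @ letters v)"
instance by standard (simp_all add: zero_word_def plus_word_def)
end

text \<open>
  \<open>GE i n\<close> is \<open>E\<^sub>i[n]\<close> and \<open>GF i n\<close> is \<open>F\<^sub>i[n]\<close>. With \<open>True\<close> standing for \<open>+\<close> and \<open>False\<close> for \<open>-\<close>,
  \<open>GK s j n\<close> is \<open>k\<^sup>s\<^sub>j[s n]\<close> (so \<open>n\<close> is the absolute value of the mode number), and \<open>GKinv s j\<close>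
  is the inverse of the zero mode \<open>k\<^sup>s\<^sub>j[0]\<close>.
\<close>

datatype gen = GE nat int | GF nat int | GK bool nat nat | GKinv bool nat

type_synonym free = "gen word \<Rightarrow>\<^sub>0 complex"

definition gcst :: "complex \<Rightarrow> free" where "gcst c = Poly_Mapping.single 0 c"

definition gmon :: "gen list \<Rightarrow> free" where "gmon w = Poly_Mapping.single (Word w) 1"

definition Emode :: "nat \<Rightarrow> int \<Rightarrow> free" where "Emode i n = gmon [GE i n]"

definition Fmode :: "nat \<Rightarrow> int \<Rightarrow> free" where "Fmode i n = gmon [GF i n]"

definition kmode :: "bool \<Rightarrow> nat \<Rightarrow> int \<Rightarrow> free" where
  "kmode s j n =
     (let m = (if s then n else - n) in if m < 0 then 0 else gmon [GK s j (nat m)])"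

text \<open>Coefficients of the inverse power series \<open>k\<^sup>s\<^sub>j(z)\<^sup>-\<^sup>1\<close>, in powers of \<open>z\<^sup>-\<^sup>1\<close> for \<open>s = +\<close> and of \<open>z\<close> for \<open>s = -\<close>.\<close>

fun kinv :: "bool \<Rightarrow> nat \<Rightarrow> nat \<Rightarrow> free" where
  "kinv s j 0 = gmon [GKinv s j]"
| "kinv s j (Suc m) =
     - (gmon [GKinv s j] * (\<Sum>p\<le>m. gmon [GK s j (Suc p)] * kinv s j (m - p)))"

text \<open>The mode number \<open>n\<close> of \<open>k\<^sup>s\<^sub>i(z) / k\<^sup>s\<^sub>i\<^sub>+\<^sub>1(z)\<close>.\<close>

definition psimode :: "bool \<Rightarrow> nat \<Rightarrow> int \<Rightarrow> free" where
  "psimode s i n =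
     (let m = (if s then n else - n) in
      if m < 0 then 0 else \<Sum>p\<le>nat m. gmon [GK s i p] * kinv s (Suc i) (nat m - p))"

text \<open>
  The coefficients of the relation \<open>(a z - b w) X(z) Y(w) = (c z - d w) Y(w) X(z)\<close>, for
  \<open>X(z) = \<Sum>n. X n z\<^sup>-\<^sup>n\<close>. The relations between \<open>k\<close> and \<open>E\<close> or \<open>F\<close> are put in this form by clearing
  the denominator of the structure function; as \<open>k\<^sup>+\<close> is a power series in \<open>z\<^sup>-\<^sup>1\<close> and \<open>k\<^sup>-\<close> in \<open>z\<close>,
  this is equivalent to expanding it in powers of \<open>w/z\<close>, respectively \<open>z/w\<close>.
\<close>

definition exch ::
  "complex \<Rightarrow> complex \<Rightarrow> complex \<Rightarrow> complex \<Rightarrow> (int \<Rightarrow> free) \<Rightarrow> (int \<Rightarrow> free) \<Rightarrow> free set" where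
  "exch a b c d X Y =
     {gcst a * X (m + 1) * Y n - gcst b * X m * Y (n + 1)
        - (gcst c * Y n * X (m + 1) - gcst d * Y (n + 1) * X m) | m n. True}"

definition serre :: "complex \<Rightarrow> (int \<Rightarrow> free) \<Rightarrow> (int \<Rightarrow> free) \<Rightarrow> int \<Rightarrow> int \<Rightarrow> int \<Rightarrow> free" where
  "serre q X Y m1 m2 n =
     X m1 * X m2 * Y n - gcst (q + 1 / q) * X m1 * Y n * X m2 + Y n * X m1 * X m2"

fun valid_gen :: "nat \<Rightarrow> gen \<Rightarrow> bool" where
  "valid_gen N (GE i n) \<longleftrightarrow> 1 \<le> i \<and> i < N"
| "valid_gen N (GF i n) \<longleftrightarrow> 1 \<le> i \<and> i < N"
| "valid_gen N (GK s j n) \<longleftrightarrow> 1 \<le> j \<and> j \<le> N"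
| "valid_gen N (GKinv s j) \<longleftrightarrow> 1 \<le> j \<and> j \<le> N"

text \<open>
  Rule \<open>out_of_range\<close> removes the generators of the type \<^typ>\<open>gen\<close> that do not exist for the given
  \<open>N\<close>. Rules \<open>EE_far\<close> and \<open>FF_far\<close> are the usual commutation of currents at non-adjacent nodes.
\<close>

inductive_set relators :: "nat \<Rightarrow> complex \<Rightarrow> free set" for N :: nat and q :: complex where
  out_of_range: "\<not> valid_gen N g \<Longrightarrow> gmon [g] \<in> relators N q"
| k_commute: "\<lbrakk>1 \<le> i; i \<le> N; 1 \<le> j; j \<le> N\<rbrakk> \<Longrightarrow>
    kmode s i m * kmode s' j n - kmode s' j n * kmode s i m \<in> relators N q"
| k_inverse_right: "\<lbrakk>1 \<le> j; j \<le> N\<rbrakk> \<Longrightarrow> kmode s j 0 * gmon [GKinv s j] - 1 \<in> relators N q"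
| k_inverse_left: "\<lbrakk>1 \<le> j; j \<le> N\<rbrakk> \<Longrightarrow> gmon [GKinv s j] * kmode s j 0 - 1 \<in> relators N q"
| EE: "\<lbrakk>1 \<le> i; i < N; r \<in> exch (1 / q) q q (1 / q) (Emode i) (Emode i)\<rbrakk> \<Longrightarrow> r \<in> relators N q"
| EE_next: "\<lbrakk>1 \<le> i; i + 1 < N; r \<in> exch 1 1 (1 / q) q (Emode i) (Emode (i + 1))\<rbrakk> \<Longrightarrow> r \<in> relators N q"
| EE_far: "\<lbrakk>1 \<le> i; i + 1 < j; j < N\<rbrakk> \<Longrightarrow>
    Emode i m * Emode j n - Emode j n * Emode i m \<in> relators N q"
| kE: "\<lbrakk>1 \<le> i; i < N; r \<in> exch (1 / q) q 1 1 (kmode s i) (Emode i)\<rbrakk> \<Longrightarrow> r \<in> relators N q"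
| kE_next: "\<lbrakk>1 \<le> i; i < N; r \<in> exch q (1 / q) 1 1 (kmode s (i + 1)) (Emode i)\<rbrakk> \<Longrightarrow> r \<in> relators N q"
| kE_other: "\<lbrakk>1 \<le> i; i \<le> N; 1 \<le> j; j < N; i \<noteq> j; i \<noteq> j + 1\<rbrakk> \<Longrightarrow>
    kmode s i m * Emode j n - Emode j n * kmode s i m \<in> relators N q"
| FF: "\<lbrakk>1 \<le> i; i < N; r \<in> exch q (1 / q) (1 / q) q (Fmode i) (Fmode i)\<rbrakk> \<Longrightarrow> r \<in> relators N q"
| FF_next: "\<lbrakk>1 \<le> i; i + 1 < N; r \<in> exch (1 / q) q 1 1 (Fmode i) (Fmode (i + 1))\<rbrakk> \<Longrightarrow> r \<in> relators N q"
| FF_far: "\<lbrakk>1 \<le> i; i + 1 < j; j < N\<rbrakk> \<Longrightarrow>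
    Fmode i m * Fmode j n - Fmode j n * Fmode i m \<in> relators N q"
| kF: "\<lbrakk>1 \<le> i; i < N; r \<in> exch 1 1 (1 / q) q (kmode s i) (Fmode i)\<rbrakk> \<Longrightarrow> r \<in> relators N q"
| kF_next: "\<lbrakk>1 \<le> i; i < N; r \<in> exch 1 1 q (1 / q) (kmode s (i + 1)) (Fmode i)\<rbrakk> \<Longrightarrow> r \<in> relators N q"
| kF_other: "\<lbrakk>1 \<le> i; i \<le> N; 1 \<le> j; j < N; i \<noteq> j; i \<noteq> j + 1\<rbrakk> \<Longrightarrow>
    kmode s i m * Fmode j n - Fmode j n * kmode s i m \<in> relators N q"
| EF: "\<lbrakk>1 \<le> i; i < N; 1 \<le> j; j < N\<rbrakk> \<Longrightarrow>
    Emode i m * Fmode j n - Fmode j n * Emode i m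
      - (if i = j then gcst (q - 1 / q) * (psimode True i (m + n) - psimode False i (m + n)) else 0)
    \<in> relators N q"
| serre_E: "\<lbrakk>1 \<le> i; i < N; 1 \<le> j; j < N; j = i + 1 \<or> i = j + 1\<rbrakk> \<Longrightarrow>
    serre q (Emode i) (Emode j) m1 m2 n + serre q (Emode i) (Emode j) m2 m1 n \<in> relators N q"
| serre_F: "\<lbrakk>1 \<le> i; i < N; 1 \<le> j; j < N; j = i + 1 \<or> i = j + 1\<rbrakk> \<Longrightarrow>
    serre q (Fmode i) (Fmode j) m1 m2 n + serre q (Fmode i) (Fmode j) m2 m1 n \<in> relators N q"

inductive_set two_sided_ideal :: "'a::ring_1 set \<Rightarrow> 'a set" for R :: "'a set" where
  zero: "0 \<in> two_sided_ideal R"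
| gen: "r \<in> R \<Longrightarrow> a * r * b \<in> two_sided_ideal R"
| add: "\<lbrakk>x \<in> two_sided_ideal R; y \<in> two_sided_ideal R\<rbrakk> \<Longrightarrow> x + y \<in> two_sided_ideal R"

text \<open>
  The ring \<^typ>\<open>'a\<close> is the quantum affine algebra: \<open>\<phi>\<close> identifies it with the free algebra modulo the
  ideal of relations. The complex scalars act through \<open>\<phi> \<circ> gcst\<close>.
\<close>

definition is_Uq_gl_hat :: "nat \<Rightarrow> complex \<Rightarrow> (free \<Rightarrow> 'a::ring_1) \<Rightarrow> bool" where
  "is_Uq_gl_hat N q \<phi> \<longleftrightarrow>
     \<phi> 1 = 1 \<and> (\<forall>x y. \<phi> (x + y) = \<phi> x + \<phi> y) \<and> (\<forall>x y. \<phi> (x * y) = \<phi> x * \<phi> y) \<and>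
     surj \<phi> \<and> (\<forall>x. \<phi> x = 0 \<longleftrightarrow> x \<in> two_sided_ideal (relators N q))"

definition uscale :: "(free \<Rightarrow> 'a::ring_1) \<Rightarrow> complex \<Rightarrow> 'a \<Rightarrow> 'a" where
  "uscale \<phi> c u = \<phi> (gcst c) * u"


section \<open>Borel subalgebras and the projection\<close>

inductive_set subalgebra :: "(free \<Rightarrow> 'a::ring_1) \<Rightarrow> free set \<Rightarrow> 'a set"
  for \<phi> :: "free \<Rightarrow> 'a" and G :: "free set" where
  scalar: "\<phi> (gcst c) \<in> subalgebra \<phi> G"
| gen: "x \<in> G \<Longrightarrow> \<phi> x \<in> subalgebra \<phi> G"
| add: "\<lbrakk>u \<in> subalgebra \<phi> G; v \<in> subalgebra \<phi> G\<rbrakk> \<Longrightarrow> u + v \<in> subalgebra \<phi> G"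
| mult: "\<lbrakk>u \<in> subalgebra \<phi> G; v \<in> subalgebra \<phi> G\<rbrakk> \<Longrightarrow> u * v \<in> subalgebra \<phi> G"

text \<open>
  The elements \<open>E\<^sub>a\<^sub>,\<^sub>b[1]\<close> and \<open>F\<^sub>b\<^sub>,\<^sub>a[-1]\<close> of the Borel subalgebras, for \<open>b = a + 1 + d\<close>. As a mode of
  a composed current, \<open>F\<^sub>b\<^sub>,\<^sub>a[-1]\<close> is the infinite sum
  \<open>F\<^sub>b\<^sub>,\<^sub>c[-1] F\<^sub>c\<^sub>,\<^sub>a[0] - q\<^sup>-\<^sup>1 F\<^sub>c\<^sub>,\<^sub>a[0] F\<^sub>b\<^sub>,\<^sub>c[-1] + (q - q\<^sup>-\<^sup>1) (\<Sum>k<0. F\<^sub>c\<^sub>,\<^sub>a[k] F\<^sub>b\<^sub>,\<^sub>c[-1-k])\<close>, whose tail is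
  normally ordered and lies in the completion only. The element of the Borel subalgebra is what
  remains without the tail, an iterated \<open>q\<close>-commutator; it is the leading mode of the Gauss
  coordinate of the L-operator. In the same way \<open>E\<^sub>a\<^sub>,\<^sub>b[1]\<close> is
  \<open>E\<^sub>a\<^sub>,\<^sub>c[0] E\<^sub>c\<^sub>,\<^sub>b[1] - q E\<^sub>c\<^sub>,\<^sub>b[1] E\<^sub>a\<^sub>,\<^sub>c[0] - (q - q\<^sup>-\<^sup>1) (\<Sum>k>0. E\<^sub>c\<^sub>,\<^sub>b[1-k] E\<^sub>a\<^sub>,\<^sub>c[k])\<close> without its tail.
\<close>

fun Ecomp_one :: "complex \<Rightarrow> nat \<Rightarrow> nat \<Rightarrow> free" where
  "Ecomp_one q a 0 = Emode a 1"
| "Ecomp_one q a (Suc d) =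
     Emode a 0 * Ecomp_one q (Suc a) d - gcst q * Ecomp_one q (Suc a) d * Emode a 0"

fun Fcomp_minus_one :: "complex \<Rightarrow> nat \<Rightarrow> nat \<Rightarrow> free" where
  "Fcomp_minus_one q a 0 = Fmode a (- 1)"
| "Fcomp_minus_one q a (Suc d) =
     Fcomp_minus_one q (Suc a) d * Fmode a 0 - gcst (1 / q) * Fmode a 0 * Fcomp_minus_one q (Suc a) d"

definition Uq_b_plus :: "nat \<Rightarrow> complex \<Rightarrow> (free \<Rightarrow> 'a::ring_1) \<Rightarrow> 'a set" where
  "Uq_b_plus N q \<phi> = subalgebra \<phi>
     ({Emode i m | i m. 1 \<le> i \<and> i < N \<and> 0 < m} \<union> {Fmode i n | i n. 1 \<le> i \<and> i < N \<and> 0 \<le> n} \<union>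
      {kmode True j n | j n. 1 \<le> j \<and> j \<le> N \<and> 0 \<le> n} \<union>
      {Ecomp_one q a d | a d. 1 \<le> a \<and> 0 < d \<and> a + 1 + d \<le> N})"

definition Uq_b_minus :: "nat \<Rightarrow> complex \<Rightarrow> (free \<Rightarrow> 'a::ring_1) \<Rightarrow> 'a set" where
  "Uq_b_minus N q \<phi> = subalgebra \<phi>
     ({Fmode i m | i m. 1 \<le> i \<and> i < N \<and> m < 0} \<union> {Emode i n | i n. 1 \<le> i \<and> i < N \<and> n \<le> 0} \<union>
      {kmode False j n | j n. 1 \<le> j \<and> j \<le> N \<and> n \<le> 0} \<union>
      {Fcomp_minus_one q a d | a d. 1 \<le> a \<and> 0 < d \<and> a + 1 + d \<le> N})"

definition U_F :: "nat \<Rightarrow> (free \<Rightarrow> 'a::ring_1) \<Rightarrow> 'a set" where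
  "U_F N \<phi> = subalgebra \<phi>
     ({Fmode i n | i n. 1 \<le> i \<and> i < N} \<union> {kmode True j m | j m. 1 \<le> j \<and> j \<le> N \<and> 0 \<le> m})"

definition U_F' :: "nat \<Rightarrow> (free \<Rightarrow> 'a::ring_1) \<Rightarrow> 'a set" where
  "U_F' N \<phi> = subalgebra \<phi>
     ({Fmode i n | i n. 1 \<le> i \<and> i < N} \<union> {kmode True j m | j m. 1 \<le> j \<and> j \<le> N \<and> 0 < m})"

definition U_f_minus :: "nat \<Rightarrow> complex \<Rightarrow> (free \<Rightarrow> 'a::ring_1) \<Rightarrow> 'a set" where
  "U_f_minus N q \<phi> = U_F' N \<phi> \<inter> Uq_b_minus N q \<phi>"

definition U_F_plus :: "nat \<Rightarrow> complex \<Rightarrow> (free \<Rightarrow> 'a::ring_1) \<Rightarrow> 'a set" where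
  "U_F_plus N q \<phi> = U_F N \<phi> \<inter> Uq_b_plus N q \<phi>"

definition is_counit :: "nat \<Rightarrow> (free \<Rightarrow> 'a::ring_1) \<Rightarrow> ('a \<Rightarrow> complex) \<Rightarrow> bool" where
  "is_counit N \<phi> \<epsilon> \<longleftrightarrow>
     (\<forall>u v. \<epsilon> (u + v) = \<epsilon> u + \<epsilon> v) \<and> (\<forall>u v. \<epsilon> (u * v) = \<epsilon> u * \<epsilon> v) \<and> (\<forall>c. \<epsilon> (\<phi> (gcst c)) = c) \<and>
     (\<forall>i n. 1 \<le> i \<and> i < N \<longrightarrow> \<epsilon> (\<phi> (Emode i n)) = 0 \<and> \<epsilon> (\<phi> (Fmode i n)) = 0) \<and>
     (\<forall>s j n. 1 \<le> j \<and> j \<le> N \<longrightarrow> \<epsilon> (\<phi> (kmode s j n)) = (if n = 0 then 1 else 0))"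

definition is_minus_projection ::
  "nat \<Rightarrow> complex \<Rightarrow> (free \<Rightarrow> 'a::ring_1) \<Rightarrow> ('a \<Rightarrow> complex) \<Rightarrow> ('a \<Rightarrow> 'a) \<Rightarrow> bool" where
  "is_minus_projection N q \<phi> \<epsilon> P \<longleftrightarrow>
     (\<forall>u\<in>U_F N \<phi>. \<forall>v\<in>U_F N \<phi>. P (u + v) = P u + P v) \<and>
     (\<forall>c. \<forall>u\<in>U_F N \<phi>. P (uscale \<phi> c u) = uscale \<phi> c (P u)) \<and>
     (\<forall>f\<in>U_f_minus N q \<phi>. \<forall>g\<in>U_F_plus N q \<phi>. P (f * g) = uscale \<phi> (\<epsilon> g) f)"

text \<open>
  Elements of the completion of \<^term>\<open>U_F N \<phi>\<close> are given by possibly infinite linear combinations of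
  monomials, i.e. by arbitrary coefficient functions on words. The projection kills all but finitely
  many terms of a sum converging in the completion and is extended termwise.
\<close>

type_synonym wseries = "gen list \<Rightarrow> complex"

definition wscale :: "complex \<Rightarrow> wseries \<Rightarrow> wseries" where "wscale c x = (\<lambda>w. c * x w)"

definition wletter :: "gen \<Rightarrow> wseries" where "wletter g = (\<lambda>w. if w = [g] then 1 else 0)"

definition wone :: wseries where "wone = (\<lambda>w. if w = [] then 1 else 0)"

definition wmult :: "wseries \<Rightarrow> wseries \<Rightarrow> wseries" where
  "wmult x y = (\<lambda>w. \<Sum>k\<le>length w. x (take k w) * y (drop k w))"

definition Pbar :: "(free \<Rightarrow> 'a::ring_1) \<Rightarrow> ('a \<Rightarrow> 'a) \<Rightarrow> wseries \<Rightarrow> 'a" where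
  "Pbar \<phi> P x = Sum_any (\<lambda>w. uscale \<phi> (x w) (P (\<phi> (gmon w))))"

text \<open>
  \<open>Fcomp q i d n\<close> is the mode \<open>F\<^sub>j\<^sub>,\<^sub>i[n]\<close> of the composed current for \<open>j = i + 1 + d\<close>, by the recursion
  with intermediate index \<open>a = i + 1\<close>. For each word at most one \<open>k\<close> contributes to the infinite sum.
\<close>

fun Fcomp :: "complex \<Rightarrow> nat \<Rightarrow> nat \<Rightarrow> int \<Rightarrow> wseries" where
  "Fcomp q i 0 n = wletter (GF i n)"
| "Fcomp q i (Suc d) n = (\<lambda>w.
     wmult (Fcomp q (Suc i) d n) (wletter (GF i 0)) w
     - 1 / q * wmult (wletter (GF i 0)) (Fcomp q (Suc i) d n) w
     + (q - 1 / q) * Sum_any (\<lambda>k. if k < 0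
         then wmult (wletter (GF i k)) (Fcomp q (Suc i) d (n - k)) w else 0))"


section \<open>Generating series up to analytic continuation\<close>

text \<open>
  \<open>(a, i)\<close> is the variable \<open>t\<^sup>a\<^sub>i\<close>. A value \<open>f e\<close> of a distribution \<open>f\<close> is the coefficient of the
  monomial with exponents \<open>e\<close>.
\<close>

type_synonym var = "nat \<times> nat"
type_synonym expo = "var \<Rightarrow>\<^sub>0 int"
type_synonym laurent = "expo \<Rightarrow>\<^sub>0 complex"
type_synonym 'b dist = "expo \<Rightarrow> 'b"

definition lcst :: "complex \<Rightarrow> laurent" where "lcst c = Poly_Mapping.single 0 c"

definition lratio :: "var \<Rightarrow> var \<Rightarrow> laurent" where
  "lratio x y = Poly_Mapping.single (Poly_Mapping.single x 1 - Poly_Mapping.single y 1) 1"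

definition lin :: "complex \<Rightarrow> complex \<Rightarrow> var \<Rightarrow> var \<Rightarrow> laurent" where
  "lin \<alpha> \<beta> x y = lcst \<alpha> - lcst \<beta> * lratio x y"

definition lact :: "(complex \<Rightarrow> 'b \<Rightarrow> 'b::comm_monoid_add) \<Rightarrow> laurent \<Rightarrow> 'b dist \<Rightarrow> 'b dist" where
  "lact scl p f = (\<lambda>e. \<Sum>d\<in>Poly_Mapping.keys p. scl (Poly_Mapping.lookup p d) (f (e - d)))"

text \<open>
  Permuting the variables of a product of currents, or of its projection, takes one out of the
  region \<open>|t\<^sub>1| << |t\<^sub>2| << \<dots>\<close> of the displayed expansions, and the product of the permuted series with an
  expanded rational function need not converge: the product of permuted currents is understood
  by analytic continuation. To make this precise, a series is a pair \<open>(f, d)\<close> standing for \<open>f / d\<close>,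
  with \<open>f\<close> a formal distribution and \<open>d\<close> a product of factors \<open>\<alpha> - \<beta> x/y\<close>; a formal series \<open>f\<close> is
  \<open>(f, 1)\<close>. Two pairs are equal if they agree after multiplication by such factors. Expansions are
  not lost: if \<open>g\<close> is the series expansion of a rational multiple \<open>f/d\<close> of \<open>f\<close>, then \<open>(f, d)\<close> equals
  \<open>(g, 1)\<close>; and by \<open>series_eq_imp_eq\<close> below equal series expanded in the region above are
  equal coefficientwise.
\<close>

type_synonym 'b frac = "'b dist \<times> laurent"
type_synonym rat_fun = "laurent \<times> laurent"

inductive_set dens :: "var set \<Rightarrow> laurent set" for V :: "var set" where
  one: "1 \<in> dens V"
| factor: "\<lbrakk>c \<in> dens V; x \<in> V; y \<in> V; x \<noteq> y; \<alpha> \<noteq> 0; \<beta> \<noteq> 0\<rbrakk> \<Longrightarrow> lin \<alpha> \<beta> x y * c \<in> dens V"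

definition series_eq ::
  "(complex \<Rightarrow> 'b \<Rightarrow> 'b::comm_monoid_add) \<Rightarrow> var set \<Rightarrow> 'b frac \<Rightarrow> 'b frac \<Rightarrow> bool" where
  "series_eq scl V X Y \<longleftrightarrow>
     (\<exists>c\<in>dens V. lact scl (c * snd Y) (fst X) = lact scl (c * snd X) (fst Y))"

definition fzero :: "'b::zero frac" where "fzero = ((\<lambda>_. 0), 1)"

definition fone :: "'b::zero_neq_one frac" where "fone = ((\<lambda>e. if e = 0 then 1 else 0), 1)"

definition rmult :: "(complex \<Rightarrow> 'b \<Rightarrow> 'b::comm_monoid_add) \<Rightarrow> rat_fun \<Rightarrow> 'b frac \<Rightarrow> 'b frac" where
  "rmult scl r X = (lact scl (fst r) (fst X), snd r * snd X)"

definition fsum ::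
  "(complex \<Rightarrow> 'b \<Rightarrow> 'b::comm_monoid_add) \<Rightarrow> 'i set \<Rightarrow> ('i \<Rightarrow> 'b frac) \<Rightarrow> 'b frac" where
  "fsum scl I X =
     ((\<lambda>e. \<Sum>i\<in>I. lact scl (\<Prod>j\<in>I - {i}. snd (X j)) (fst (X i)) e), \<Prod>i\<in>I. snd (X i))"

text \<open>
  This product is used for factors depending on disjoint sets of variables only; then at most one
  term of the sum is nonzero.
\<close>

definition fmult :: "'a::ring_1 frac \<Rightarrow> 'a frac \<Rightarrow> 'a frac" where
  "fmult X Y = ((\<lambda>e. Sum_any (\<lambda>d. fst X d * fst Y (e - d))), snd X * snd Y)"

text \<open>Substitution of the variable \<open>\<rho> v\<close> for \<open>v\<close>, for injective \<open>\<rho>\<close>.\<close>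

definition ren_expo :: "(var \<Rightarrow> var) \<Rightarrow> expo \<Rightarrow> expo" where
  "ren_expo \<rho> e =
     (\<Sum>v\<in>Poly_Mapping.keys e. Poly_Mapping.single (\<rho> v) (Poly_Mapping.lookup e v))"

definition ren_laurent :: "(var \<Rightarrow> var) \<Rightarrow> laurent \<Rightarrow> laurent" where
  "ren_laurent \<rho> p =
     (\<Sum>e\<in>Poly_Mapping.keys p. Poly_Mapping.single (ren_expo \<rho> e) (Poly_Mapping.lookup p e))"

definition ren_dist :: "(var \<Rightarrow> var) \<Rightarrow> 'b::zero dist \<Rightarrow> 'b dist" where
  "ren_dist \<rho> f =
     (\<lambda>e. if e \<in> range (ren_expo \<rho>) then f (inv (ren_expo \<rho>) e) else 0)"

definition ren :: "(var \<Rightarrow> var) \<Rightarrow> 'b::zero frac \<Rightarrow> 'b frac" where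
  "ren \<rho> X = (ren_dist \<rho> (fst X), ren_laurent \<rho> (snd X))"

subsection \<open>Uniqueness of expansions\<close>

text \<open>
  In the order on \<^typ>\<open>expo\<close> the monomials \<open>t\<^sup>a\<^sub>i / t\<^sup>a\<^sub>j\<close> for \<open>i < j\<close> and \<open>t\<^sup>a\<^sub>i / t\<^sup>b\<^sub>j\<close> for \<open>a < b\<close> are positive, so
  series in these ratios have well-ordered supports.
\<close>

definition expanded :: "'b::zero dist \<Rightarrow> bool" where
  "expanded f \<longleftrightarrow> (\<forall>B. B \<subseteq> {e. f e \<noteq> 0} \<and> B \<noteq> {} \<longrightarrow> (\<exists>m\<in>B. \<forall>e\<in>B. m \<le> e))"

lemma lin_nonzero:
  assumes "x \<noteq> y" "\<alpha> \<noteq> 0"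
  shows "lin \<alpha> \<beta> x y \<noteq> 0"
proof
  assume "lin \<alpha> \<beta> x y = 0"
  moreover have "Poly_Mapping.single x 1 - Poly_Mapping.single y 1 \<noteq> (0 :: expo)"
  proof
    assume "Poly_Mapping.single x 1 - Poly_Mapping.single y 1 = (0 :: expo)"
    then have "Poly_Mapping.lookup (Poly_Mapping.single x 1 - Poly_Mapping.single y 1 :: expo) x = 0"
      by simp
    then show False
      using assms(1) by (simp add: lookup_minus lookup_single when_def)
  qed
  then have "Poly_Mapping.lookup (lin \<alpha> \<beta> x y) 0 = \<alpha>"
    by (simp add: lin_def lcst_def lratio_def mult_single lookup_minus lookup_single when_def)
  ultimately show False
    using assms(2) by simp
qed

lemma dens_nonzero: "c \<in> dens V \<Longrightarrow> c \<noteq> 0"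
  by (induction rule: dens.induct) (simp_all add: lin_nonzero)

lemma lact_eq_zero:
  assumes vs: "vector_space (scl :: complex \<Rightarrow> 'b \<Rightarrow> 'b::ab_group_add)"
    and f: "expanded f" and p: "p \<noteq> 0" and eq: "lact scl p f = (\<lambda>_. 0)"
  shows "f = (\<lambda>_. 0)"
proof (rule ccontr)
  assume "f \<noteq> (\<lambda>_. 0)"
  then have "{e. f e \<noteq> 0} \<noteq> {}"
    by auto
  then obtain e0 where e0: "f e0 \<noteq> 0" and least: "\<And>e. f e \<noteq> 0 \<Longrightarrow> e0 \<le> e"
    using f unfolding expanded_def by (metis (mono_tags, lifting) mem_Collect_eq subset_refl)
  interpret vector_space scl by (rule vs)
  define m where "m = Min (Poly_Mapping.keys p)"
  have m: "m \<in> Poly_Mapping.keys p"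
    unfolding m_def using p by (intro Min_in) auto
  have "scl (Poly_Mapping.lookup p d) (f (m + e0 - d)) = 0"
    if d: "d \<in> Poly_Mapping.keys p - {m}" for d
  proof -
    have "m < d"
      using d by (metis Diff_iff Min_le finite_keys insertI1 m_def order_le_imp_less_or_eq)
    then have "m + e0 - d < e0"
      by (simp add: algebra_simps)
    then have "f (m + e0 - d) = 0"
      using least not_le by blast
    then show ?thesis by simp
  qed
  then have "(\<Sum>d\<in>Poly_Mapping.keys p - {m}. scl (Poly_Mapping.lookup p d) (f (m + e0 - d))) = 0"
    by (intro sum.neutral) blast
  then have "lact scl p f (m + e0) = scl (Poly_Mapping.lookup p m) (f e0)"
    unfolding lact_def using m by (simp add: sum.remove[of _ m])
  moreover have "\<dots> \<noteq> 0"
    using m e0 by (simp add: in_keys_iff)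
  ultimately show False
    using eq by simp
qed

lemma expanded_diff:
  assumes "expanded f" "expanded (g :: 'b::ab_group_add dist)"
  shows "expanded (\<lambda>e. f e - g e)"
  unfolding expanded_def
proof (intro allI impI, elim conjE)
  fix B assume B: "B \<subseteq> {e. f e - g e \<noteq> 0}" "B \<noteq> {}"
  define F where "F = B \<inter> {e. f e \<noteq> 0}"
  define G where "G = B \<inter> {e. g e \<noteq> 0}"
  have FG: "e \<in> F \<or> e \<in> G" if "e \<in> B" for e
    using B(1) that by (cases "f e = 0") (auto simp: F_def G_def)
  have minF: "\<exists>m\<in>F. \<forall>e\<in>F. m \<le> e" if "F \<noteq> {}"
    using assms(1)[unfolded expanded_def, rule_format, of F] that by (simp add: F_def)
  have minG: "\<exists>m\<in>G. \<forall>e\<in>G. m \<le> e" if "G \<noteq> {}"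
    using assms(2)[unfolded expanded_def, rule_format, of G] that by (simp add: G_def)
  show "\<exists>m\<in>B. \<forall>e\<in>B. m \<le> e"
  proof (cases "F = {} \<or> G = {}")
    case True
    then have "B = F \<or> B = G"
      using FG by (auto simp: F_def G_def)
    then show ?thesis
      using minF minG B(2) by metis
  next
    case False
    then obtain m1 m2 where m: "m1 \<in> F" "\<And>e. e \<in> F \<Longrightarrow> m1 \<le> e" "m2 \<in> G" "\<And>e. e \<in> G \<Longrightarrow> m2 \<le> e"
      using minF minG by metis
    have "min m1 m2 \<in> B"
      using m(1,3) by (simp add: min_def F_def G_def)
    moreover have "min m1 m2 \<le> e" if "e \<in> B" for e
      using FG[OF that] m(2,4) by (auto intro: min.coboundedI1 min.coboundedI2)
    ultimately show ?thesis
      by (intro bexI ballI)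
  qed
qed

lemma series_eq_imp_eq:
  assumes vs: "vector_space (scl :: complex \<Rightarrow> 'b \<Rightarrow> 'b::ab_group_add)"
    and fg: "expanded f" "expanded g" and eq: "series_eq scl V (f, 1) (g, 1)"
  shows "f = g"
proof -
  interpret vector_space scl by (rule vs)
  obtain c where c: "c \<in> dens V" and "lact scl c f = lact scl c g"
    using eq unfolding series_eq_def by auto
  then have "lact scl c (\<lambda>e. f e - g e) = (\<lambda>_. 0)"
    unfolding lact_def fun_eq_iff by (simp add: scale_right_diff_distrib sum_subtractf)
  then have "(\<lambda>e. f e - g e) = (\<lambda>_. 0)"
    by (rule lact_eq_zero[OF vs expanded_diff[OF fg] dens_nonzero[OF c]])
  then show ?thesis
    by (simp add: fun_eq_iff)
qed


section \<open>The \<open>q\<close>-symmetrization and the star product\<close>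

type_synonym mindex = "nat \<Rightarrow> nat"

definition mindices :: "nat \<Rightarrow> mindex set" where
  "mindices N = {n. \<forall>a. a \<notin> {1..N - 1} \<longrightarrow> n a = 0}"

definition tvars :: "nat \<Rightarrow> mindex \<Rightarrow> mindex \<Rightarrow> var set" where
  "tvars N l r = {(a, i). 1 \<le> a \<and> a \<le> N - 1 \<and> l a < i \<and> i \<le> r a}"

abbreviation tvars0 :: "nat \<Rightarrow> mindex \<Rightarrow> var set" where
  "tvars0 N n \<equiv> tvars N (\<lambda>_. 0) n"

text \<open>A tuple \<open>(\<sigma>\<^sup>a)\<close> of permutations is a type-preserving permutation \<open>\<sigma>\<close> of the variables.\<close>

definition tperms :: "nat \<Rightarrow> mindex \<Rightarrow> mindex \<Rightarrow> (var \<Rightarrow> var) set" where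
  "tperms N l r = {\<sigma>. \<sigma> permutes tvars N l r \<and> (\<forall>v. fst (\<sigma> v) = fst v)}"

definition inversions :: "nat \<Rightarrow> mindex \<Rightarrow> mindex \<Rightarrow> (var \<Rightarrow> var) \<Rightarrow> (nat \<times> nat \<times> nat) set" where
  "inversions N l r \<sigma> =
     {(a, i, j). (a, i) \<in> tvars N l r \<and> (a, j) \<in> tvars N l r \<and> i < j \<and> snd (\<sigma> (a, i)) > snd (\<sigma> (a, j))}"

definition sym_factor :: "nat \<Rightarrow> complex \<Rightarrow> mindex \<Rightarrow> mindex \<Rightarrow> (var \<Rightarrow> var) \<Rightarrow> rat_fun" where
  "sym_factor N q l r \<sigma> =
     (lcst (\<Prod>a=1..N - 1. 1 / fact (r a - l a)) *
        (\<Prod>(a, i, j)\<in>inversions N l r \<sigma>. lin (1 / q) q (\<sigma> (a, j)) (\<sigma> (a, i))),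
      \<Prod>(a, i, j)\<in>inversions N l r \<sigma>. lin q (1 / q) (\<sigma> (a, j)) (\<sigma> (a, i)))"

definition qsym ::
  "(complex \<Rightarrow> 'b \<Rightarrow> 'b::comm_monoid_add) \<Rightarrow> nat \<Rightarrow> complex \<Rightarrow> mindex \<Rightarrow> mindex \<Rightarrow> 'b frac \<Rightarrow> 'b frac" where
  "qsym scl N q l r X =
     fsum scl (tperms N l r) (\<lambda>\<sigma>. rmult scl (sym_factor N q l r \<sigma>) (ren \<sigma> X))"

abbreviation qsym0 ::
  "(complex \<Rightarrow> 'b \<Rightarrow> 'b::comm_monoid_add) \<Rightarrow> nat \<Rightarrow> complex \<Rightarrow> mindex \<Rightarrow> 'b frac \<Rightarrow> 'b frac" where
  "qsym0 scl N q n \<equiv> qsym scl N q (\<lambda>_. 0) n"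

text \<open>
  A family \<open>A\<close> stands for the series in \<open>u\<^sub>1, \<dots>, u\<^sub>N\<^sub>-\<^sub>1\<close> whose coefficient with multi-index \<open>n\<close> is \<open>A n\<close>,
  in the variables \<^term>\<open>tvars0 N n\<close>.
\<close>

definition qsym_series ::
  "(complex \<Rightarrow> 'a \<Rightarrow> 'a::ring_1) \<Rightarrow> nat \<Rightarrow> complex \<Rightarrow> (mindex \<Rightarrow> 'a frac) \<Rightarrow> bool" where
  "qsym_series scl N q A \<longleftrightarrow>
     (\<forall>n\<in>mindices N. (\<forall>e. fst (A n) e \<noteq> 0 \<longrightarrow> Poly_Mapping.keys e \<subseteq> tvars0 N n) \<and>
        snd (A n) \<in> dens (tvars0 N n)) \<and>
     series_eq scl {} (A (\<lambda>_. 0)) fone \<and>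
     (\<forall>n\<in>mindices N. n \<noteq> (\<lambda>_. 0) \<longrightarrow> series_eq scl (tvars0 N n) (qsym0 scl N q n (A n)) (A n))"

definition shift :: "mindex \<Rightarrow> 'b::zero frac \<Rightarrow> 'b frac" where
  "shift s X = ren (\<lambda>(a, i). (a, i + s a)) X"

definition Zfactor :: "nat \<Rightarrow> complex \<Rightarrow> mindex \<Rightarrow> mindex \<Rightarrow> rat_fun" where
  "Zfactor N q s n =
     (\<Prod>a=1..N - 2. \<Prod>i\<in>{s a<..n a}. \<Prod>j\<in>{0<..s (a + 1)}. lin q (1 / q) (a, i) (a + 1, j),
      \<Prod>a=1..N - 2. \<Prod>i\<in>{s a<..n a}. \<Prod>j\<in>{0<..s (a + 1)}. lin 1 1 (a, i) (a + 1, j))"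

definition star ::
  "(complex \<Rightarrow> 'a \<Rightarrow> 'a::ring_1) \<Rightarrow> nat \<Rightarrow> complex \<Rightarrow> (mindex \<Rightarrow> 'a frac) \<Rightarrow> (mindex \<Rightarrow> 'a frac) \<Rightarrow>
    mindex \<Rightarrow> 'a frac" where
  "star scl N q A B n =
     fsum scl {s\<in>mindices N. \<forall>a. s a \<le> n a} (\<lambda>s.
       qsym0 scl N q n (rmult scl (Zfactor N q s n) (fmult (shift s (A (\<lambda>a. n a - s a))) (B s))))"

definition is_star_one ::
  "(complex \<Rightarrow> 'a \<Rightarrow> 'a::ring_1) \<Rightarrow> nat \<Rightarrow> (mindex \<Rightarrow> 'a frac) \<Rightarrow> bool" where
  "is_star_one scl N A \<longleftrightarrow>
     (\<forall>n\<in>mindices N. series_eq scl (tvars0 N n) (A n) (if n = (\<lambda>_. 0) then fone else fzero))"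

definition is_star_inverse ::
  "(complex \<Rightarrow> 'a \<Rightarrow> 'a::ring_1) \<Rightarrow> nat \<Rightarrow> complex \<Rightarrow> (mindex \<Rightarrow> 'a frac) \<Rightarrow> (mindex \<Rightarrow> 'a frac) \<Rightarrow> bool" where
  "is_star_inverse scl N q A D \<longleftrightarrow>
     qsym_series scl N q D \<and> is_star_one scl N (star scl N q D A) \<and> is_star_one scl N (star scl N q A D)"


section \<open>Dual strings\<close>

text \<open>The variables \<open>t\<^sup>1\<^sub>m\<close> and \<open>t\<^sup>2\<^sub>m\<close> of the function \<open>V\<close> are \<open>x m\<close> and \<open>y m\<close>, for \<open>1 \<le> m \<le> l\<close>.\<close>

definition Vtilde :: "complex \<Rightarrow> nat \<Rightarrow> (nat \<Rightarrow> var) \<Rightarrow> (nat \<Rightarrow> var) \<Rightarrow> rat_fun" where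
  "Vtilde q l y x =
     (\<Prod>m=1..l. \<Prod>m'=m + 1..l. lin q (1 / q) (x m') (y m),
      \<Prod>m=1..l. lin 1 1 (x m) (y m) * (\<Prod>m'=m + 1..l. lin 1 1 (x m') (y m)))"

definition string_Vtilde :: "complex \<Rightarrow> mindex \<Rightarrow> nat \<Rightarrow> rat_fun" where
  "string_Vtilde q s a =
     Vtilde q (s (a + 1)) (\<lambda>m. (a + 1, m)) (\<lambda>m. (a, s a - s (a + 1) + m))"

definition string_factor :: "nat \<Rightarrow> complex \<Rightarrow> mindex \<Rightarrow> rat_fun" where
  "string_factor N q s =
     (lcst (\<Prod>a=2..N. 1 / fact (s (a - 1) - s a)) * (\<Prod>a=1..N - 2. fst (string_Vtilde q s a)),
      \<Prod>a=1..N - 2. snd (string_Vtilde q s a))"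

text \<open>The pairs \<open>(a, l)\<close> of the factors \<open>F\<^sub>a\<^sub>,\<^sub>1(t\<^sup>1\<^sub>l)\<close> of the string, from left to right.\<close>

definition string_list :: "nat \<Rightarrow> mindex \<Rightarrow> (nat \<times> nat) list" where
  "string_list N s =
     concat (map (\<lambda>a. map (\<lambda>l. (a, l)) (rev [s 1 - s (a - 1) + 1 ..< s 1 - s a + 1])) (rev [2 ..< N + 1]))"

text \<open>As \<open>F(t) = \<Sum>n. F[n] t\<^sup>-\<^sup>n\<close>, the coefficient of \<open>t\<^sup>e\<close> is the mode number \<open>- e\<close>.\<close>

definition string_currents :: "nat \<Rightarrow> complex \<Rightarrow> mindex \<Rightarrow> wseries dist" where
  "string_currents N q s e =
     (if Poly_Mapping.keys e \<subseteq> {1} \<times> {1..s 1}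
      then foldr wmult
        (map (\<lambda>(a, l). Fcomp q 1 (a - 2) (- Poly_Mapping.lookup e (1, l))) (string_list N s)) wone
      else 0)"

definition dual_string :: "nat \<Rightarrow> complex \<Rightarrow> mindex \<Rightarrow> wseries frac" where
  "dual_string N q s = rmult wscale (string_factor N q s) (string_currents N q s, 1)"

definition noninc :: "nat \<Rightarrow> mindex \<Rightarrow> bool" where
  "noninc N s \<longleftrightarrow> s \<in> mindices N \<and> (\<forall>a. 1 \<le> a \<and> a + 1 \<le> N - 1 \<longrightarrow> s (a + 1) \<le> s a)"

text \<open>
  The coefficients of the generating series of negative projections of dual strings; the projection
  commutes with multiplication by rational functions and acts on the numerator.
\<close>

definition Eser ::
  "nat \<Rightarrow> complex \<Rightarrow> (free \<Rightarrow> 'a::ring_1) \<Rightarrow> ('a \<Rightarrow> 'a) \<Rightarrow> mindex \<Rightarrow> 'a frac" where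
  "Eser N q \<phi> P s =
     (if noninc N s
      then (let X = qsym0 wscale N q s (dual_string N q s) in (\<lambda>e. Pbar \<phi> P (fst X e), snd X))
      else fzero)"


section \<open>Tableaux\<close>

text \<open>
  A tableau is the list of its rows from bottom to top, a row the list of the types of its boxes.
  Row and partial-sum indices start at 0: \<open>\<chi> ! i\<close> is row number \<open>i + 1\<close>, and \<open>row_sums N \<chi> i\<close> is
  the multi-index \<open>(h\<^sup>i\<^sub>a)\<close>.
\<close>

definition connected_tableau :: "nat \<Rightarrow> nat list list \<Rightarrow> bool" where
  "connected_tableau N \<chi> \<longleftrightarrow>
     \<chi> \<noteq> [] \<and> (\<forall>row\<in>set \<chi>. row \<noteq> [] \<and> set row \<subseteq> {1..N - 1} \<and> sorted_wrt (\<ge>) row)"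

definition row_count :: "nat \<Rightarrow> nat list \<Rightarrow> mindex" where
  "row_count N row = (\<lambda>a. if 1 \<le> a \<and> a \<le> N - 1 then length (filter (\<lambda>x. a \<le> x) row) else 0)"

definition row_sums :: "nat \<Rightarrow> nat list list \<Rightarrow> nat \<Rightarrow> mindex" where
  "row_sums N \<chi> i = (\<lambda>a. \<Sum>j<i. row_count N (\<chi> ! j) a)"

definition weight :: "nat \<Rightarrow> nat list list \<Rightarrow> mindex" where
  "weight N \<chi> = row_sums N \<chi> (length \<chi>)"

definition Ztableau :: "nat \<Rightarrow> complex \<Rightarrow> nat list list \<Rightarrow> rat_fun" where
  "Ztableau N q \<chi> =
     (let h = row_sums N \<chi> in
      (\<Prod>j<length \<chi>. \<Prod>i<j. \<Prod>a=1..N - 2. \<Prod>k\<in>{h j a<..h (j + 1) a}.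
         \<Prod>k'\<in>{h i (a + 1)<..h (i + 1) (a + 1)}. lin q (1 / q) (a, k) (a + 1, k'),
       \<Prod>j<length \<chi>. \<Prod>i<j. \<Prod>a=1..N - 2. \<Prod>k\<in>{h j a<..h (j + 1) a}.
         \<Prod>k'\<in>{h i (a + 1)<..h (i + 1) (a + 1)}. lin 1 1 (a, k) (a + 1, k')))"

text \<open>The top row stands leftmost in the product.\<close>

definition Etableau ::
  "nat \<Rightarrow> complex \<Rightarrow> (free \<Rightarrow> 'a::ring_1) \<Rightarrow> ('a \<Rightarrow> 'a) \<Rightarrow> nat list list \<Rightarrow> 'a frac" where
  "Etableau N q \<phi> P \<chi> =
     foldr fmult
       (rev (map (\<lambda>i. shift (row_sums N \<chi> i) (Eser N q \<phi> P (row_count N (\<chi> ! i)))) [0 ..< length \<chi>]))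
       fone"

definition tableau_term ::
  "nat \<Rightarrow> complex \<Rightarrow> (free \<Rightarrow> 'a::ring_1) \<Rightarrow> ('a \<Rightarrow> 'a) \<Rightarrow> nat list list \<Rightarrow> 'a frac" where
  "tableau_term N q \<phi> P \<chi> =
     rmult (uscale \<phi>) (lcst ((- 1) ^ length \<chi>), 1)
       (qsym0 (uscale \<phi>) N q (weight N \<chi>)
          (rmult (uscale \<phi>) (Ztableau N q \<chi>) (Etableau N q \<phi> P \<chi>)))"

end

theory Submission
  imports Defs
begin

text \<open>
  The coefficient at \<open>n \<noteq> 0\<close> of \<open>\<E> \<star> \<D> = 1\<close> expresses \<open>\<D>\<close> at \<open>n\<close>, which is its own
  \<open>q\<close>-symmetrization, through the values of \<open>\<D>\<close> at smaller indices \<open>s\<close>. As \<open>\<E>\<close> vanishes at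
  \<open>n - s\<close> unless \<open>n - s\<close> is non-increasing, and non-increasing indices correspond to rows, one step
  of this recursion puts a top row on a tableau of weight \<open>s\<close> and changes the sign. The inner
  symmetrization over the variables of the smaller tableau is absorbed by the outer one, because the
  factors of the \<open>q\<close>-symmetrization form a cocycle, the coefficient of the new row does not involve these
  variables, and \<open>Z\<^sub>s\<close> is invariant under permuting them.
\<close>

text \<open>The recursion cannot be run with literal equalities of series. A coefficient is a pair
  standing for \<open>f / d\<close>, and transitivity of \<open>series_eq\<close> needs a middle
  denominator in \<open>dens V\<close>: multiplication by a Laurent polynomial can kill a nonzero
  distribution, as 1 - x/y kills the sum of all powers of x/y, so a denominator cannot simply be
  cancelled. Hence every intermediate expression is confined to \<open>fracs_in V\<close>, with V
  the variables of the coefficient at hand; there the pairs behave like a localized module. Sums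
  over permutations, multi-indices and tableaux are compared over a common denominator. Products are
  convolutions, which make sense only because the factors have disjoint variables; this is why each
  row is shifted above the variables already in use.\<close>

lemma poly_mapping_additive_induct [case_names single add]:
  assumes single: "\<And>d c. Q (Poly_Mapping.single d c)"
    and add: "\<And>p r. Q p \<Longrightarrow> Q r \<Longrightarrow> Q (p + r)"
  shows "Q (p :: 'k \<Rightarrow>\<^sub>0 'c::monoid_add)"
proof (induction p rule: update_induct)
  case const
  then show ?case using single[of undefined 0] by simp
next
  case (update f a b)
  then have "Poly_Mapping.update a b f = f + Poly_Mapping.single a b"
    by (intro poly_mapping_eqI)
      (auto simp: lookup_update lookup_add lookup_single when_def in_keys_iff)
  then show ?case using update add single by simp
qed

text \<open>Cancellation can make the keys of \<open>p + r\<close> fewer than those of the summands,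
  so all three sums are extended to the union of the keys, where the extra terms vanish. This makes
  \<open>ren_laurent\<close> and \<open>lact\<close> additive in the Laurent polynomial.\<close>

lemma poly_mapping_sum_add:
  assumes zero: "\<And>d. h d 0 = 0" and add: "\<And>d a b. h d (a + b) = h d a + h d b"
  shows "(\<Sum>d\<in>Poly_Mapping.keys (p + r). h d (Poly_Mapping.lookup (p + r) d)) =
    (\<Sum>d\<in>Poly_Mapping.keys p. h d (Poly_Mapping.lookup p d)) +
    (\<Sum>d\<in>Poly_Mapping.keys r. h d (Poly_Mapping.lookup r d) :: 'b::comm_monoid_add)"
proof -
  let ?K = "Poly_Mapping.keys p \<union> Poly_Mapping.keys r"
  have ext: "(\<Sum>d\<in>Poly_Mapping.keys s. h d (Poly_Mapping.lookup s d)) =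
      (\<Sum>d\<in>?K. h d (Poly_Mapping.lookup s d))" if "Poly_Mapping.keys s \<subseteq> ?K" for s
    using that by (intro sum.mono_neutral_left) (auto simp: in_keys_iff zero)
  show ?thesis
    unfolding ext[OF keys_add] ext[OF Un_upper1] ext[OF Un_upper2]
    by (simp add: lookup_add add sum.distrib)
qed

section \<open>Substitution of variables\<close>

text \<open>Exponents form the free abelian group on the variables, and a substitution of variables
  induces a homomorphism of it; the theory of free abelian groups then yields additivity and
  functoriality.\<close>

lemma ren_expo_eq: "ren_expo \<rho> = frag_extend (frag_of \<circ> \<rho>)"
  unfolding ren_expo_def frag_extend_def
  by (intro ext sum.cong) (auto intro!: poly_mapping_eqI simp: lookup_single when_def)

lemma ren_expo_zero [simp]: "ren_expo \<rho> 0 = 0"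
  by (simp add: ren_expo_eq)

lemma ren_expo_add: "ren_expo \<rho> (d + e) = ren_expo \<rho> d + ren_expo \<rho> e"
  by (simp add: ren_expo_eq frag_extend_add)

lemma ren_expo_diff: "ren_expo \<rho> (d - e) = ren_expo \<rho> d - ren_expo \<rho> e"
  by (simp add: ren_expo_eq frag_extend_diff)

lemma ren_expo_comp: "ren_expo \<sigma> (ren_expo \<tau> e) = ren_expo (\<sigma> \<circ> \<tau>) e"
  by (simp add: ren_expo_eq frag_extend_compose comp_assoc)

lemma ren_expo_cong: "(\<And>v. v \<in> Poly_Mapping.keys e \<Longrightarrow> \<rho> v = v) \<Longrightarrow> ren_expo \<rho> e = e"
  unfolding ren_expo_eq
  by (subst (2) frag_expansion) (auto intro: frag_extend_eq)

lemma ren_expo_id [simp]: "ren_expo id e = e"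
  by (rule ren_expo_cong) simp

lemma keys_ren_expo: "Poly_Mapping.keys (ren_expo \<rho> e) \<subseteq> \<rho> ` Poly_Mapping.keys e"
  unfolding ren_expo_eq using keys_frag_extend[of "frag_of \<circ> \<rho>" e] by auto

lemma ren_expo_inv:
  assumes "inj \<rho>" shows "ren_expo (inv \<rho>) (ren_expo \<rho> e) = e"
  using assms by (simp add: ren_expo_comp)

lemma inj_ren_expo: "inj \<rho> \<Longrightarrow> inj (ren_expo \<rho>)"
  by (metis injI ren_expo_inv)

lemma ren_expo_inv':
  assumes "bij \<rho>" shows "ren_expo \<rho> (ren_expo (inv \<rho>) e) = e"
  using assms by (simp add: ren_expo_comp bij_is_surj surj_iff[symmetric] surj_iff[THEN iffD1])

lemma bij_ren_expo: "bij \<rho> \<Longrightarrow> bij (ren_expo \<rho>)"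
  by (metis bij_is_inj bij_def inj_ren_expo ren_expo_inv' surjI)

lemma ren_dist_ren_expo: "inj \<rho> \<Longrightarrow> ren_dist \<rho> f (ren_expo \<rho> e) = f e"
  by (simp add: ren_dist_def inj_ren_expo)

text \<open>For a bijective substitution every exponent is in the range of \<open>ren_expo\<close>,
  so the default value 0 in \<open>ren_dist\<close> disappears.\<close>

lemma ren_dist_bij: "bij \<rho> \<Longrightarrow> ren_dist \<rho> f e = f (ren_expo (inv \<rho>) e)"
  by (metis bij_is_inj ren_dist_ren_expo ren_expo_inv')

lemma ren_dist_comp:
  assumes "bij \<sigma>" "bij \<tau>"
  shows "ren_dist \<sigma> (ren_dist \<tau> f) = ren_dist (\<sigma> \<circ> \<tau>) f"
  using assms by (simp add: fun_eq_iff ren_dist_bij ren_expo_comp bij_comp o_inv_distrib)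

lemma ren_laurent_single:
  "ren_laurent \<rho> (Poly_Mapping.single e c) = Poly_Mapping.single (ren_expo \<rho> e) c"
  by (simp add: ren_laurent_def)

lemma ren_laurent_add: "ren_laurent \<rho> (p + r) = ren_laurent \<rho> p + ren_laurent \<rho> r"
  unfolding ren_laurent_def by (rule poly_mapping_sum_add) (simp_all add: single_add)

lemma ren_laurent_mult: "ren_laurent \<rho> (p * r) = ren_laurent \<rho> p * ren_laurent \<rho> r"
proof (induction p rule: poly_mapping_additive_induct)
  case (single d c)
  show ?case
    by (induction r rule: poly_mapping_additive_induct)
      (simp_all add: mult_single ren_laurent_single ren_laurent_add ren_expo_add distrib_left)
qed (simp add: ren_laurent_add distrib_right)

lemma ren_laurent_lcst [simp]: "ren_laurent \<rho> (lcst c) = lcst c"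
  by (simp add: lcst_def ren_laurent_single)

lemma lcst_1 [simp]: "lcst 1 = 1"
  by (simp add: lcst_def)

lemma lcst_mult: "lcst (a * b) = lcst a * lcst b"
  by (simp add: lcst_def mult_single)

lemma ren_laurent_1 [simp]: "ren_laurent \<rho> 1 = 1"
  using ren_laurent_lcst[of \<rho> 1] by simp

lemma ren_laurent_prod: "ren_laurent \<rho> (\<Prod>i\<in>I. f i) = (\<Prod>i\<in>I. ren_laurent \<rho> (f i))"
  by (induction I rule: infinite_finite_induct) (simp_all add: ren_laurent_mult)

lemma ren_laurent_diff: "ren_laurent \<rho> (p - r) = ren_laurent \<rho> p - ren_laurent \<rho> r"
  using ren_laurent_add[of \<rho> "p - r" r] by (simp add: algebra_simps)

lemma ren_laurent_lin [simp]: "ren_laurent \<rho> (lin \<alpha> \<beta> x y) = lin \<alpha> \<beta> (\<rho> x) (\<rho> y)"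
  by (simp add: lin_def ren_laurent_diff ren_laurent_mult lratio_def ren_laurent_single
      ren_expo_diff ren_expo_eq frag_extend_diff)

lemma ren_laurent_comp: "ren_laurent \<sigma> (ren_laurent \<tau> p) = ren_laurent (\<sigma> \<circ> \<tau>) p"
  by (induction p rule: poly_mapping_additive_induct)
    (simp_all add: ren_laurent_single ren_laurent_add ren_expo_comp del: comp_apply)

lemma ren_comp: "bij \<sigma> \<Longrightarrow> bij \<tau> \<Longrightarrow> ren \<sigma> (ren \<tau> X) = ren (\<sigma> \<circ> \<tau>) X"
  by (simp add: ren_def ren_dist_comp ren_laurent_comp)

section \<open>Laurent polynomials and series in given variables\<close>

definition laurents_in :: "var set \<Rightarrow> laurent set" where
  "laurents_in V = {p. \<forall>d\<in>Poly_Mapping.keys p. Poly_Mapping.keys d \<subseteq> V}"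

lemma laurents_in_mono: "V \<subseteq> W \<Longrightarrow> laurents_in V \<subseteq> laurents_in W"
  by (auto simp: laurents_in_def)

lemma laurents_in_mult:
  assumes "p \<in> laurents_in V" "r \<in> laurents_in V" shows "p * r \<in> laurents_in V"
  unfolding laurents_in_def
proof safe
  fix d v assume "d \<in> Poly_Mapping.keys (p * r)" and v: "v \<in> Poly_Mapping.keys d"
  then obtain a b where "a \<in> Poly_Mapping.keys p" "b \<in> Poly_Mapping.keys r" "d = a + b"
    using keys_mult[of p r] by auto
  then show "v \<in> V"
    using assms v keys_add[of a b] unfolding laurents_in_def by blast
qed

lemma laurents_in_lcst [simp]: "lcst c \<in> laurents_in V"
  by (simp add: laurents_in_def lcst_def)

lemma laurents_in_1 [simp]: "1 \<in> laurents_in V"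
  by (simp add: laurents_in_def)

lemma laurents_in_prod: "(\<And>i. i \<in> I \<Longrightarrow> f i \<in> laurents_in V) \<Longrightarrow> prod f I \<in> laurents_in V"
  by (induction I rule: infinite_finite_induct) (simp_all add: laurents_in_mult)

lemma laurents_in_lin [simp]: "x \<in> V \<Longrightarrow> y \<in> V \<Longrightarrow> lin \<alpha> \<beta> x y \<in> laurents_in V"
  using keys_diff[of "frag_of x" "frag_of y"]
  by (auto simp: laurents_in_def lin_def lcst_def lratio_def mult_single
      dest!: keys_diff[THEN subsetD] split: if_splits)

lemma dens_subset_laurents_in: "dens V \<subseteq> laurents_in V"
proof
  show "c \<in> laurents_in V" if "c \<in> dens V" for c
    using that by induction (auto intro: laurents_in_mult)
qed

lemma dens_mult: "c \<in> dens V \<Longrightarrow> d \<in> dens V \<Longrightarrow> c * d \<in> dens V"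
  by (induction rule: dens.induct) (auto simp: mult.assoc intro: dens.factor)

lemma dens_prod: "(\<And>i. i \<in> I \<Longrightarrow> f i \<in> dens V) \<Longrightarrow> prod f I \<in> dens V"
  by (induction I rule: infinite_finite_induct) (auto intro: dens.one dens_mult)

lemma dens_mono: "V \<subseteq> W \<Longrightarrow> dens V \<subseteq> dens W"
proof
  show "c \<in> dens W" if "V \<subseteq> W" "c \<in> dens V" for c
    using that(2,1) by induction (auto intro: dens.intros)
qed

lemma lin_in_dens: "x \<in> V \<Longrightarrow> y \<in> V \<Longrightarrow> x \<noteq> y \<Longrightarrow> \<alpha> \<noteq> 0 \<Longrightarrow> \<beta> \<noteq> 0 \<Longrightarrow> lin \<alpha> \<beta> x y \<in> dens V"
  using dens.factor[OF dens.one] by simp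

text \<open>Injectivity on \<open>V\<close> keeps the two variables of a factor distinct, as
  \<open>dens\<close> demands.\<close>

lemma ren_laurent_dens:
  assumes "inj_on \<rho> V" "c \<in> dens V" shows "ren_laurent \<rho> c \<in> dens (\<rho> ` V)"
  using assms(2,1)
  by (induction) (auto simp: ren_laurent_mult inj_on_eq_iff intro: dens.intros)

definition supp_in :: "var set \<Rightarrow> 'b::zero dist \<Rightarrow> bool" where
  "supp_in V f \<longleftrightarrow> (\<forall>e. f e \<noteq> 0 \<longrightarrow> Poly_Mapping.keys e \<subseteq> V)"

lemma supp_in_mono: "supp_in V f \<Longrightarrow> V \<subseteq> W \<Longrightarrow> supp_in W f"
  by (auto simp: supp_in_def)

lemma supp_in_sum: "(\<And>i. i \<in> I \<Longrightarrow> supp_in V (f i)) \<Longrightarrow> supp_in V (\<lambda>e. \<Sum>i\<in>I. f i e)"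
  unfolding supp_in_def by (metis sum.neutral)

lemma supp_in_lact:
  assumes "\<And>c. scl c 0 = 0" "p \<in> laurents_in V" "supp_in V f"
  shows "supp_in V (lact scl p f)"
  unfolding supp_in_def
proof safe
  fix e v assume "lact scl p f e \<noteq> 0" and v: "v \<in> Poly_Mapping.keys e"
  then obtain d where d: "d \<in> Poly_Mapping.keys p" "f (e - d) \<noteq> 0"
    unfolding lact_def using assms(1) by (metis (mono_tags, lifting) sum.neutral)
  moreover have "Poly_Mapping.keys e \<subseteq> Poly_Mapping.keys d \<union> Poly_Mapping.keys (e - d)"
    using keys_add[of d "e - d"] by simp
  ultimately show "v \<in> V"
    using assms(2,3) v by (force simp: supp_in_def laurents_in_def)
qed

lemma supp_in_ren: "inj \<rho> \<Longrightarrow> supp_in V f \<Longrightarrow> supp_in (\<rho> ` V) (ren_dist \<rho> f)"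
  unfolding supp_in_def
proof (intro allI impI)
  fix e assume "inj \<rho>" "\<forall>e. f e \<noteq> 0 \<longrightarrow> Poly_Mapping.keys e \<subseteq> V" "ren_dist \<rho> f e \<noteq> 0"
  then obtain d where "e = ren_expo \<rho> d" "Poly_Mapping.keys d \<subseteq> V"
    by (metis rangeE ren_dist_def ren_dist_ren_expo)
  then show "Poly_Mapping.keys e \<subseteq> \<rho> ` V"
    using keys_ren_expo[of \<rho> d] by blast
qed

text \<open>On these, \<^const>\<open>series_eq\<close> is equality in the localization at \<^term>\<open>dens V\<close>, hence transitive.\<close>

definition fracs_in :: "var set \<Rightarrow> 'b::zero frac set" where
  "fracs_in V = {X. supp_in V (fst X) \<and> snd X \<in> dens V}"

lemma fracs_in_mono: "V \<subseteq> W \<Longrightarrow> fracs_in V \<subseteq> fracs_in W"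
  using dens_mono by (auto simp: fracs_in_def intro: supp_in_mono)

lemma fracs_in_rmult:
  assumes "\<And>c. scl c 0 = 0" "fst r \<in> laurents_in V" "snd r \<in> dens V" "X \<in> fracs_in V"
  shows "rmult scl r X \<in> fracs_in V"
  using assms by (auto simp: fracs_in_def rmult_def intro: dens_mult supp_in_lact)

lemma fracs_in_fsum:
  assumes "\<And>c. scl c 0 = 0" "\<And>i. i \<in> I \<Longrightarrow> X i \<in> fracs_in V"
  shows "fsum scl I X \<in> fracs_in V"
  using assms dens_subset_laurents_in[of V]
  by (auto simp: fracs_in_def fsum_def intro!: dens_prod supp_in_sum supp_in_lact laurents_in_prod)

lemma fracs_in_ren:
  assumes "inj \<rho>" "X \<in> fracs_in V" shows "ren \<rho> X \<in> fracs_in (\<rho> ` V)"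
  using assms by (auto simp: fracs_in_def ren_def intro: supp_in_ren ren_laurent_dens inj_on_subset)

lemma fracs_in_fmult:
  assumes "X \<in> fracs_in V" "Y \<in> fracs_in W" shows "fmult X Y \<in> fracs_in (V \<union> W)"
proof -
  have "supp_in (V \<union> W) (\<lambda>e. Sum_any (\<lambda>d. fst X d * fst Y (e - d)))"
    unfolding supp_in_def
  proof safe
    fix e a b
    assume "Sum_any (\<lambda>d. fst X d * fst Y (e - d)) \<noteq> 0" and v: "(a, b) \<in> Poly_Mapping.keys e" "(a, b) \<notin> W"
    then obtain d where "fst X d * fst Y (e - d) \<noteq> 0"
      by (meson Sum_any.not_neutral_obtains_not_neutral)
    then have "fst X d \<noteq> 0" "fst Y (e - d) \<noteq> 0" by auto
    then have "Poly_Mapping.keys d \<subseteq> V" "Poly_Mapping.keys (e - d) \<subseteq> W"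
      using assms by (auto simp: fracs_in_def supp_in_def)
    moreover have "Poly_Mapping.keys e \<subseteq> Poly_Mapping.keys d \<union> Poly_Mapping.keys (e - d)"
      using keys_add[of d "e - d"] by simp
    ultimately show "(a, b) \<in> V" using v by auto
  qed
  then show ?thesis
    using assms dens_mono[of V "V \<union> W"] dens_mono[of W "V \<union> W"]
    by (auto simp: fracs_in_def fmult_def intro: dens_mult)
qed

lemma fracs_in_fone [simp]: "fone \<in> fracs_in V"
  by (auto simp: fracs_in_def fone_def supp_in_def dens.one)

lemma fracs_in_fzero [simp]: "fzero \<in> fracs_in V"
  by (auto simp: fracs_in_def fzero_def supp_in_def dens.one)

section \<open>Fractions as a localized module\<close>

text \<open>Two instances are needed: word series with \<open>wscale\<close>, where the strings are
  symmetrized before projection, and the quantum algebra with \<open>uscale\<close>.\<close>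

locale scalar_module = module scl for scl :: "complex \<Rightarrow> 'b::ab_group_add \<Rightarrow> 'b"
begin

lemma lact_single: "lact scl (Poly_Mapping.single d c) f e = scl c (f (e - d))"
  by (simp add: lact_def)

lemma lact_add: "lact scl (p + r) f e = lact scl p f e + lact scl r f e"
  unfolding lact_def by (rule poly_mapping_sum_add) (simp_all add: scale_left_distrib)

text \<open>Distributions have no product in general, but a Laurent polynomial has finitely many
  terms, so they form a module over the Laurent polynomials. Additivity in both polynomials reduces
  the claim to monomials.\<close>

lemma lact_mult: "lact scl (p * r) f = lact scl p (lact scl r f)"
proof (induction p rule: poly_mapping_additive_induct)
  case (single d c)
  have "lact scl (Poly_Mapping.single d c * r) f e = lact scl (Poly_Mapping.single d c) (lact scl r f) e" for e
    by (induction r rule: poly_mapping_additive_induct)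
      (simp_all add: mult_single lact_single lact_add distrib_left scale_right_distrib diff_diff_eq)
  then show ?case by blast
qed (simp add: distrib_right lact_add fun_eq_iff)

lemma lact_lcst: "lact scl (lcst c) f e = scl c (f e)"
  by (simp add: lcst_def lact_single)

lemma lact_1 [simp]: "lact scl 1 f = f"
  using lact_lcst[of 1 f] by (simp add: fun_eq_iff)

lemma lact_sum: "lact scl p (\<lambda>e. \<Sum>i\<in>I. f i e) = (\<lambda>e. \<Sum>i\<in>I. lact scl p (f i) e)"
  by (simp add: lact_def fun_eq_iff scale_sum_right sum.swap[of _ I])

lemma lact_zero [simp]: "lact scl p (\<lambda>_. 0) = (\<lambda>_. 0)"
  by (simp add: lact_def)

lemma ren_dist_lact:
  assumes "bij \<rho>"
  shows "ren_dist \<rho> (lact scl p f) = lact scl (ren_laurent \<rho> p) (ren_dist \<rho> f)"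
proof -
  have "lact scl p f (ren_expo (inv \<rho>) e) = lact scl (ren_laurent \<rho> p) (\<lambda>e. f (ren_expo (inv \<rho>) e)) e" for e
    by (induction p rule: poly_mapping_additive_induct)
      (simp_all add: lact_add ren_laurent_add ren_laurent_single lact_single ren_expo_diff
        ren_expo_inv bij_is_inj assms)
  then show ?thesis
    by (simp add: ext[OF ren_dist_bij[OF assms]] fun_eq_iff)
qed

lemma series_eq_refl [intro, simp]: "series_eq scl V X X"
  unfolding series_eq_def using dens.one by blast

lemma series_eq_sym: "series_eq scl V X Y \<Longrightarrow> series_eq scl V Y X"
  unfolding series_eq_def by metis

text \<open>The common multiplier is \<open>c * d\<close> times the middle denominator. As that
  denominator may annihilate a distribution, it is absorbed into the multiplier instead of being
  cancelled, and so must lie in \<open>dens V\<close> itself.\<close>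

lemma series_eq_trans [trans]:
  assumes "series_eq scl V X Y" "series_eq scl V Y Z" and "snd Y \<in> dens V"
  shows "series_eq scl V X Z"
proof -
  obtain c d where c: "c \<in> dens V" "lact scl (c * snd Y) (fst X) = lact scl (c * snd X) (fst Y)"
    and d: "d \<in> dens V" "lact scl (d * snd Z) (fst Y) = lact scl (d * snd Y) (fst Z)"
    using assms by (auto simp: series_eq_def)
  have "lact scl (c * d * snd Y * snd Z) (fst X) = lact scl (d * snd Z) (lact scl (c * snd Y) (fst X))"
    by (simp add: lact_mult[symmetric] mult_ac)
  also have "\<dots> = lact scl (c * snd X) (lact scl (d * snd Z) (fst Y))"
    by (simp only: c) (simp add: lact_mult[symmetric] mult_ac)
  also have "\<dots> = lact scl (c * d * snd Y * snd X) (fst Z)"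
    by (simp only: d) (simp add: lact_mult[symmetric] mult_ac)
  finally show ?thesis
    unfolding series_eq_def using c d assms(3) by (intro bexI[of _ "c * d * snd Y"]) (auto intro: dens_mult)
qed

lemma series_eq_common:
  assumes "series_eq scl V X Z" "series_eq scl V Y Z" and "snd Z \<in> dens V"
  shows "series_eq scl V X Y"
  using series_eq_trans[OF assms(1) series_eq_sym[OF assms(2)] assms(3)] .

lemma series_eq_mono: "series_eq scl V X Y \<Longrightarrow> V \<subseteq> W \<Longrightarrow> series_eq scl W X Y"
  unfolding series_eq_def using dens_mono by blast

lemma series_eq_cancel: "c \<in> dens V \<Longrightarrow> series_eq scl V (lact scl c f, c * d) (f, d)"
  unfolding series_eq_def
  by (intro bexI[OF _ dens.one]) (simp add: lact_mult[symmetric] mult_ac)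

lemma rmult_cong: "series_eq scl V X Y \<Longrightarrow> series_eq scl V (rmult scl r X) (rmult scl r Y)"
proof -
  assume "series_eq scl V X Y"
  then obtain c where c: "c \<in> dens V" "lact scl (c * snd Y) (fst X) = lact scl (c * snd X) (fst Y)"
    by (auto simp: series_eq_def)
  have "lact scl (c * (snd r * snd Y)) (lact scl (fst r) (fst X)) =
      lact scl (snd r * fst r) (lact scl (c * snd Y) (fst X))"
    by (simp add: lact_mult[symmetric] mult_ac)
  also have "\<dots> = lact scl (c * (snd r * snd X)) (lact scl (fst r) (fst Y))"
    by (simp only: c) (simp add: lact_mult[symmetric] mult_ac)
  finally show ?thesis
    unfolding series_eq_def rmult_def using c by auto
qed

lemma rmult_rmult: "rmult scl r (rmult scl r' X) = rmult scl (fst r * fst r', snd r * snd r') X"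
  by (simp add: rmult_def lact_mult mult_ac)

lemma rmult_one [simp]: "rmult scl (1, 1) X = X"
  by (simp add: rmult_def)

lemma rmult_eqI:
  assumes "fst r * snd r' = fst r' * snd r"
  shows "series_eq scl V (rmult scl r X) (rmult scl r' X)"
  unfolding series_eq_def rmult_def
  by (intro bexI[OF _ dens.one])
    (simp add: lact_mult[symmetric] mult_ac assms[symmetric] arg_cong[OF assms, of "\<lambda>z. snd X * z", simplified mult_ac])

lemma ren_rmult:
  assumes "bij \<rho>"
  shows "ren \<rho> (rmult scl r X) = rmult scl (ren_laurent \<rho> (fst r), ren_laurent \<rho> (snd r)) (ren \<rho> X)"
  by (simp add: ren_def rmult_def ren_dist_lact[OF assms] ren_laurent_mult)

lemma ren_cong:
  assumes "\<rho> permutes V" "series_eq scl V X Y"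
  shows "series_eq scl V (ren \<rho> X) (ren \<rho> Y)"
proof -
  have bij: "bij \<rho>" using assms(1) by (rule permutes_bij)
  obtain c where c: "c \<in> dens V" "lact scl (c * snd Y) (fst X) = lact scl (c * snd X) (fst Y)"
    using assms by (auto simp: series_eq_def)
  have "ren_laurent \<rho> c \<in> dens V"
    using ren_laurent_dens[OF _ c(1), of \<rho>] assms(1)
    by (simp add: permutes_inj_on permutes_image)
  then show ?thesis
    using arg_cong[OF c(2), of "ren_dist \<rho>"]
    by (auto simp: series_eq_def ren_def ren_dist_lact[OF bij] ren_laurent_mult)
qed

lemma ren_fsum:
  assumes "bij \<rho>" shows "ren \<rho> (fsum scl I X) = fsum scl I (\<lambda>i. ren \<rho> (X i))"
proof -
  have "ren_dist \<rho> (\<lambda>e. \<Sum>i\<in>I. f i e) = (\<lambda>e. \<Sum>i\<in>I. ren_dist \<rho> (f i) e)" for f :: "_ \<Rightarrow> 'b dist"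
    by (simp add: ren_dist_bij[OF assms] fun_eq_iff)
  then show ?thesis
    by (simp add: ren_def fsum_def ren_laurent_prod ren_dist_lact[OF assms])
qed

text \<open>\<open>fsum\<close> multiplies all denominators together, so its literal value changes
  under regrouping. Over one denominator \<open>d\<close> it becomes an ordinary sum of numerators;
  congruence, regrouping, swapping and linearity of \<open>fsum\<close> all come from this normal
  form.\<close>

lemma fsum_common_denominator:
  assumes I: "finite I" and X: "\<And>i. i \<in> I \<Longrightarrow> snd (X i) \<in> dens V"
    and f: "\<And>i. i \<in> I \<Longrightarrow> series_eq scl V (X i) (f i, d)"
  shows "series_eq scl V (fsum scl I X) (\<lambda>e. \<Sum>i\<in>I. f i e, d)"
proof -
  obtain c where c: "\<And>i. i \<in> I \<Longrightarrow> c i \<in> dens V"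
    "\<And>i. i \<in> I \<Longrightarrow> lact scl (c i * d) (fst (X i)) = lact scl (c i * snd (X i)) (f i)"
    using f unfolding series_eq_def by simp metis
  \<comment> \<open>One multiplier for all summands: each \<open>c i\<close> divides
    \<open>C\<close>, and the remaining factors multiply both sides of its equation.\<close>
  define C where "C = prod c I"
  have C: "C = (\<Prod>j\<in>I - {i}. c j) * c i" if "i \<in> I" for i
    unfolding C_def using that I by (simp add: prod.remove mult.commute)
  have "lact scl (C * d) (lact scl (\<Prod>j\<in>I - {i}. snd (X j)) (fst (X i))) =
      lact scl (C * (\<Prod>j\<in>I. snd (X j))) (f i)" if i: "i \<in> I" for i
  proof -
    have "lact scl (C * d) (lact scl (\<Prod>j\<in>I - {i}. snd (X j)) (fst (X i))) =
        lact scl ((\<Prod>j\<in>I - {i}. c j) * (\<Prod>j\<in>I - {i}. snd (X j))) (lact scl (c i * d) (fst (X i)))"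
      by (simp add: lact_mult[symmetric] C[OF i] mult_ac)
    also have "\<dots> = lact scl (C * ((\<Prod>j\<in>I - {i}. snd (X j)) * snd (X i))) (f i)"
      by (simp only: c(2)[OF i]) (simp add: lact_mult[symmetric] C[OF i] mult_ac)
    also have "(\<Prod>j\<in>I - {i}. snd (X j)) * snd (X i) = (\<Prod>j\<in>I. snd (X j))"
      using i I by (simp add: prod.remove mult.commute)
    finally show ?thesis .
  qed
  then have "lact scl (C * d) (fst (fsum scl I X)) = lact scl (C * snd (fsum scl I X)) (\<lambda>e. \<Sum>i\<in>I. f i e)"
    by (simp add: fsum_def lact_sum)
  moreover have "C \<in> dens V"
    unfolding C_def using c(1) by (rule dens_prod)
  ultimately show ?thesis
    by (auto simp: series_eq_def)
qed

lemma common_denominator: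
  assumes I: "finite I" and X: "\<And>i. i \<in> I \<Longrightarrow> X i \<in> fracs_in V"
  shows "\<exists>f d. d \<in> dens V \<and> (\<forall>i\<in>I. series_eq scl V (X i) (f i, d) \<and> supp_in V (f i))"
proof (intro exI conjI ballI)
  define d where "d = (\<Prod>i\<in>I. snd (X i))"
  define f where "f i = lact scl (\<Prod>j\<in>I - {i}. snd (X j)) (fst (X i))" for i
  have D: "(\<Prod>j\<in>I - {i}. snd (X j)) \<in> dens V" for i
    using X by (auto simp: fracs_in_def intro: dens_prod)
  show "d \<in> dens V"
    unfolding d_def using X by (auto simp: fracs_in_def intro: dens_prod)
  fix i assume i: "i \<in> I"
  have "series_eq scl V (f i, (\<Prod>j\<in>I - {i}. snd (X j)) * snd (X i)) (X i)"
    unfolding f_def using series_eq_cancel[OF D, where f = "fst (X i)" and d = "snd (X i)"] by simp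
  moreover have "(\<Prod>j\<in>I - {i}. snd (X j)) * snd (X i) = d"
    unfolding d_def using i I by (simp add: prod.remove mult.commute)
  ultimately show "series_eq scl V (X i) (f i, d)"
    using series_eq_sym by simp
  show "supp_in V (f i)"
    unfolding f_def using D[of i] X[OF i] dens_subset_laurents_in
    by (intro supp_in_lact) (auto simp: fracs_in_def)
qed

lemma snd_fsum_dens: "(\<And>i. i \<in> I \<Longrightarrow> snd (X i) \<in> dens V) \<Longrightarrow> snd (fsum scl I X) \<in> dens V"
  by (auto simp: fsum_def intro: dens_prod)

lemma fracs_inD: "X \<in> fracs_in V \<Longrightarrow> snd X \<in> dens V"
  by (simp add: fracs_in_def)

lemma fsum_cong:
  assumes I: "finite I" and X: "\<And>i. i \<in> I \<Longrightarrow> X i \<in> fracs_in V" "\<And>i. i \<in> I \<Longrightarrow> Y i \<in> fracs_in V"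
    and eq: "\<And>i. i \<in> I \<Longrightarrow> series_eq scl V (X i) (Y i)"
  shows "series_eq scl V (fsum scl I X) (fsum scl I Y)"
proof -
  obtain f d where fd: "d \<in> dens V" "\<And>i. i \<in> I \<Longrightarrow> series_eq scl V (X i) (f i, d)"
    using common_denominator[OF I, of X V] X(1) by blast
  then have "series_eq scl V (Y i) (f i, d)" if "i \<in> I" for i
    using series_eq_trans[OF series_eq_sym[OF eq[OF that]]] X(1) that by (auto simp: fracs_in_def)
  then have "series_eq scl V (fsum scl I Y) (\<lambda>e. \<Sum>i\<in>I. f i e, d)"
    using I X by (intro fsum_common_denominator) (auto simp: fracs_in_def)
  moreover have "series_eq scl V (fsum scl I X) (\<lambda>e. \<Sum>i\<in>I. f i e, d)"
    using I X fd by (intro fsum_common_denominator) (auto simp: fracs_in_def)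
  ultimately show ?thesis
    using fd(1) by (auto elim: series_eq_common)
qed

lemma fsum_Sigma:
  assumes I: "finite I" and J: "\<And>i. i \<in> I \<Longrightarrow> finite (J i)"
    and X: "\<And>i j. i \<in> I \<Longrightarrow> j \<in> J i \<Longrightarrow> X i j \<in> fracs_in V"
  shows "series_eq scl V (fsum scl I (\<lambda>i. fsum scl (J i) (X i))) (fsum scl (Sigma I J) (\<lambda>(i, j). X i j))"
proof -
  have S: "finite (Sigma I J)" using I J by blast
  obtain f d where fd: "d \<in> dens V" "\<And>i j. i \<in> I \<Longrightarrow> j \<in> J i \<Longrightarrow> series_eq scl V (X i j) (f (i, j), d)"
  proof -
    have "\<exists>f d. d \<in> dens V \<and> (\<forall>p\<in>Sigma I J. series_eq scl V (case p of (i, j) \<Rightarrow> X i j) (f p, d) \<and> supp_in V (f p))"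
      by (rule common_denominator[OF S]) (use X in auto)
    then show thesis
      using that by fastforce
  qed
  have "series_eq scl V (fsum scl (J i) (X i)) (\<lambda>e. \<Sum>j\<in>J i. f (i, j) e, d)" if "i \<in> I" for i
    by (rule fsum_common_denominator[where f = "\<lambda>j. f (i, j)"])
      (use that J X fd in \<open>auto simp: fracs_in_def\<close>)
  then have "series_eq scl V (fsum scl I (\<lambda>i. fsum scl (J i) (X i))) (\<lambda>e. \<Sum>i\<in>I. \<Sum>j\<in>J i. f (i, j) e, d)"
    using X by (intro fsum_common_denominator[OF I] snd_fsum_dens) (auto simp: fracs_in_def)
  moreover have "series_eq scl V (fsum scl (Sigma I J) (\<lambda>(i, j). X i j)) (\<lambda>e. \<Sum>p\<in>Sigma I J. f p e, d)"
    using S X fd by (intro fsum_common_denominator) (auto simp: fracs_in_def)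
  moreover have "(\<lambda>e. \<Sum>p\<in>Sigma I J. f p e) = (\<lambda>e. \<Sum>i\<in>I. \<Sum>j\<in>J i. f (i, j) e)"
    using I J by (simp add: sum.Sigma)
  ultimately show ?thesis
    using fd(1) by (auto elim: series_eq_common)
qed

text \<open>Reindexing only permutes the factors of the products of denominators, so this is a
  literal equality.\<close>

lemma fsum_reindex:
  assumes "inj_on h I" shows "fsum scl (h ` I) X = fsum scl I (X \<circ> h)"
proof -
  have "h ` I - {h i} = h ` (I - {i})" if "i \<in> I" for i
    using assms that by (auto simp: inj_on_def)
  then have "(\<Prod>j\<in>h ` I - {h i}. snd (X j)) = (\<Prod>j\<in>I - {i}. snd (X (h j)))" if "i \<in> I" for i
    using that assms by (simp add: prod.reindex inj_on_diff)
  then show ?thesis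
    using assms by (simp add: fsum_def sum.reindex prod.reindex)
qed

lemma fsum_cong_eq: "(\<And>i. i \<in> I \<Longrightarrow> X i = Y i) \<Longrightarrow> fsum scl I X = fsum scl I Y"
  by (simp add: fsum_def)

lemma fsum_bij:
  assumes "bij_betw h I J" "\<And>i. i \<in> I \<Longrightarrow> X (h i) = Y i"
  shows "fsum scl J X = fsum scl I Y"
  using fsum_reindex[of h I X] assms by (auto simp: bij_betw_def intro: fsum_cong_eq)

lemma fsum_swap:
  assumes I: "finite I" and J: "finite J"
    and X: "\<And>i j. i \<in> I \<Longrightarrow> j \<in> J \<Longrightarrow> X i j \<in> fracs_in V"
  shows "series_eq scl V (fsum scl I (\<lambda>i. fsum scl J (X i))) (fsum scl J (\<lambda>j. fsum scl I (\<lambda>i. X i j)))"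
proof -
  have "fsum scl (I \<times> J) (\<lambda>(i, j). X i j) = fsum scl (J \<times> I) (\<lambda>(j, i). X i j)"
    by (rule fsum_bij[where h = "\<lambda>(j, i). (i, j)"]) (auto simp: bij_betw_def inj_on_def)
  then show ?thesis
    using fsum_Sigma[of I "\<lambda>_. J" X V] fsum_Sigma[of J "\<lambda>_. I" "\<lambda>j i. X i j" V] assms
      snd_fsum_dens[of "J \<times> I" "\<lambda>(j, i). X i j" V]
    by (auto simp: fracs_in_def elim: series_eq_common)
qed

lemma rmult_fsum:
  assumes I: "finite I" and X: "\<And>i. i \<in> I \<Longrightarrow> X i \<in> fracs_in V" and r: "snd r \<in> dens V"
  shows "series_eq scl V (rmult scl r (fsum scl I X)) (fsum scl I (\<lambda>i. rmult scl r (X i)))"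
proof -
  obtain f d where fd: "d \<in> dens V" "\<And>i. i \<in> I \<Longrightarrow> series_eq scl V (X i) (f i, d)"
    using common_denominator[OF I, of X] X by blast
  have "series_eq scl V (rmult scl r (X i)) (lact scl (fst r) (f i), snd r * d)" if "i \<in> I" for i
    using rmult_cong[OF fd(2)[OF that], of r] by (simp add: rmult_def)
  then have "series_eq scl V (fsum scl I (\<lambda>i. rmult scl r (X i))) (\<lambda>e. \<Sum>i\<in>I. lact scl (fst r) (f i) e, snd r * d)"
    using I X r by (intro fsum_common_denominator) (auto simp: fracs_in_def rmult_def intro: dens_mult)
  moreover have "series_eq scl V (rmult scl r (fsum scl I X)) (rmult scl r (\<lambda>e. \<Sum>i\<in>I. f i e, d))"
    using I X fd by (intro rmult_cong fsum_common_denominator) (auto simp: fracs_in_def)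
  moreover have "rmult scl r (\<lambda>e. \<Sum>i\<in>I. f i e, d) = (\<lambda>e. \<Sum>i\<in>I. lact scl (fst r) (f i) e, snd r * d)"
    by (simp add: rmult_def lact_sum)
  ultimately show ?thesis
    using dens_mult[OF r fd(1)] by (auto elim: series_eq_common)
qed

text \<open>Serves to average: equal summands with weights adding up to 1 give the summand
  back.\<close>

lemma fsum_const_weights:
  assumes I: "finite I" and X: "X \<in> fracs_in V"
  shows "series_eq scl V (fsum scl I (\<lambda>i. rmult scl (lcst (w i), 1) X)) (rmult scl (lcst (\<Sum>i\<in>I. w i), 1) X)"
proof -
  have "series_eq scl V (fsum scl I (\<lambda>i. rmult scl (lcst (w i), 1) X))
     (\<lambda>e. \<Sum>i\<in>I. fst (rmult scl (lcst (w i), 1) X) e, snd X)"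
    using I X by (intro fsum_common_denominator) (auto simp: fracs_in_def rmult_def)
  also have "\<dots> = rmult scl (lcst (\<Sum>i\<in>I. w i), 1) X"
    by (simp add: rmult_def lact_lcst fun_eq_iff scale_sum_left)
  finally show ?thesis .
qed

text \<open>Solves a vanishing sum for one summand. Over a common denominator, the multiplier that
  kills the total numerator also witnesses the solved equation.\<close>

lemma fsum_remove_eq_zero:
  assumes I: "finite I" "i \<in> I" and X: "\<And>i. i \<in> I \<Longrightarrow> X i \<in> fracs_in V"
    and zero: "series_eq scl V (fsum scl I X) fzero"
  shows "series_eq scl V (X i) (fsum scl (I - {i}) (\<lambda>i. rmult scl (lcst (- 1), 1) (X i)))"
proof -
  obtain f d where fd: "d \<in> dens V" "\<And>i. i \<in> I \<Longrightarrow> series_eq scl V (X i) (f i, d)"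
    using common_denominator[OF I(1), of X V] X by blast
  have "series_eq scl V (\<lambda>e. \<Sum>i\<in>I. f i e, d) (fsum scl I X)"
    using I X fd by (intro series_eq_sym[OF fsum_common_denominator]) (auto simp: fracs_in_def)
  from series_eq_trans[OF this zero]
  have "series_eq scl V (\<lambda>e. \<Sum>i\<in>I. f i e, d) fzero"
    using X by (blast intro: snd_fsum_dens fracs_inD)
  then obtain c where c: "c \<in> dens V" "lact scl c (\<lambda>e. \<Sum>i\<in>I. f i e) = (\<lambda>_. 0)"
    by (auto simp: series_eq_def fzero_def)
  have "lact scl c (f i) e = lact scl c (\<lambda>e. - (\<Sum>j\<in>I - {i}. f j e)) e" for e
  proof -
    have "lact scl c (f i) e - lact scl c (\<lambda>e. - (\<Sum>j\<in>I - {i}. f j e)) e = lact scl c (\<lambda>e. \<Sum>i\<in>I. f i e) e"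
      using I by (simp add: lact_def sum.remove[of I i] scale_right_distrib sum.distrib sum_negf)
    then show ?thesis
      using c(2) by simp
  qed
  then have "lact scl c (f i) = lact scl c (\<lambda>e. - (\<Sum>j\<in>I - {i}. f j e))"
    by blast
  then have 1: "series_eq scl V (f i, d) (\<lambda>e. \<Sum>j\<in>I - {i}. - f j e, d)"
    unfolding series_eq_def
    by (intro bexI[OF _ c(1)]) (simp add: mult.commute[of _ d] lact_mult sum_negf)
  have "series_eq scl V (rmult scl (lcst (- 1), 1) (X j)) (\<lambda>e. - f j e, d)" if "j \<in> I" for j
    using rmult_cong[OF fd(2)[OF that], of "(lcst (- 1), 1)"] by (simp add: rmult_def ext[OF lact_lcst])
  then have 2: "series_eq scl V (fsum scl (I - {i}) (\<lambda>i. rmult scl (lcst (- 1), 1) (X i))) (\<lambda>e. \<Sum>j\<in>I - {i}. - f j e, d)"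
    using I X by (intro fsum_common_denominator) (auto simp: fracs_in_def rmult_def)
  show ?thesis
    using series_eq_trans[OF series_eq_trans[OF fd(2)[OF I(2)] 1] series_eq_sym[OF 2]] fd(1) by simp
qed

lemma fracs_in_rmult' [intro]:
  "fst r \<in> laurents_in V \<Longrightarrow> snd r \<in> dens V \<Longrightarrow> X \<in> fracs_in V \<Longrightarrow> rmult scl r X \<in> fracs_in V"
  by (rule fracs_in_rmult) simp_all

lemma fracs_in_fsum' [intro]: "(\<And>i. i \<in> I \<Longrightarrow> X i \<in> fracs_in V) \<Longrightarrow> fsum scl I X \<in> fracs_in V"
  by (rule fracs_in_fsum) simp_all

lemma fracs_in_ren': "\<rho> permutes V \<Longrightarrow> X \<in> fracs_in V \<Longrightarrow> ren \<rho> X \<in> fracs_in V"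
  using fracs_in_ren[of \<rho> X V] by (simp add: permutes_inj permutes_image)

end

text \<open>Centrality of the scalars lets a rational function acting on the right factor of
  \<open>fmult\<close> be moved in front of the left factor, with which that factor need not
  commute.\<close>

locale scalar_algebra = scalar_module scl for scl :: "complex \<Rightarrow> 'a::ring_1 \<Rightarrow> 'a" +
  assumes mult_scale_right: "x * scl c y = scl c (x * y)"

section \<open>Products of series in disjoint variables\<close>

definition restr_expo :: "var set \<Rightarrow> expo \<Rightarrow> expo" where
  "restr_expo V = frag_extend (\<lambda>v. if v \<in> V then frag_of v else 0)"

lemma restr_expo_diff: "restr_expo V (d - e) = restr_expo V d - restr_expo V e"
  by (simp add: restr_expo_def frag_extend_diff)

lemma restr_expo_id: "Poly_Mapping.keys d \<subseteq> V \<Longrightarrow> restr_expo V d = d"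
  unfolding restr_expo_def
  by (rule trans[OF frag_extend_eq frag_expansion[symmetric]]) auto

lemma restr_expo_zero: "Poly_Mapping.keys d \<inter> V = {} \<Longrightarrow> restr_expo V d = 0"
  unfolding restr_expo_def by (rule frag_extend_eq_0) auto

text \<open>With disjoint variables an exponent splits in only one way, into its parts in
  \<open>V\<close> and outside \<open>V\<close>. So the convolution has at most one nonzero term,
  and \<open>Sum_any\<close> never meets an infinite support, where it would return 0.\<close>

lemma fst_fmult:
  assumes "supp_in V (fst X)" "supp_in W (fst Y)" "V \<inter> W = {}"
  shows "fst (fmult X Y) e = fst X (restr_expo V e) * fst Y (e - restr_expo V e)"
proof -
  have "d = restr_expo V e" if "fst X d * fst Y (e - d) \<noteq> 0" for d
  proof -
    have "fst X d \<noteq> 0" "fst Y (e - d) \<noteq> 0" using that by auto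
    then have "Poly_Mapping.keys d \<subseteq> V" "Poly_Mapping.keys (e - d) \<subseteq> W"
      using assms(1,2) by (auto simp: supp_in_def)
    then have "restr_expo V d = d" "restr_expo V (e - d) = 0"
      using assms(3) by (auto intro: restr_expo_id restr_expo_zero)
    then show ?thesis by (simp add: restr_expo_diff)
  qed
  then have "{d. fst X d * fst Y (e - d) \<noteq> 0} \<subseteq> {restr_expo V e}" by blast
  then show ?thesis
    by (simp add: fmult_def Sum_any.expand_superset[of "{restr_expo V e}"])
qed

context scalar_algebra
begin

lemma fmult_rmult:
  assumes A: "supp_in V (fst A)" and Y: "supp_in W (fst Y)" and r: "fst r \<in> laurents_in W"
    and disj: "V \<inter> W = {}"
  shows "fmult A (rmult scl r Y) = rmult scl r (fmult A Y)"
proof -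
  have rY: "supp_in W (fst (rmult scl r Y))"
    using r Y by (simp add: rmult_def supp_in_lact)
  have "fst (fmult A (rmult scl r Y)) e = fst (rmult scl r (fmult A Y)) e" for e
  proof -
    \<comment> \<open>The polynomial involves no variable of \<open>V\<close>, so its monomials
      shift only the part of the exponent that belongs to the right factor.\<close>
    have "restr_expo V (e - d) = restr_expo V e" if "d \<in> Poly_Mapping.keys (fst r)" for d
      using that r disj by (auto simp: laurents_in_def restr_expo_diff intro!: restr_expo_zero)
    then show ?thesis
      by (simp add: fst_fmult[OF A rY disj])
        (simp add: rmult_def lact_def fst_fmult[OF A Y disj] sum_distrib_left mult_scale_right
          algebra_simps cong: sum.cong)
  qed
  then show ?thesis
    by (auto simp: prod_eq_iff fun_eq_iff) (simp add: fmult_def rmult_def mult_ac)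
qed

text \<open>The multiplier for \<open>Y\<close> and \<open>Y'\<close> also works for the products:
  its variables are disjoint from those of \<open>A\<close>, so it passes through
  \<open>A\<close>.\<close>

lemma fmult_cong:
  assumes A: "A \<in> fracs_in V" and Y: "Y \<in> fracs_in W" "Y' \<in> fracs_in W" and disj: "V \<inter> W = {}"
    and eq: "series_eq scl W Y Y'"
  shows "series_eq scl (V \<union> W) (fmult A Y) (fmult A Y')"
proof -
  obtain c where c: "c \<in> dens W" "lact scl (c * snd Y') (fst Y) = lact scl (c * snd Y) (fst Y')"
    using eq by (auto simp: series_eq_def)
  have L: "c * snd Y' \<in> laurents_in W" "c * snd Y \<in> laurents_in W"
    using c(1) Y dens_subset_laurents_in by (auto simp: fracs_in_def intro!: laurents_in_mult)
  have act: "fst (fmult A (lact scl p (fst Z), 1)) = lact scl p (fst (fmult A Z))"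
    if "p \<in> laurents_in W" "Z \<in> fracs_in W" for p Z
    using fmult_rmult[of V A W Z "(p, 1)"] A that disj
    by (simp add: fracs_in_def rmult_def prod_eq_iff) (simp add: fmult_def)
  have "lact scl (c * snd Y') (fst (fmult A Y)) = lact scl (c * snd Y) (fst (fmult A Y'))"
    using act[OF L(1) Y(1)] act[OF L(2) Y(2)] c(2) by simp
  then have "lact scl (c * snd (fmult A Y')) (fst (fmult A Y)) = lact scl (c * snd (fmult A Y)) (fst (fmult A Y'))"
    using lact_mult[of "snd A" "c * snd Y'"] lact_mult[of "snd A" "c * snd Y"]
    by (simp add: fmult_def mult_ac)
  then show ?thesis
    unfolding series_eq_def using c(1) dens_mono[of W "V \<union> W"] by auto
qed

text \<open>Over a common denominator this is distributivity in the algebra, since each coefficient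
  of the convolution is a single product.\<close>

lemma fmult_fsum:
  assumes A: "A \<in> fracs_in V" and I: "finite I" and X: "\<And>i. i \<in> I \<Longrightarrow> X i \<in> fracs_in W"
    and disj: "V \<inter> W = {}"
  shows "series_eq scl (V \<union> W) (fmult A (fsum scl I X)) (fsum scl I (\<lambda>i. fmult A (X i)))"
proof -
  obtain f d where fd: "d \<in> dens W" "\<And>i. i \<in> I \<Longrightarrow> series_eq scl W (X i) (f i, d)"
    "\<And>i. i \<in> I \<Longrightarrow> supp_in W (f i)"
    using common_denominator[OF I, of X] X by blast
  have sf: "supp_in W (\<lambda>e. \<Sum>i\<in>I. f i e)"
    using fd(3) by (rule supp_in_sum)
  have "series_eq scl (V \<union> W) (fmult A (X i)) (fst (fmult A (f i, 1)), snd A * d)" if "i \<in> I" for i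
    using fmult_cong[OF A X[OF that] _ disj fd(2)[OF that]] fd that
    by (simp add: fracs_in_def) (simp add: fmult_def)
  then have "series_eq scl (V \<union> W) (fsum scl I (\<lambda>i. fmult A (X i)))
      (\<lambda>e. \<Sum>i\<in>I. fst (fmult A (f i, 1)) e, snd A * d)"
    using I fracs_in_fmult[OF A X] by (intro fsum_common_denominator) (auto simp: fracs_in_def)
  moreover have "(\<lambda>e. \<Sum>i\<in>I. fst (fmult A (f i, 1)) e, snd A * d) = fmult A (\<lambda>e. \<Sum>i\<in>I. f i e, d)"
    using A fd sf disj
    by (simp add: prod_eq_iff fun_eq_iff fst_fmult[of V _ W] fracs_in_def sum_distrib_left)
      (simp add: fmult_def)
  moreover have "series_eq scl (V \<union> W) (fmult A (fsum scl I X)) (fmult A (\<lambda>e. \<Sum>i\<in>I. f i e, d))"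
    using X I fd sf disj A
    by (intro fmult_cong fsum_common_denominator fracs_in_fsum') (auto simp: fracs_in_def)
  moreover have "snd (fmult A (\<lambda>e. \<Sum>i\<in>I. f i e, d)) \<in> dens (V \<union> W)"
    using A fd(1) dens_mono[of V "V \<union> W"] dens_mono[of W "V \<union> W"]
    by (auto simp: fmult_def fracs_in_def intro: dens_mult)
  ultimately show ?thesis
    by (auto elim: series_eq_common)
qed

end

lemma ren_fmult:
  assumes "bij \<rho>" shows "ren \<rho> (fmult X Y) = fmult (ren \<rho> X) (ren \<rho> Y)"
proof -
  have "Sum_any (\<lambda>d. fst X d * fst Y (ren_expo (inv \<rho>) e - d)) =
      Sum_any (\<lambda>d. fst X (ren_expo (inv \<rho>) d) * fst Y (ren_expo (inv \<rho>) (e - d)))" for e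
    using bij_ren_expo[OF bij_imp_bij_inv[OF assms]]
    by (intro Sum_any.reindex_cong[of "ren_expo (inv \<rho>)"]) (auto simp: fun_eq_iff ren_expo_diff)
  then show ?thesis
    by (simp add: ren_def fmult_def ren_dist_bij[OF assms] ren_laurent_mult fun_eq_iff)
qed

text \<open>A bijection fixing \<open>V\<close> pointwise maps the complement of \<open>V\<close> to
  itself. An exponent with a variable outside \<open>V\<close> therefore goes to another such
  exponent, and both coefficients vanish; exponents in \<open>V\<close> do not move.\<close>

lemma ren_fixed:
  assumes "bij \<rho>" and fixed: "\<And>v. v \<in> V \<Longrightarrow> \<rho> v = v" and X: "X \<in> fracs_in V"
  shows "ren \<rho> X = X"
proof -
  have "fst X (ren_expo (inv \<rho>) e) = fst X e" for e
  proof (cases "Poly_Mapping.keys e \<subseteq> V")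
    case True
    then have "ren_expo (inv \<rho>) e = e"
      using fixed assms(1) by (intro ren_expo_cong) (metis bij_inv_eq_iff subsetD)
    then show ?thesis by simp
  next
    case False
    have "\<not> Poly_Mapping.keys (ren_expo (inv \<rho>) e) \<subseteq> V"
    proof
      assume *: "Poly_Mapping.keys (ren_expo (inv \<rho>) e) \<subseteq> V"
      then have "ren_expo \<rho> (ren_expo (inv \<rho>) e) = ren_expo (inv \<rho>) e"
        using fixed by (intro ren_expo_cong) auto
      with * False show False
        by (simp add: ren_expo_inv'[OF assms(1)])
    qed
    with False show ?thesis
      using X unfolding fracs_in_def supp_in_def by (metis (mono_tags, lifting) mem_Collect_eq)
  qed
  moreover have "ren_laurent \<rho> (snd X) = snd X"
  proof -
    have "ren_laurent \<rho> c = c" if "c \<in> dens V" for c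
      using that by induction (simp_all add: ren_laurent_mult fixed)
    then show ?thesis using X by (simp add: fracs_in_def)
  qed
  ultimately show ?thesis
    by (simp add: ren_def ren_dist_bij[OF assms(1)] prod_eq_iff fun_eq_iff)
qed

lemma fmult_fone [simp]: "fmult fone X = X"
  by (simp add: fmult_def fone_def prod_eq_iff fun_eq_iff
      Sum_any.expand_superset[of "{0}"] if_distrib[of "\<lambda>x. x * _"] cong: if_cong)

text \<open>The result need not be \<open>fzero\<close> literally: the denominator of the other
  factor stays.\<close>

lemma fmult_fzero: "fmult fzero X = ((\<lambda>_. 0), snd X)"
  by (simp add: fmult_def fzero_def)

section \<open>The \<open>q\<close>-symmetrization\<close>

lemma tvars_eq_Sigma: "tvars N l r = (SIGMA a:{1..N - 1}. {l a<..r a})"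
  by (auto simp: tvars_def)

lemma finite_tvars [simp]: "finite (tvars N l r)"
  by (simp add: tvars_eq_Sigma)

lemma tpermsD:
  assumes "\<sigma> \<in> tperms N l r"
  shows "\<sigma> permutes tvars N l r" "bij \<sigma>" "\<sigma> (a, i) = (a, snd (\<sigma> (a, i)))"
    "\<sigma> v \<in> tvars N l r \<longleftrightarrow> v \<in> tvars N l r"
  using assms by (auto simp: tperms_def prod_eq_iff permutes_in_image intro: permutes_bij)

lemma finite_tperms [simp]: "finite (tperms N l r)"
  by (rule finite_subset[of _ "{\<sigma>. \<sigma> permutes tvars N l r}"]) (auto simp: tperms_def finite_permutations)

lemma tperms_comp: "\<sigma> \<in> tperms N l r \<Longrightarrow> \<tau> \<in> tperms N l r \<Longrightarrow> \<sigma> \<circ> \<tau> \<in> tperms N l r"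
  unfolding tperms_def by (auto intro: permutes_compose) (metis fst_conv surj_pair)

lemma tperms_inv:
  assumes "\<sigma> \<in> tperms N l r" shows "inv \<sigma> \<in> tperms N l r"
proof -
  have "fst (inv \<sigma> v) = fst v" for v
    using assms tpermsD(2)[OF assms] unfolding tperms_def
    by (metis (mono_tags, lifting) bij_inv_eq_iff mem_Collect_eq)
  then show ?thesis
    using assms by (auto simp: tperms_def permutes_inv)
qed

lemma bij_betw_tperms_comp:
  assumes "\<tau> \<in> tperms N l r"
  shows "bij_betw (\<lambda>\<sigma>. \<sigma> \<circ> \<tau>) (tperms N l r) (tperms N l r)"
proof (rule bij_betw_byWitness[where f' = "\<lambda>\<sigma>. \<sigma> \<circ> inv \<tau>"])
  have \<tau>: "\<tau> \<circ> inv \<tau> = id" "inv \<tau> \<circ> \<tau> = id"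
    using tpermsD(1)[OF assms] by (simp_all add: permutes_inv_o)
  show "\<forall>\<sigma>\<in>tperms N l r. \<sigma> \<circ> \<tau> \<circ> inv \<tau> = \<sigma>" "\<forall>\<sigma>\<in>tperms N l r. \<sigma> \<circ> inv \<tau> \<circ> \<tau> = \<sigma>"
    by (simp_all add: comp_assoc \<tau>)
qed (use assms in \<open>auto intro: tperms_comp tperms_inv\<close>)

lemma tperms_mono:
  assumes "\<tau> \<in> tperms N (\<lambda>_. 0) s" "\<And>a. s a \<le> n a"
  shows "\<tau> \<in> tperms N (\<lambda>_. 0) n"
proof -
  have "tvars N (\<lambda>_. 0) s \<subseteq> tvars N (\<lambda>_. 0) n"
    using assms(2) by (auto simp: tvars_def intro: order_trans)
  then show ?thesis
    using assms(1) by (auto simp: tperms_def intro: permutes_subset)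
qed

lemma tperms_permutes:
  assumes \<sigma>: "\<sigma> \<in> tperms N (\<lambda>_. 0) s" and a: "a \<in> {1..N - 1}"
  shows "(\<lambda>i. snd (\<sigma> (a, i))) permutes {1..s a}"
proof -
  have inV: "(a, i) \<in> tvars0 N s \<longleftrightarrow> i \<in> {1..s a}" for i
    using a by (auto simp: tvars_def)
  let ?p = "\<lambda>i. snd (\<sigma> (a, i))"
  have "inj_on ?p {1..s a}"
    using tpermsD(2,3)[OF \<sigma>] by (intro inj_onI) (metis bij_is_inj injD prod.inject)
  moreover have "?p ` {1..s a} \<subseteq> {1..s a}"
    using tpermsD(3,4)[OF \<sigma>] inV by (metis image_subsetI)
  ultimately have "bij_betw ?p {1..s a} {1..s a}"
    by (simp add: bij_betw_def endo_inj_surj)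
  moreover have "?p i = i" if "i \<notin> {1..s a}" for i
    using permutes_not_in[OF tpermsD(1)[OF \<sigma>], of "(a, i)"] that inV by simp
  ultimately show ?thesis
    by (auto intro: bij_imp_permutes)
qed

text \<open>A type-preserving permutation amounts to one permutation per type, encoded as an
  extensional family on \<open>{1..N - 1}\<close>. The count cancels the factorial prefactor of the
  symmetrization.\<close>

lemma card_tperms: "card (tperms N (\<lambda>_. 0) s) = (\<Prod>a=1..N - 1. fact (s a))"
proof -
  let ?V = "tvars N (\<lambda>_. 0) s"
  let ?F = "\<lambda>\<sigma>. \<lambda>a\<in>{1..N - 1}. \<lambda>i. snd (\<sigma> (a, i)) :: nat"
  let ?G = "\<lambda>f (a, i). if a \<in> {1..N - 1} then (a, f a i) else (a, i :: nat)"
  have "bij_betw ?F (tperms N (\<lambda>_. 0) s) (PiE {1..N - 1} (\<lambda>a. {p. p permutes {1..s a}}))"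
  proof (rule bij_betw_byWitness[where f' = ?G])
    show "\<forall>\<sigma>\<in>tperms N (\<lambda>_. 0) s. ?G (?F \<sigma>) = \<sigma>"
    proof (intro ballI ext)
      fix \<sigma> and v :: var assume \<sigma>: "\<sigma> \<in> tperms N (\<lambda>_. 0) s"
      obtain a i where v: "v = (a, i)" by (cases v)
      have "\<sigma> (a, i) = (a, i)" if "a \<notin> {1..N - 1}"
        using permutes_not_in[OF tpermsD(1)[OF \<sigma>]] that by (auto simp: tvars_def)
      then show "?G (?F \<sigma>) v = \<sigma> v"
        using tpermsD(3)[OF \<sigma>, of a i] by (auto simp: v)
    qed
    show "\<forall>f\<in>PiE {1..N - 1} (\<lambda>a. {p. p permutes {1..s a}}). ?F (?G f) = f"
      by (auto simp: fun_eq_iff PiE_def extensional_def)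
    show "?F ` tperms N (\<lambda>_. 0) s \<subseteq> PiE {1..N - 1} (\<lambda>a. {p. p permutes {1..s a}})"
    proof (intro image_subsetI PiE_I)
      fix \<sigma> a assume \<sigma>: "\<sigma> \<in> tperms N (\<lambda>_. 0) s" and a: "a \<in> {1..N - 1}"
      then show "?F \<sigma> a \<in> {p. p permutes {1..s a}}"
        using tperms_permutes[OF \<sigma> a] by simp
    qed auto
    show "?G ` PiE {1..N - 1} (\<lambda>a. {p. p permutes {1..s a}}) \<subseteq> tperms N (\<lambda>_. 0) s"
    proof (intro image_subsetI)
      fix f assume f: "f \<in> PiE {1..N - 1} (\<lambda>a. {p. p permutes {1..s a}})"
      have fp: "f a permutes {1..s a}" if "a \<in> {1..N - 1}" for a
        using f that by (auto simp: PiE_def Pi_def)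
      have "inj_on (?G f) ?V"
        using permutes_inj[OF fp] by (intro inj_onI) (auto simp: tvars_def inj_eq)
      moreover have "?G f ` ?V \<subseteq> ?V"
      proof (rule image_subsetI)
        fix v assume "v \<in> ?V"
        then obtain a i where *: "v = (a, i)" "a \<in> {1..N - 1}" "i \<in> {1..s a}" by (auto simp: tvars_def)
        then have "f a i \<in> {1..s a}" using fp permutes_in_image by metis
        then show "?G f v \<in> ?V" using * by (auto simp: tvars_def)
      qed
      ultimately have "bij_betw (?G f) ?V ?V"
        by (simp add: bij_betw_def endo_inj_surj)
      moreover have "?G f v = v" if "v \<notin> ?V" for v
      proof (cases v)
        case (Pair a i)
        have "f a i = i" if "a \<in> {1..N - 1}"
          using permutes_not_in[OF fp[OF that]] \<open>v \<notin> ?V\<close> that by (auto simp: Pair tvars_def)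
        then show ?thesis by (simp add: Pair)
      qed
      ultimately show "?G f \<in> tperms N (\<lambda>_. 0) s"
        unfolding tperms_def by (auto intro: bij_imp_permutes)
    qed
  qed
  then have "card (tperms N (\<lambda>_. 0) s) = card (PiE {1..N - 1} (\<lambda>a. {p. p permutes {1..s a}}))"
    by (rule bij_betw_same_card)
  also have "\<dots> = (\<Prod>a=1..N - 1. fact (s a))"
    by (simp add: card_PiE card_permutations)
  finally show ?thesis .
qed

text \<open>Numerator \<open>(1 / q, q)\<close> and denominator \<open>(q, 1 / q)\<close> of the
  symmetrization factor have the same shape. The factorial prefactor is split off as
  \<open>sym_const\<close>, since the cocycle identity concerns the inversion products only.\<close>

definition inv_prod :: "nat \<Rightarrow> mindex \<Rightarrow> complex \<Rightarrow> complex \<Rightarrow> (var \<Rightarrow> var) \<Rightarrow> laurent" where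
  "inv_prod N n \<alpha> \<beta> \<sigma> = (\<Prod>(a, i, j)\<in>inversions N (\<lambda>_. 0) n \<sigma>. lin \<alpha> \<beta> (\<sigma> (a, j)) (\<sigma> (a, i)))"

definition sym_const :: "nat \<Rightarrow> mindex \<Rightarrow> complex" where
  "sym_const N n = (\<Prod>a=1..N - 1. 1 / fact (n a))"

lemma sym_factor_eq:
  "sym_factor N q (\<lambda>_. 0) n \<sigma> =
    (lcst (sym_const N n) * inv_prod N n (1 / q) q \<sigma>, inv_prod N n q (1 / q) \<sigma>)"
  by (simp add: sym_factor_def inv_prod_def sym_const_def)

text \<open>Indices above \<open>s a\<close> are fixed and those up to \<open>s a\<close> stay below
  them, so a permutation of the lower variables gains no inversions when regarded as a permutation
  of all variables.\<close>

lemma inversions_mono: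
  assumes "\<tau> \<in> tperms N (\<lambda>_. 0) s" "\<And>a. s a \<le> n a"
  shows "inversions N (\<lambda>_. 0) n \<tau> = inversions N (\<lambda>_. 0) s \<tau>"
proof -
  have "(a, i) \<in> tvars0 N s \<and> (a, j) \<in> tvars0 N s"
    if *: "(a, i) \<in> tvars0 N n" "(a, j) \<in> tvars0 N n" "i < j" "snd (\<tau> (a, j)) < snd (\<tau> (a, i))" for a i j
  proof -
    have j: "(a, j) \<in> tvars0 N s"
    proof (rule ccontr)
      assume nj: "(a, j) \<notin> tvars0 N s"
      then have "\<tau> (a, j) = (a, j)"
        by (rule permutes_not_in[OF tpermsD(1)[OF assms(1)]])
      moreover have "snd (\<tau> (a, i)) \<le> j"
      proof (cases "(a, i) \<in> tvars0 N s")
        case True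
        then have "(a, snd (\<tau> (a, i))) \<in> tvars0 N s"
          using tpermsD(3,4)[OF assms(1)] by metis
        then show ?thesis using nj *(2) by (auto simp: tvars_def)
      next
        case False
        then have "\<tau> (a, i) = (a, i)"
          by (rule permutes_not_in[OF tpermsD(1)[OF assms(1)]])
        then show ?thesis using *(3) by simp
      qed
      ultimately show False using *(4) by simp
    qed
    then show ?thesis using * by (auto simp: tvars_def)
  qed
  moreover have "tvars0 N s \<subseteq> tvars0 N n"
    using assms(2) by (auto simp: tvars_def intro: order_trans)
  ultimately show ?thesis
    unfolding inversions_def by blast
qed

lemma inv_prod_mono:
  assumes "\<tau> \<in> tperms N (\<lambda>_. 0) s" "\<And>a. s a \<le> n a"
  shows "inv_prod N n \<alpha> \<beta> \<tau> = inv_prod N s \<alpha> \<beta> \<tau>"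
  using inversions_mono[OF assms] by (simp add: inv_prod_def)

lemma inv_prod_laurents_in:
  assumes "\<sigma> \<in> tperms N (\<lambda>_. 0) n" shows "inv_prod N n \<alpha> \<beta> \<sigma> \<in> laurents_in (tvars0 N n)"
  unfolding inv_prod_def
  by (rule laurents_in_prod) (auto simp: inversions_def tpermsD(4)[OF assms])

lemma inv_prod_dens:
  assumes "\<sigma> \<in> tperms N (\<lambda>_. 0) n" "\<alpha> \<noteq> 0" "\<beta> \<noteq> 0" shows "inv_prod N n \<alpha> \<beta> \<sigma> \<in> dens (tvars0 N n)"
  unfolding inv_prod_def
  by (rule dens_prod) (auto simp: inversions_def tpermsD(4)[OF assms(1)] intro!: lin_in_dens assms(2,3))

text \<open>For g(z) = (1/q - q z) / (q - z/q) this is g(z) g(1/z) = 1 with denominators cleared and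
  z = x/y. Both sides equal q^2 + q^-2 - (z + 1/z).\<close>

lemma lin_swap:
  assumes "q \<noteq> 0"
  shows "lin (1 / q) q x y * lin (1 / q) q y x = lin q (1 / q) x y * lin q (1 / q) y x"
proof -
  have r: "lratio x y * lratio y x = 1" "lratio y x * lratio x y = 1"
    by (simp_all add: lratio_def mult_single)
  have c: "lcst q * lcst (1 / q) = 1" "lcst (1 / q) * lcst q = 1"
    using assms by (simp_all add: lcst_mult[symmetric])
  have *: "(b - a * r) * (b - a * s) = b * b + a * a * (r * s) - (a * b) * (r + s)" for a b r s :: laurent
    by (simp add: algebra_simps)
  show ?thesis
    by (simp only: lin_def * r c) (simp add: algebra_simps)
qed

text \<open>With \<open>g (x / y)\<close> the factor of an inversion and \<open>g (x) g (1 / x) = 1\<close>, the factors form a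
  cocycle: the pairs inverted by \<open>\<tau>\<close> and inverted back by \<open>\<sigma>\<close> cancel.\<close>

lemma inv_prod_comp:
  assumes \<sigma>: "\<sigma> \<in> tperms N (\<lambda>_. 0) n" and \<tau>: "\<tau> \<in> tperms N (\<lambda>_. 0) n" and q: "q \<noteq> 0"
  shows "inv_prod N n (1 / q) q \<sigma> * ren_laurent \<sigma> (inv_prod N n (1 / q) q \<tau>) * inv_prod N n q (1 / q) (\<sigma> \<circ> \<tau>) =
    inv_prod N n (1 / q) q (\<sigma> \<circ> \<tau>) * (inv_prod N n q (1 / q) \<sigma> * ren_laurent \<sigma> (inv_prod N n q (1 / q) \<tau>))"
proof -
  define T where "T = {(a, i, j). (a, i) \<in> tvars0 N n \<and> (a, j) \<in> tvars0 N n \<and> i < j}"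
  define U :: "complex \<Rightarrow> complex \<Rightarrow> (var \<Rightarrow> var) \<Rightarrow> nat \<times> nat \<times> nat \<Rightarrow> laurent"
    where "U = (\<lambda>\<alpha> \<beta> \<rho> (a, i, j).
    if snd (\<rho> (a, j)) < snd (\<rho> (a, i)) then lin \<alpha> \<beta> (\<rho> (a, j)) (\<rho> (a, i)) else 1)"
  \<comment> \<open>A pair \<open>i < j\<close> is sent to its images under \<open>\<tau>\<close>,
    put back in increasing order. This permutes \<open>T\<close>, so the factors of
    \<open>\<sigma>\<close> can be matched with the pairs of \<open>\<tau>\<close> and of
    \<open>\<sigma> \<circ> \<tau>\<close>.\<close>
  define srt where "srt = (\<lambda>(a, i, j). (a, min (snd (\<tau> (a, i))) (snd (\<tau> (a, j))), max (snd (\<tau> (a, i))) (snd (\<tau> (a, j)))))"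
  have finT: "finite T"
  proof (rule finite_subset)
    show "T \<subseteq> (\<lambda>((a, i), (b, j)). (a, i, j)) ` (tvars0 N n \<times> tvars0 N n)"
      by (force simp: T_def)
  qed simp
  have prod_U: "inv_prod N n \<alpha> \<beta> \<rho> = prod (U \<alpha> \<beta> \<rho>) T" for \<alpha> \<beta> \<rho>
  proof -
    have "inversions N (\<lambda>_. 0) n \<rho> = {p \<in> T. case p of (a, i, j) \<Rightarrow> snd (\<rho> (a, j)) < snd (\<rho> (a, i))}"
      by (auto simp: inversions_def T_def)
    then show ?thesis
      unfolding inv_prod_def U_def using finT
      by (simp add: prod.inter_filter) (auto intro!: prod.cong)
  qed
  have inj: "snd (\<rho> (a, i)) = snd (\<rho> (a, j)) \<longleftrightarrow> i = j" if "\<rho> \<in> tperms N (\<lambda>_. 0) n" for \<rho> a i j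
    using tpermsD(2,3)[OF that] by (metis bij_is_inj injD prod.inject)
  have in_T: "(a, snd (\<tau> (a, i))) \<in> tvars0 N n \<longleftrightarrow> (a, i) \<in> tvars0 N n" for a i
    using tpermsD(3,4)[OF \<tau>] by metis
  have "srt ` T \<subseteq> T"
    using inj[OF \<tau>] by (auto simp: srt_def T_def min_def max_def in_T not_le)
      (metis le_neq_implies_less nat_neq_iff)+
  moreover have "inj_on srt T"
    by (intro inj_onI) (auto simp: srt_def T_def inj[OF \<tau>] min_def max_def split: if_splits)
  ultimately have bij: "bij_betw srt T T"
    by (simp add: bij_betw_def endo_inj_surj finT)
  have reindex: "inv_prod N n \<alpha> \<beta> \<sigma> = (\<Prod>p\<in>T. U \<alpha> \<beta> \<sigma> (srt p))" for \<alpha> \<beta>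
    unfolding prod_U by (rule prod.reindex_bij_betw[OF bij, symmetric])
  \<comment> \<open>After this matching the identity holds for each pair separately.\<close>
  have "U (1 / q) q \<sigma> (srt p) * ren_laurent \<sigma> (U (1 / q) q \<tau> p) * U q (1 / q) (\<sigma> \<circ> \<tau>) p =
      U (1 / q) q (\<sigma> \<circ> \<tau>) p * (U q (1 / q) \<sigma> (srt p) * ren_laurent \<sigma> (U q (1 / q) \<tau> p))"
    if p: "p \<in> T" for p
  proof -
    obtain a i j where p_eq: "p = (a, i, j)" and ij: "i < j"
      using p by (auto simp: T_def)
    define i' j' where "i' = snd (\<tau> (a, i))" and "j' = snd (\<tau> (a, j))"
    have t: "\<tau> (a, i) = (a, i')" "\<tau> (a, j) = (a, j')"
      unfolding i'_def j'_def by (rule tpermsD(3)[OF \<tau>])+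
    have ne: "i' \<noteq> j'" "snd (\<sigma> (a, i')) \<noteq> snd (\<sigma> (a, j'))"
      using inj[OF \<tau>, of a i j] inj[OF \<sigma>, of a i' j'] ij by (auto simp: i'_def j'_def)
    consider "i' < j'" | "j' < i'" using ne by linarith
    then show ?thesis
    proof cases
      case 1
      then show ?thesis
        by (simp add: p_eq U_def srt_def t)
    next
      \<comment> \<open>Here \<open>\<tau>\<close> inverts the pair. If \<open>\<sigma>\<close>
        inverts it back, \<open>\<sigma> \<circ> \<tau>\<close> contributes 1 and the other two
        factors cancel by \<open>lin_swap\<close>; otherwise \<open>\<sigma>\<close> contributes 1
        and the factors of \<open>\<tau>\<close> and of the composition agree.\<close>
      case 2
      then show ?thesis
        using ne lin_swap[OF q, of "\<sigma> (a, i')" "\<sigma> (a, j')"]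
        by (cases "snd (\<sigma> (a, i')) < snd (\<sigma> (a, j'))") (simp_all add: p_eq U_def srt_def t)
    qed
  qed
  then show ?thesis
    unfolding reindex
    unfolding prod_U ren_laurent_prod prod.distrib[symmetric] by (rule prod.cong[OF refl])
qed

section \<open>Linearity and idempotence of the symmetrization\<close>

context scalar_module
begin

lemma fracs_in_scale [intro]: "X \<in> fracs_in V \<Longrightarrow> rmult scl (lcst c, 1) X \<in> fracs_in V"
  by (intro fracs_in_rmult') (simp_all add: dens.one)

lemma sym_term_fracs_in:
  assumes q: "q \<noteq> 0" and \<sigma>: "\<sigma> \<in> tperms N (\<lambda>_. 0) n" and X: "X \<in> fracs_in (tvars0 N n)"
  shows "rmult scl (sym_factor N q (\<lambda>_. 0) n \<sigma>) (ren \<sigma> X) \<in> fracs_in (tvars0 N n)"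
  using q inv_prod_laurents_in[OF \<sigma>] inv_prod_dens[OF \<sigma>] fracs_in_ren'[OF tpermsD(1)[OF \<sigma>] X]
  by (intro fracs_in_rmult') (simp_all add: sym_factor_eq laurents_in_mult)

lemma qsym_fracs_in:
  "q \<noteq> 0 \<Longrightarrow> X \<in> fracs_in (tvars0 N n) \<Longrightarrow> qsym0 scl N q n X \<in> fracs_in (tvars0 N n)"
  unfolding qsym_def by (intro fracs_in_fsum' sym_term_fracs_in)

lemma qsym_cong:
  assumes q: "q \<noteq> 0" and XY: "X \<in> fracs_in (tvars0 N n)" "Y \<in> fracs_in (tvars0 N n)"
    and eq: "series_eq scl (tvars0 N n) X Y"
  shows "series_eq scl (tvars0 N n) (qsym0 scl N q n X) (qsym0 scl N q n Y)"
  unfolding qsym_def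
  by (intro fsum_cong sym_term_fracs_in rmult_cong ren_cong q XY eq finite_tperms tpermsD(1))

lemma qsym_fsum:
  assumes q: "q \<noteq> 0" and I: "finite I" and X: "\<And>i. i \<in> I \<Longrightarrow> X i \<in> fracs_in (tvars0 N n)"
  shows "series_eq scl (tvars0 N n) (qsym0 scl N q n (fsum scl I X)) (fsum scl I (\<lambda>i. qsym0 scl N q n (X i)))"
proof -
  let ?V = "tvars0 N n" and ?S = "sym_factor N q (\<lambda>_. 0) n" and ?T = "tperms N (\<lambda>_. 0) n"
  have Xr: "ren \<sigma> (X i) \<in> fracs_in ?V" if "\<sigma> \<in> ?T" "i \<in> I" for \<sigma> i
    using fracs_in_ren'[OF tpermsD(1)[OF that(1)] X[OF that(2)]] .
  have 1: "series_eq scl ?V (qsym0 scl N q n (fsum scl I X))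
      (fsum scl ?T (\<lambda>\<sigma>. fsum scl I (\<lambda>i. rmult scl (?S \<sigma>) (ren \<sigma> (X i)))))"
    unfolding qsym_def
  proof (rule fsum_cong[OF finite_tperms])
    fix \<sigma> assume \<sigma>: "\<sigma> \<in> ?T"
    have "snd (?S \<sigma>) \<in> dens ?V"
      using inv_prod_dens[OF \<sigma>] q by (simp add: sym_factor_eq)
    then show "series_eq scl ?V (rmult scl (?S \<sigma>) (ren \<sigma> (fsum scl I X)))
        (fsum scl I (\<lambda>i. rmult scl (?S \<sigma>) (ren \<sigma> (X i))))"
      unfolding ren_fsum[OF tpermsD(2)[OF \<sigma>]] using Xr[OF \<sigma>] by (intro rmult_fsum I)
  qed (use X q in \<open>auto intro!: sym_term_fracs_in\<close>)
  have 2: "series_eq scl ?V \<dots> (fsum scl I (\<lambda>i. fsum scl ?T (\<lambda>\<sigma>. rmult scl (?S \<sigma>) (ren \<sigma> (X i)))))"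
    using X by (intro fsum_swap I finite_tperms sym_term_fracs_in q)
  show ?thesis
    using series_eq_trans[OF 1 2] X q unfolding qsym_def
    by (auto intro!: fracs_inD intro: sym_term_fracs_in)
qed

text \<open>By the cocycle identity the summand for \<open>\<sigma>\<close> is the untwisted summand
  for \<open>\<sigma> \<circ> \<tau>\<close>, and composition with \<open>\<tau>\<close> permutes
  the index set. Only the factorial prefactor of the twist survives.\<close>

lemma qsym_twist:
  assumes q: "q \<noteq> 0" and s: "\<And>a. s a \<le> n a" and \<tau>: "\<tau> \<in> tperms N (\<lambda>_. 0) s"
    and X: "X \<in> fracs_in (tvars0 N n)"
  shows "series_eq scl (tvars0 N n)
    (qsym0 scl N q n (rmult scl (sym_factor N q (\<lambda>_. 0) s \<tau>) (ren \<tau> X)))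
    (rmult scl (lcst (sym_const N s), 1) (qsym0 scl N q n X))"
proof -
  let ?V = "tvars0 N n" and ?S = "sym_factor N q (\<lambda>_. 0) n" and ?T = "tperms N (\<lambda>_. 0) n"
  let ?S' = "sym_factor N q (\<lambda>_. 0) s \<tau>" and ?c = "(lcst (sym_const N s), 1)"
  have \<tau>n: "\<tau> \<in> ?T"
    using tperms_mono[OF \<tau> s] .
  have S': "?S' = (lcst (sym_const N s) * inv_prod N n (1 / q) q \<tau>, inv_prod N n q (1 / q) \<tau>)"
    unfolding sym_factor_eq inv_prod_mono[OF \<tau> s] ..
  have S'X: "rmult scl ?S' (ren \<tau> X) \<in> fracs_in ?V"
    unfolding S' using inv_prod_laurents_in[OF \<tau>n] inv_prod_dens[OF \<tau>n] q
      fracs_in_ren'[OF tpermsD(1)[OF \<tau>n] X] by (intro fracs_in_rmult') (simp_all add: laurents_in_mult)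
  have tm: "rmult scl (?S (\<sigma> \<circ> \<tau>)) (ren (\<sigma> \<circ> \<tau>) X) \<in> fracs_in ?V" if "\<sigma> \<in> ?T" for \<sigma>
    using q tperms_comp[OF that \<tau>n] X by (rule sym_term_fracs_in)
  have 1: "series_eq scl ?V (qsym0 scl N q n (rmult scl ?S' (ren \<tau> X)))
      (fsum scl ?T (\<lambda>\<sigma>. rmult scl ?c (rmult scl (?S (\<sigma> \<circ> \<tau>)) (ren (\<sigma> \<circ> \<tau>) X))))"
    unfolding qsym_def
  proof (rule fsum_cong[OF finite_tperms])
    fix \<sigma> assume \<sigma>: "\<sigma> \<in> ?T"
    show "series_eq scl ?V (rmult scl (?S \<sigma>) (ren \<sigma> (rmult scl ?S' (ren \<tau> X))))
        (rmult scl ?c (rmult scl (?S (\<sigma> \<circ> \<tau>)) (ren (\<sigma> \<circ> \<tau>) X)))"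
      unfolding ren_rmult[OF tpermsD(2)[OF \<sigma>]] rmult_rmult ren_comp[OF tpermsD(2)[OF \<sigma>] tpermsD(2)[OF \<tau>]] S'
      using arg_cong[OF inv_prod_comp[OF \<sigma> \<tau>n q], of "\<lambda>z. lcst (sym_const N s) * (lcst (sym_const N n) * z)"]
      by (intro rmult_eqI) (simp add: sym_factor_eq ren_laurent_mult mult_ac)
    show "rmult scl (?S \<sigma>) (ren \<sigma> (rmult scl ?S' (ren \<tau> X))) \<in> fracs_in ?V"
      using q \<sigma> S'X by (rule sym_term_fracs_in)
    show "rmult scl ?c (rmult scl (?S (\<sigma> \<circ> \<tau>)) (ren (\<sigma> \<circ> \<tau>) X)) \<in> fracs_in ?V"
      using tm[OF \<sigma>] by (rule fracs_in_scale)
  qed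
  have 2: "series_eq scl ?V (rmult scl ?c (fsum scl ?T (\<lambda>\<sigma>. rmult scl (?S (\<sigma> \<circ> \<tau>)) (ren (\<sigma> \<circ> \<tau>) X))))
      (fsum scl ?T (\<lambda>\<sigma>. rmult scl ?c (rmult scl (?S (\<sigma> \<circ> \<tau>)) (ren (\<sigma> \<circ> \<tau>) X))))"
    using tm by (intro rmult_fsum) (auto intro: dens.one)
  have 3: "qsym0 scl N q n X = fsum scl ?T (\<lambda>\<sigma>. rmult scl (?S (\<sigma> \<circ> \<tau>)) (ren (\<sigma> \<circ> \<tau>) X))"
    unfolding qsym_def by (rule fsum_bij[OF bij_betw_tperms_comp[OF \<tau>n]]) (rule refl)
  show ?thesis
    using tm unfolding 3
    by (intro series_eq_common[OF 1 2] fracs_inD[OF fracs_in_fsum']) (auto intro: dens.one)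
qed

text \<open>All summands of the inner symmetrization contribute equally after the outer one.
  \<open>X\<close> may involve all variables of \<open>n\<close>; the inner permutations move only
  those with index up to \<open>s a\<close>.\<close>

lemma qsym_qsym:
  assumes q: "q \<noteq> 0" and s: "\<And>a. s a \<le> n a" and X: "X \<in> fracs_in (tvars0 N n)"
  shows "series_eq scl (tvars0 N n) (qsym0 scl N q n (qsym0 scl N q s X)) (qsym0 scl N q n X)"
proof -
  let ?V = "tvars0 N n" and ?S = "sym_factor N q (\<lambda>_. 0) s" and ?T = "tperms N (\<lambda>_. 0) s"
  have tm: "rmult scl (?S \<tau>) (ren \<tau> X) \<in> fracs_in ?V" if \<tau>: "\<tau> \<in> ?T" for \<tau>
  proof -
    note \<tau>n = tperms_mono[OF \<tau> s]
    show ?thesis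
      unfolding sym_factor_eq inv_prod_mono[OF \<tau> s, symmetric]
      using inv_prod_laurents_in[OF \<tau>n] inv_prod_dens[OF \<tau>n] q
        fracs_in_ren'[OF tpermsD(1)[OF \<tau>n] X] by (intro fracs_in_rmult') (simp_all add: laurents_in_mult)
  qed
  have Q: "qsym0 scl N q n X \<in> fracs_in ?V"
    using q X by (rule qsym_fracs_in)
  have 1: "series_eq scl ?V (qsym0 scl N q n (qsym0 scl N q s X))
      (fsum scl ?T (\<lambda>\<tau>. qsym0 scl N q n (rmult scl (?S \<tau>) (ren \<tau> X))))"
    unfolding qsym_def[of scl N q _ s] using q tm by (intro qsym_fsum) auto
  have 2: "series_eq scl ?V (fsum scl ?T (\<lambda>\<tau>. qsym0 scl N q n (rmult scl (?S \<tau>) (ren \<tau> X))))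
      (fsum scl ?T (\<lambda>\<tau>. rmult scl (lcst (sym_const N s), 1) (qsym0 scl N q n X)))"
    using tm Q by (intro fsum_cong finite_tperms qsym_twist qsym_fracs_in fracs_in_scale q s X) blast+
  have 3: "series_eq scl ?V (fsum scl ?T (\<lambda>\<tau>. rmult scl (lcst (sym_const N s), 1) (qsym0 scl N q n X)))
      (rmult scl (lcst (\<Sum>\<tau>\<in>?T. sym_const N s), 1) (qsym0 scl N q n X))"
    using Q by (intro fsum_const_weights) auto
  \<comment> \<open>The prefactor is the inverse of the number of permutations: the symmetrization
    is an average.\<close>
  have "(\<Sum>\<tau>\<in>?T. sym_const N s) = 1"
    by (simp add: card_tperms sym_const_def prod_dividef)
  then have 3: "series_eq scl ?V (fsum scl ?T (\<lambda>\<tau>. rmult scl (lcst (sym_const N s), 1) (qsym0 scl N q n X)))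
      (qsym0 scl N q n X)"
    using 3 by simp
  show ?thesis
    using tm Q q by (intro series_eq_trans[OF series_eq_trans[OF 1 2] 3] fracs_inD[OF fracs_in_fsum'] qsym_fracs_in)
      (auto intro: dens.one)
qed

end

context scalar_algebra
begin

lemma qsym_absorb:
  assumes q: "q \<noteq> 0" and s: "\<And>a. s a \<le> n a"
    and A: "A \<in> fracs_in (tvars N s n)" and X: "X \<in> fracs_in (tvars0 N s)"
    and Z: "fst Z \<in> laurents_in (tvars0 N n)" "snd Z \<in> dens (tvars0 N n)"
    and Z_inv: "\<And>\<tau>. \<tau> \<in> tperms N (\<lambda>_. 0) s \<Longrightarrow> ren_laurent \<tau> (fst Z) = fst Z"
      "\<And>\<tau>. \<tau> \<in> tperms N (\<lambda>_. 0) s \<Longrightarrow> ren_laurent \<tau> (snd Z) = snd Z"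
  shows "series_eq scl (tvars0 N n)
    (qsym0 scl N q n (rmult scl Z (fmult A (qsym0 scl N q s X))))
    (qsym0 scl N q n (rmult scl Z (fmult A X)))"
proof -
  let ?V = "tvars0 N n" and ?S = "sym_factor N q (\<lambda>_. 0) s" and ?T = "tperms N (\<lambda>_. 0) s"
  have V: "tvars N s n \<union> tvars0 N s = ?V"
    using s by (auto simp: tvars_def not_less intro: order_trans)
  have disj: "tvars N s n \<inter> tvars0 N s = {}"
    by (auto simp: tvars_def)
  have tm: "rmult scl (?S \<tau>) (ren \<tau> X) \<in> fracs_in (tvars0 N s)" if "\<tau> \<in> ?T" for \<tau>
    using q that X by (rule sym_term_fracs_in)
  have AX: "fmult A Y \<in> fracs_in ?V" if "Y \<in> fracs_in (tvars0 N s)" for Y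
    using fracs_in_fmult[OF A that] V by simp
  have ZAX: "rmult scl Z (fmult A Y) \<in> fracs_in ?V" if "Y \<in> fracs_in (tvars0 N s)" for Y
    using AX[OF that] Z by auto
  have "series_eq scl ?V (fmult A (qsym0 scl N q s X)) (fsum scl ?T (\<lambda>\<tau>. fmult A (rmult scl (?S \<tau>) (ren \<tau> X))))"
    unfolding qsym_def using fmult_fsum[OF A finite_tperms tm disj] V by simp
  then have 1: "series_eq scl ?V (rmult scl Z (fmult A (qsym0 scl N q s X)))
      (rmult scl Z (fsum scl ?T (\<lambda>\<tau>. fmult A (rmult scl (?S \<tau>) (ren \<tau> X)))))"
    by (rule rmult_cong)
  have 2: "series_eq scl ?V (rmult scl Z (fsum scl ?T (\<lambda>\<tau>. fmult A (rmult scl (?S \<tau>) (ren \<tau> X)))))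
      (fsum scl ?T (\<lambda>\<tau>. rmult scl Z (fmult A (rmult scl (?S \<tau>) (ren \<tau> X)))))"
    using tm by (intro rmult_fsum AX Z finite_tperms)
  \<comment> \<open>Once the sum stands in front, its summands agree literally with those of the
    lower symmetrization of the whole product, and \<open>qsym_qsym\<close> becomes
    applicable.\<close>
  have 3: "fsum scl ?T (\<lambda>\<tau>. rmult scl Z (fmult A (rmult scl (?S \<tau>) (ren \<tau> X)))) =
      qsym0 scl N q s (rmult scl Z (fmult A X))"
    unfolding qsym_def
  proof (rule fsum_cong_eq)
    fix \<tau> assume \<tau>: "\<tau> \<in> ?T"
    have "\<tau> v = v" if "v \<in> tvars N s n" for v
      using that disj by (intro permutes_not_in[OF tpermsD(1)[OF \<tau>]]) blast
    then have A\<tau>: "ren \<tau> A = A"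
      using A by (intro ren_fixed[OF tpermsD(2)[OF \<tau>]])
    have "fmult A (rmult scl (?S \<tau>) (ren \<tau> X)) = rmult scl (?S \<tau>) (fmult A (ren \<tau> X))"
      using A fracs_in_ren'[OF tpermsD(1)[OF \<tau>] X] inv_prod_laurents_in[OF \<tau>] disj
      by (intro fmult_rmult[of "tvars N s n" _ "tvars0 N s"])
        (auto simp: fracs_in_def sym_factor_eq intro: laurents_in_mult)
    also have "fmult A (ren \<tau> X) = ren \<tau> (fmult A X)"
      by (simp add: ren_fmult[OF tpermsD(2)[OF \<tau>]] A\<tau>)
    finally show "rmult scl Z (fmult A (rmult scl (?S \<tau>) (ren \<tau> X))) =
        rmult scl (?S \<tau>) (ren \<tau> (rmult scl Z (fmult A X)))"
      by (simp add: ren_rmult[OF tpermsD(2)[OF \<tau>]] Z_inv[OF \<tau>] rmult_rmult mult.commute)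
  qed
  have "series_eq scl ?V (rmult scl Z (fmult A (qsym0 scl N q s X))) (qsym0 scl N q s (rmult scl Z (fmult A X)))"
    using series_eq_trans[OF 1 2] fracs_inD[OF AX[OF tm]] dens_mult[OF Z(2)]
    unfolding 3 by (simp add: rmult_def fsum_def dens_prod)
  moreover have "qsym0 scl N q s (rmult scl Z (fmult A X)) \<in> fracs_in ?V"
    unfolding 3[symmetric] using tm by (intro fracs_in_fsum' ZAX)
  ultimately have 4: "series_eq scl ?V (qsym0 scl N q n (rmult scl Z (fmult A (qsym0 scl N q s X))))
      (qsym0 scl N q n (qsym0 scl N q s (rmult scl Z (fmult A X))))"
    using q X by (intro qsym_cong ZAX qsym_fracs_in)
  show ?thesis
    using \<open>qsym0 scl N q s (rmult scl Z (fmult A X)) \<in> fracs_in ?V\<close> q s ZAX[OF X]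
    by (intro series_eq_trans[OF 4] qsym_qsym fracs_inD[OF qsym_fracs_in])
qed

end

section \<open>Tableaux\<close>

definition tableau_rows :: "nat \<Rightarrow> nat list set" where
  "tableau_rows N = {row. row \<noteq> [] \<and> set row \<subseteq> {1..N - 1} \<and> sorted_wrt (\<ge>) row}"

text \<open>Unlike \<open>connected_tableau\<close> this admits the empty list. It is the only
  tableau of weight 0, what remains when a single row is removed, and it starts the
  recursion.\<close>

definition tableaux_of_weight :: "nat \<Rightarrow> mindex \<Rightarrow> nat list list set" where
  "tableaux_of_weight N n = {\<chi>. set \<chi> \<subseteq> tableau_rows N \<and> weight N \<chi> = n}"

lemma row_count_mindices [simp]: "row_count N row \<in> mindices N"
  by (simp add: row_count_def mindices_def)

lemma noninc_row_count: "noninc N (row_count N row)"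
proof -
  have "length (filter (\<lambda>x. Suc a \<le> x) row) \<le> length (filter (\<lambda>x. a \<le> x) row)" for a
    by (induction row) auto
  then show ?thesis
    by (auto simp: noninc_def row_count_def mindices_def)
qed

text \<open>The number of boxes of type \<open>a\<close> is the difference of the counts at
  \<open>a\<close> and \<open>a + 1\<close>. So the counts determine the multiset of boxes, and a
  row is that multiset in sorted order.\<close>

lemma inj_on_row_count: "inj_on (row_count N) (tableau_rows N)"
proof (rule inj_onI)
  fix r r' assume r: "r \<in> tableau_rows N" "r' \<in> tableau_rows N" and eq: "row_count N r = row_count N r'"
  \<comment> \<open>\<open>row_count\<close> is cut off above \<open>N - 1\<close>; nothing is lost,
    as no type exceeds \<open>N - 1\<close>.\<close>
  have cnt: "length (filter (\<lambda>x. a \<le> x) s) = row_count N s a" if "s \<in> tableau_rows N" "1 \<le> a" for s a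
  proof (cases "a \<le> N - 1")
    case False
    then have "filter (\<lambda>x. a \<le> x) s = []"
      using that by (auto simp: tableau_rows_def filter_empty_conv)
    then show ?thesis using False by (simp add: row_count_def)
  qed (use that in \<open>simp add: row_count_def\<close>)
  have split: "count (mset s) a + length (filter (\<lambda>x. Suc a \<le> x) s) = length (filter (\<lambda>x. a \<le> x) s)" for s a
    by (induction s) auto
  have "count (mset r) a = count (mset r') a" for a
  proof (cases "a = 0")
    case True
    have "0 \<notin> set r" "0 \<notin> set r'" using r by (auto simp: tableau_rows_def)
    then show ?thesis using True by (simp add: count_eq_zero_iff[THEN iffD2])
  next
    case False
    then show ?thesis
      using split[of r a] split[of r' a] cnt[OF r(1)] cnt[OF r(2)] eq by simp
  qed
  then have "mset (rev r) = mset (rev r')"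
    by (simp add: multiset_eq_iff)
  moreover have "sorted (rev r)" "sorted (rev r')"
    using r by (simp_all add: tableau_rows_def sorted_wrt_rev)
  ultimately have "rev r = rev r'"
    by (metis properties_for_sort)
  then show "r = r'" by simp
qed

text \<open>A row and its counts are conjugate partitions: the row takes
  \<open>m a - m (a + 1)\<close> boxes of type \<open>a\<close>, and the counts telescope.\<close>

lemma row_count_surj:
  assumes m: "noninc N m" "m \<noteq> (\<lambda>_. 0)"
  shows "m \<in> row_count N ` tableau_rows N"
proof
  define xs where "xs = concat (map (\<lambda>a. replicate (m a - m (Suc a)) a) [1..<N])"
  have m0: "m a = 0" if "a \<notin> {1..N - 1}" for a
    using m(1) that by (simp add: noninc_def mindices_def)
  have step: "m (Suc a) \<le> m a" if "1 \<le> a" for a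
    using m(1) that m0[of "Suc a"] by (cases "Suc a \<le> N - 1") (auto simp: noninc_def)
  \<comment> \<open>The telescoping sum ends with \<open>m N\<close>, which is 0 because
    \<open>N\<close> is not a type.\<close>
  have tele: "(\<Sum>a\<in>{b..<N}. m a - m (Suc a)) = m b" if "b \<le> N" "1 \<le> b" for b
    using that
  proof (induction b rule: inc_induct)
    case base
    then show ?case using m0[of N] by simp
  next
    case (step b)
    then show ?case
      using \<open>\<And>a. 1 \<le> a \<Longrightarrow> m (Suc a) \<le> m a\<close>[of b] by (simp add: sum.atLeast_Suc_lessThan)
  qed
  have len: "length (filter (\<lambda>x. b \<le> x) xs) = m b" if b: "1 \<le> b" for b
  proof -
    have "length (filter (\<lambda>x. b \<le> x) xs) = (\<Sum>a\<leftarrow>[1..<N]. if b \<le> a then m a - m (Suc a) else 0)"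
    proof -
      have "length (filter (\<lambda>x. b \<le> x) (replicate k a)) = (if b \<le> a then k else 0)" for k a
        by simp
      then show ?thesis
        by (simp add: xs_def filter_concat length_concat comp_def del: filter_replicate)
    qed
    also have "\<dots> = (\<Sum>a\<in>{1..<N}. if b \<le> a then m a - m (Suc a) else 0)"
      by (simp add: interv_sum_list_conv_sum_set_nat)
    also have "\<dots> = (\<Sum>a\<in>{b..<N}. m a - m (Suc a))"
      using b by (intro sum.mono_neutral_cong_right) auto
    also have "\<dots> = m b"
      using tele[of b] m0[of b] b by (cases "b \<le> N") auto
    finally show ?thesis .
  qed
  let ?r = "rev (sort xs)"
  have "filter (\<lambda>x. b \<le> x) ?r = rev (sort (filter (\<lambda>x. b \<le> x) xs))" for b
    by (simp add: rev_filter[symmetric] filter_sort)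
  then show "m = row_count N ?r"
    using m0 len by (auto simp: row_count_def fun_eq_iff)
  have "xs \<noteq> []"
  proof
    assume "xs = []"
    then have "m b = 0" for b
      using len[of b] m0[of b] by (cases "1 \<le> b") auto
    then show False using m(2) by auto
  qed
  then have "?r \<noteq> []"
    by (metis length_0_conv length_rev length_sort)
  then show "?r \<in> tableau_rows N"
    by (auto simp: tableau_rows_def sorted_wrt_rev xs_def)
qed

definition row_of :: "nat \<Rightarrow> mindex \<Rightarrow> nat list" where
  "row_of N m = inv_into (tableau_rows N) (row_count N) m"

lemma row_of:
  assumes "noninc N m" "m \<noteq> (\<lambda>_. 0)"
  shows "row_of N m \<in> tableau_rows N" "row_count N (row_of N m) = m"
  using row_count_surj[OF assms] by (simp_all add: row_of_def inv_into_into f_inv_into_f)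

lemma row_of_row_count: "row \<in> tableau_rows N \<Longrightarrow> row_of N (row_count N row) = row"
  by (simp add: row_of_def inj_on_row_count)

lemma row_count_nonzero:
  assumes "row \<in> tableau_rows N" shows "row_count N row \<noteq> (\<lambda>_. 0)"
proof
  assume *: "row_count N row = (\<lambda>_. 0)"
  have "row \<noteq> []" "\<forall>x\<in>set row. 1 \<le> x \<and> x \<le> N - 1"
    using assms by (auto simp: tableau_rows_def)
  then have "hd row \<in> set row" "1 \<le> hd row" "1 \<le> N - 1"
    by (metis hd_in_set, metis hd_in_set, metis hd_in_set le_trans)
  then have "length (filter (\<lambda>x. 1 \<le> x) row) = 0"
    using fun_cong[OF *, of 1] by (simp add: row_count_def)
  with \<open>hd row \<in> set row\<close> \<open>1 \<le> hd row\<close> show False by (auto simp: filter_empty_conv)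
qed

lemma row_sums_append: "i \<le> length \<chi> \<Longrightarrow> row_sums N (\<chi> @ \<chi>') i = row_sums N \<chi> i"
  by (simp add: row_sums_def nth_append)

lemma weight_Nil [simp]: "weight N [] = (\<lambda>_. 0)"
  by (simp add: weight_def row_sums_def)

lemma weight_snoc: "weight N (\<chi> @ [row]) = (\<lambda>a. weight N \<chi> a + row_count N row a)"
  by (simp add: weight_def row_sums_def nth_append)

lemma weight_mindices [simp]: "weight N \<chi> \<in> mindices N"
  by (auto simp: weight_def row_sums_def mindices_def row_count_def)

text \<open>The possible weights of a tableau of weight \<open>n\<close> without its top row.\<close>

definition lower_weights :: "nat \<Rightarrow> mindex \<Rightarrow> mindex set" where
  "lower_weights N n = {s \<in> mindices N. (\<forall>a. s a \<le> n a) \<and> s \<noteq> n}"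

text \<open>Empty unless \<open>n - s\<close> can be the weight of a top row. At the remaining
  indices the coefficient of the projected strings is zero, so this loses no summand of the star
  product.\<close>

definition lower_tableaux :: "nat \<Rightarrow> mindex \<Rightarrow> mindex \<Rightarrow> nat list list set" where
  "lower_tableaux N n s = (if noninc N (\<lambda>a. n a - s a) then tableaux_of_weight N s else {})"

text \<open>A nonempty tableau is its top row together with what lies below, and the top row is
  recovered from the difference of the weights. As a row has at least one box, the lower weight
  differs from \<open>n\<close>.\<close>

lemma bij_betw_tableaux:
  assumes n: "n \<noteq> (\<lambda>_. 0)"
  shows "bij_betw (\<lambda>(s, \<chi>). \<chi> @ [row_of N (\<lambda>a. n a - s a)])
    (Sigma (lower_weights N n) (lower_tableaux N n)) (tableaux_of_weight N n)"
proof (rule bij_betw_byWitness[where f' = "\<lambda>\<chi>. (weight N (butlast \<chi>), butlast \<chi>)"])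
  show "\<forall>p\<in>Sigma (lower_weights N n) (lower_tableaux N n).
      (\<lambda>\<chi>. (weight N (butlast \<chi>), butlast \<chi>)) ((\<lambda>(s, \<chi>). \<chi> @ [row_of N (\<lambda>a. n a - s a)]) p) = p"
    by (auto simp: lower_tableaux_def tableaux_of_weight_def split: if_splits)
  have last: "\<exists>\<chi>' row. \<chi> = \<chi>' @ [row] \<and> set \<chi>' \<subseteq> tableau_rows N \<and> row \<in> tableau_rows N
      \<and> n = (\<lambda>a. weight N \<chi>' a + row_count N row a)"
    if "\<chi> \<in> tableaux_of_weight N n" for \<chi>
    using that n by (cases \<chi> rule: rev_cases) (auto simp: tableaux_of_weight_def weight_snoc)
  show "\<forall>\<chi>\<in>tableaux_of_weight N n.
      (\<lambda>(s, \<chi>). \<chi> @ [row_of N (\<lambda>a. n a - s a)]) (weight N (butlast \<chi>), butlast \<chi>) = \<chi>"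
    by (auto dest!: last simp: row_of_row_count)
  show "(\<lambda>(s, \<chi>). \<chi> @ [row_of N (\<lambda>a. n a - s a)]) ` Sigma (lower_weights N n) (lower_tableaux N n)
      \<subseteq> tableaux_of_weight N n"
  proof (rule image_subsetI, clarify)
    fix s \<chi> assume s: "s \<in> lower_weights N n" and \<chi>: "\<chi> \<in> lower_tableaux N n s"
    then have s_le: "s a \<le> n a" for a by (simp add: lower_weights_def)
    have "(\<lambda>a. n a - s a) \<noteq> (\<lambda>_. 0)"
      using s by (auto simp: lower_weights_def fun_eq_iff intro: le_antisym)
    moreover have "noninc N (\<lambda>a. n a - s a)"
      using \<chi> by (auto simp: lower_tableaux_def split: if_splits)
    ultimately show "\<chi> @ [row_of N (\<lambda>a. n a - s a)] \<in> tableaux_of_weight N n"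
      using \<chi> row_of[of N "\<lambda>a. n a - s a"] s_le
      by (auto simp: lower_tableaux_def tableaux_of_weight_def weight_snoc)
  qed
  show "(\<lambda>\<chi>. (weight N (butlast \<chi>), butlast \<chi>)) ` tableaux_of_weight N n
      \<subseteq> Sigma (lower_weights N n) (lower_tableaux N n)"
  proof (rule image_subsetI)
    fix \<chi> assume "\<chi> \<in> tableaux_of_weight N n"
    then obtain \<chi>' row where *: "\<chi> = \<chi>' @ [row]" "set \<chi>' \<subseteq> tableau_rows N" "row \<in> tableau_rows N"
      "n = (\<lambda>a. weight N \<chi>' a + row_count N row a)"
      using last by blast
    have "weight N \<chi>' \<noteq> n"
      using row_count_nonzero[OF *(3)] by (auto simp: *(4) fun_eq_iff)
    then show "(weight N (butlast \<chi>), butlast \<chi>) \<in> Sigma (lower_weights N n) (lower_tableaux N n)"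
      using * noninc_row_count[of N row]
      by (auto simp: lower_weights_def lower_tableaux_def tableaux_of_weight_def)
  qed
qed

lemma tableaux_of_weight_zero: "tableaux_of_weight N (\<lambda>_. 0) = {[]}"
proof -
  have "\<chi> = []" if "\<chi> \<in> tableaux_of_weight N (\<lambda>_. 0)" for \<chi>
    using that
    by (cases \<chi> rule: rev_cases)
      (auto simp: tableaux_of_weight_def weight_snoc fun_eq_iff dest!: row_count_nonzero)
  then show ?thesis
    by (auto simp: tableaux_of_weight_def)
qed

lemma finite_mindices_le:
  assumes "n \<in> mindices N" shows "finite {s \<in> mindices N. \<forall>a. s a \<le> n a}"
proof (rule finite_subset)
  let ?S = "{s. \<forall>a. (a \<in> {1..N - 1} \<longrightarrow> s a \<in> {..sum n {1..N - 1}}) \<and> (a \<notin> {1..N - 1} \<longrightarrow> s a = 0)}"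
  have "n a \<le> sum n {1..N - 1}" if "a \<in> {1..N - 1}" for a
    using that by (intro member_le_sum) auto
  then have "s a \<le> sum n {1..N - 1}" if "a \<in> {1..N - 1}" "\<forall>a. s a \<le> n a" for s a
    using that le_trans by blast
  then show "{s \<in> mindices N. \<forall>a. s a \<le> n a} \<subseteq> ?S"
    unfolding mindices_def by blast
  show "finite ?S"
    by (rule finite_set_of_finite_funs) auto
qed

lemma finite_lower_weights: "n \<in> mindices N \<Longrightarrow> finite (lower_weights N n)"
  by (rule finite_subset[OF _ finite_mindices_le[of n N]]) (auto simp: lower_weights_def)

lemma lower_weights_less:
  assumes "n \<in> mindices N" "s \<in> lower_weights N n"
  shows "sum s {1..N - 1} < sum n {1..N - 1}"
proof -
  obtain a where a: "s a \<noteq> n a"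
    using assms(2) by (auto simp: lower_weights_def fun_eq_iff)
  then have "a \<in> {1..N - 1}"
    using assms by (auto simp: lower_weights_def mindices_def)
  then show ?thesis
    using a assms(2) by (intro sum_strict_mono_ex1) (auto simp: lower_weights_def order_less_le)
qed

text \<open>Lower indices have a strictly smaller total. The zero index is a case of its own because
  the coefficient there is given by normalization and not by the recursion.\<close>

lemma mindices_induct [consumes 1, case_names zero nonzero]:
  assumes "n \<in> mindices N" and zero: "Q (\<lambda>_. 0)"
    and nonzero: "\<And>n. n \<in> mindices N \<Longrightarrow> n \<noteq> (\<lambda>_. 0) \<Longrightarrow> (\<And>s. s \<in> lower_weights N n \<Longrightarrow> Q s) \<Longrightarrow> Q n"
  shows "Q n"
  using assms(1)
proof (induction "sum n {1..N - 1}" arbitrary: n rule: less_induct)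
  case less
  have "Q s" if "s \<in> lower_weights N n" for s
    using that less lower_weights_less by (auto simp: lower_weights_def)
  then show ?case
    using zero nonzero less.prems by blast
qed

lemma finite_tableaux_of_weight:
  assumes "n \<in> mindices N" shows "finite (tableaux_of_weight N n)"
  using assms
proof (induction rule: mindices_induct)
  case zero
  then show ?case by (simp add: tableaux_of_weight_zero)
next
  case (nonzero n)
  then have "finite (Sigma (lower_weights N n) (lower_tableaux N n))"
    by (intro finite_SigmaI finite_lower_weights) (auto simp: lower_tableaux_def)
  then show ?case
    using bij_betw_finite[OF bij_betw_tableaux[OF nonzero(2)]] by blast
qed

section \<open>The factors \<open>Z\<close>\<close>

text \<open>For \<open>s = n\<close> the range of the index \<open>i\<close> is empty. This is the
  summand that isolates the unknown coefficient of the inverse.\<close>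

lemma Zfactor_same: "Zfactor N q n n = (1, 1)"
  by (simp add: Zfactor_def)

lemma Zfactor_variables:
  assumes "1 \<le> a" "a \<le> N - 2" "i \<in> {s a<..n a}" "j \<in> {0<..s (a + 1)}" "\<And>a. s a \<le> n a"
  shows "(a, i) \<in> tvars0 N n" "(a + 1, j) \<in> tvars0 N n"
  using assms(1-4) le_trans[OF _ assms(5)[of "a + 1"], of j] by (auto simp: tvars_def)

lemma Zfactor_in:
  assumes "q \<noteq> 0" "\<And>a. s a \<le> n a"
  shows "fst (Zfactor N q s n) \<in> laurents_in (tvars0 N n)" "snd (Zfactor N q s n) \<in> dens (tvars0 N n)"
  using Zfactor_variables[OF _ _ _ _ assms(2), of _ N] assms(1)
  by (auto simp: Zfactor_def intro!: laurents_in_prod dens_prod laurents_in_lin lin_in_dens)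

text \<open>The variables of type \<open>a\<close> have indices above \<open>s a\<close> and are
  fixed; those of type \<open>a + 1\<close> run over all indices up to \<open>s (a + 1)\<close> and
  are permuted among themselves.\<close>

lemma Zfactor_invariant:
  assumes \<tau>: "\<tau> \<in> tperms N (\<lambda>_. 0) s"
  shows "ren_laurent \<tau> (fst (Zfactor N q s n)) = fst (Zfactor N q s n)"
    "ren_laurent \<tau> (snd (Zfactor N q s n)) = snd (Zfactor N q s n)"
proof -
  have "(\<Prod>j\<in>{0<..s (a + 1)}. lin \<alpha> \<beta> (\<tau> (a, i)) (\<tau> (a + 1, j))) = (\<Prod>j\<in>{0<..s (a + 1)}. lin \<alpha> \<beta> (a, i) (a + 1, j))"
    if a: "a \<in> {1..N - 2}" and i: "i \<in> {s a<..n a}" for \<alpha> \<beta> a i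
  proof -
    have "\<tau> (a, i) = (a, i)"
      using i by (intro permutes_not_in[OF tpermsD(1)[OF \<tau>]]) (auto simp: tvars_def)
    then have "(\<Prod>j\<in>{0<..s (a + 1)}. lin \<alpha> \<beta> (\<tau> (a, i)) (\<tau> (a + 1, j))) =
        (\<Prod>j\<in>{0<..s (a + 1)}. lin \<alpha> \<beta> (a, i) (a + 1, snd (\<tau> (a + 1, j))))"
      using tpermsD(3)[OF \<tau>, of "a + 1"] by (intro prod.cong) auto
    also have "\<dots> = (\<Prod>j\<in>{0<..s (a + 1)}. lin \<alpha> \<beta> (a, i) (a + 1, j))"
    proof -
      have "a + 1 \<in> {1..N - 1}" using a by auto
      then have "(\<lambda>j. snd (\<tau> (a + 1, j))) permutes {0<..s (a + 1)}"
        using tperms_permutes[OF \<tau>] by (simp add: atLeastSucAtMost_greaterThanAtMost)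
      from prod.permute[OF this, of "\<lambda>j. lin \<alpha> \<beta> (a, i) (a + 1, j)"] show ?thesis
        by (simp add: comp_def)
    qed
    finally show ?thesis .
  qed
  then show "ren_laurent \<tau> (fst (Zfactor N q s n)) = fst (Zfactor N q s n)"
    "ren_laurent \<tau> (snd (Zfactor N q s n)) = snd (Zfactor N q s n)"
    unfolding Zfactor_def by (simp_all add: ren_laurent_prod)
qed

text \<open>The blocks of consecutive rows fill the interval without gaps.\<close>

lemma prod_row_sums:
  "(\<Prod>i<k. \<Prod>j\<in>{row_sums N \<chi> i a<..row_sums N \<chi> (Suc i) a}. g j) = (\<Prod>j\<in>{0<..row_sums N \<chi> k a}. g j :: 'b::comm_monoid_mult)"
proof (induction k)
  case (Suc k)
  have "row_sums N \<chi> k a \<le> row_sums N \<chi> (Suc k) a"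
    by (simp add: row_sums_def)
  then have "{0<..row_sums N \<chi> (Suc k) a} = {0<..row_sums N \<chi> k a} \<union> {row_sums N \<chi> k a<..row_sums N \<chi> (Suc k) a}"
    by auto
  then show ?case
    using Suc by (simp add: prod.union_disjoint)
qed (simp add: row_sums_def)

text \<open>The pairs of rows involving the new top row are those with
  \<open>j = length \<chi>\<close>. In them the blocks of the lower rows join to all variables of
  the smaller tableau, which gives \<open>Zfactor\<close>.\<close>

lemma Ztableau_snoc:
  "Ztableau N q (\<chi> @ [row]) =
    (let Z = Zfactor N q (weight N \<chi>) (weight N (\<chi> @ [row]))
     in (fst Z * fst (Ztableau N q \<chi>), snd Z * snd (Ztableau N q \<chi>)))"
proof -
  let ?h = "row_sums N (\<chi> @ [row])" and ?L = "length \<chi>"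
  define H where "H \<alpha> \<beta> i a k = (\<Prod>k'\<in>{?h i (a + 1)<..?h (i + 1) (a + 1)}. lin \<alpha> \<beta> (a, k) (a + 1, k'))"
    for \<alpha> \<beta> i a k
  define G where "G \<alpha> \<beta> h j i = (\<Prod>a=1..N - 2. \<Prod>k\<in>{h j a<..h (j + 1) a}.
      \<Prod>k'\<in>{h i (a + 1)<..h (i + 1) (a + 1)}. lin \<alpha> \<beta> (a, k) (a + 1, k'))"
    for \<alpha> \<beta> and h :: "nat \<Rightarrow> mindex" and j i
  have Z: "Ztableau N q \<chi>' = (\<Prod>j<length \<chi>'. \<Prod>i<j. G q (1 / q) (row_sums N \<chi>') j i,
      \<Prod>j<length \<chi>'. \<Prod>i<j. G 1 1 (row_sums N \<chi>') j i)" for \<chi>'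
    unfolding Ztableau_def Let_def G_def ..
  have h: "?h i = row_sums N \<chi> i" if "i \<le> ?L" for i
    using that by (rule row_sums_append)
  have lower: "(\<Prod>j<?L. \<Prod>i<j. G \<alpha> \<beta> ?h j i) = (\<Prod>j<?L. \<Prod>i<j. G \<alpha> \<beta> (row_sums N \<chi>) j i)" for \<alpha> \<beta>
    by (intro prod.cong refl) (simp add: G_def h)
  have w: "?h ?L = weight N \<chi>" "?h (?L + 1) = weight N (\<chi> @ [row])"
    by (simp_all add: h weight_def)
  have top: "(\<Prod>i<?L. G \<alpha> \<beta> ?h ?L i) =
      (\<Prod>a=1..N - 2. \<Prod>k\<in>{weight N \<chi> a<..weight N (\<chi> @ [row]) a}.
        \<Prod>k'\<in>{0<..weight N \<chi> (a + 1)}. lin \<alpha> \<beta> (a, k) (a + 1, k'))" for \<alpha> \<beta>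
  proof -
    have "(\<Prod>i<?L. H \<alpha> \<beta> i a k) = (\<Prod>k'\<in>{0<..weight N \<chi> (a + 1)}. lin \<alpha> \<beta> (a, k) (a + 1, k'))" for a k
      unfolding H_def Suc_eq_plus1[symmetric] prod_row_sums unfolding w(1) ..
    moreover have "(\<Prod>i<?L. G \<alpha> \<beta> ?h ?L i) =
        (\<Prod>a=1..N - 2. \<Prod>k\<in>{?h ?L a<..?h (?L + 1) a}. \<Prod>i<?L. H \<alpha> \<beta> i a k)"
      unfolding G_def H_def[symmetric]
      by (subst prod.swap) (rule prod.cong[OF refl prod.swap])
    ultimately show ?thesis
      unfolding w by simp
  qed
  show ?thesis
    unfolding Z Zfactor_def Let_def by (simp add: lower top mult.commute)
qed

section \<open>Scalars, the projection and the series of dual strings\<close>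

text \<open>Scalars are multiples of the empty word. Since \<open>\<phi>\<close> is surjective,
  their images are central in the quantum algebra.\<close>

lemma gcst_central: "gcst c * x = x * gcst c"
  by (induction x rule: poly_mapping_additive_induct)
    (simp_all add: gcst_def mult_single distrib_left distrib_right mult.commute)

lemma scalar_algebra_uscale:
  assumes "is_Uq_gl_hat N q \<phi>" shows "scalar_algebra (uscale \<phi>)"
proof -
  have hom: "\<phi> 1 = 1" "\<phi> (x + y) = \<phi> x + \<phi> y" "\<phi> (x * y) = \<phi> x * \<phi> y" "surj \<phi>" for x y
    using assms by (simp_all add: is_Uq_gl_hat_def)
  have "gcst (a + b) = gcst a + gcst b" "gcst (a * b) = gcst a * gcst b" "gcst 1 = 1" for a b
    by (simp_all add: gcst_def single_add mult_single)
  then have module: "module (uscale \<phi>)"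
    by unfold_locales (simp_all add: uscale_def hom distrib_left distrib_right mult.assoc)
  have "u * (\<phi> (gcst c) * v) = \<phi> (gcst c) * (u * v)" for c u v
    using gcst_central[of c] hom(3,4) by (metis surjD mult.assoc)
  then show ?thesis
    using module by (simp add: scalar_algebra_def scalar_module_def scalar_algebra_axioms_def uscale_def)
qed

lemma scalar_module_wscale: "scalar_module wscale"
  by unfold_locales (simp_all add: wscale_def fun_eq_iff algebra_simps)

section \<open>Variables and constant coefficient of the series of projected strings\<close>

context scalar_module
begin

lemma qsym_zero_index: "qsym0 scl N q (\<lambda>_. 0) X = X"
proof -
  have V: "tvars N (\<lambda>_. 0) (\<lambda>_. 0) = {}" by (auto simp: tvars_def)
  have "tperms N (\<lambda>_. 0) (\<lambda>_. 0) = {id}" by (auto simp: tperms_def V)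
  moreover have "inversions N (\<lambda>_. 0) (\<lambda>_. 0) id = {}" by (simp add: inversions_def V)
  moreover have "ren id X = X"
  proof -
    have "ren_laurent id p = p" for p
      by (induction p rule: poly_mapping_additive_induct)
        (simp_all only: ren_laurent_add ren_laurent_single ren_expo_id)
    moreover have "ren_dist id f = f" for f :: "'b dist"
      by (simp add: fun_eq_iff ren_dist_bij)
    ultimately show ?thesis
      by (simp add: ren_def)
  qed
  ultimately show ?thesis
    by (simp add: qsym_def sym_factor_def fsum_def)
qed

end

lemma string_currents_zero: "string_currents N q (\<lambda>_. 0) e = (if e = 0 then wone else 0)"
proof -
  have "string_list N (\<lambda>_. 0) = []"
    by (simp add: string_list_def concat_eq_Nil_conv)
  then show ?thesis
    by (simp add: string_currents_def)
qed

lemma dual_string_zero: "dual_string N q (\<lambda>_. 0) = (\<lambda>e. if e = 0 then wone else 0, 1)"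
proof -
  have "string_factor N q (\<lambda>_. 0) = (1, 1)"
    by (simp add: string_factor_def string_Vtilde_def Vtilde_def)
  then show ?thesis
    by (simp add: dual_string_def string_currents_zero fun_eq_iff
        scalar_module.rmult_one[OF scalar_module_wscale])
qed

text \<open>As \<open>s (a + 1) \<le> s a\<close>, the truncated difference
  \<open>s a - s (a + 1)\<close> is exact, and the indices \<open>s a - s (a + 1) + m\<close> with
  \<open>m \<le> s (a + 1)\<close> do not exceed \<open>s a\<close>.\<close>

lemma string_factor_in:
  assumes "noninc N s"
  shows "fst (string_factor N q s) \<in> laurents_in (tvars0 N s)"
    and "snd (string_factor N q s) \<in> dens (tvars0 N s)"
proof -
  have V: "(a, s a - s (a + 1) + m) \<in> tvars0 N s" "(a + 1, m) \<in> tvars0 N s"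
    if "a \<in> {1..N - 2}" "m \<in> {1..s (a + 1)}" for a m
  proof -
    have "s (a + 1) \<le> s a" using assms that by (auto simp: noninc_def)
    then show "(a, s a - s (a + 1) + m) \<in> tvars0 N s" "(a + 1, m) \<in> tvars0 N s"
      using that by (auto simp: tvars_def)
  qed
  have "fst (string_Vtilde q s a) \<in> laurents_in (tvars0 N s)"
    and "snd (string_Vtilde q s a) \<in> dens (tvars0 N s)" if a: "a \<in> {1..N - 2}" for a
    using V[OF a] unfolding string_Vtilde_def Vtilde_def
    by (auto intro!: laurents_in_prod laurents_in_lin dens_mult dens_prod lin_in_dens)
  then show "fst (string_factor N q s) \<in> laurents_in (tvars0 N s)"
    and "snd (string_factor N q s) \<in> dens (tvars0 N s)"
    by (auto simp: string_factor_def intro!: laurents_in_mult laurents_in_prod dens_prod)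
qed

lemma dual_string_fracs_in:
  assumes "2 \<le> N" "noninc N s" shows "dual_string N q s \<in> fracs_in (tvars0 N s)"
proof -
  have "{1} \<times> {1..s 1} \<subseteq> tvars0 N s"
    using assms(1) by (auto simp: tvars_def)
  then have "(string_currents N q s, 1) \<in> fracs_in (tvars0 N s)"
    by (auto simp: fracs_in_def supp_in_def string_currents_def dens.one split: if_splits)
  then show ?thesis
    unfolding dual_string_def using string_factor_in[OF assms(2)]
    by (intro scalar_module.fracs_in_rmult'[OF scalar_module_wscale])
qed

lemma Pbar_zero:
  assumes "scalar_module (uscale \<phi>)" shows "Pbar \<phi> P 0 = 0"
proof -
  interpret scalar_module "uscale \<phi>" by fact
  show ?thesis by (simp add: Pbar_def)
qed

text \<open>The projection acts on each coefficient of the numerator and sends 0 to 0, so no new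
  variables or denominators arise.\<close>

lemma Eser_fracs_in:
  assumes "scalar_module (uscale \<phi>)" "2 \<le> N" "q \<noteq> 0"
  shows "Eser N q \<phi> P s \<in> fracs_in (tvars0 N s)"
proof (cases "noninc N s")
  case True
  then have "qsym0 wscale N q s (dual_string N q s) \<in> fracs_in (tvars0 N s)"
    using assms by (intro scalar_module.qsym_fracs_in[OF scalar_module_wscale] dual_string_fracs_in)
  moreover have "f e \<noteq> 0" if "Pbar \<phi> P (f e) \<noteq> 0" for f :: "wseries dist" and e
    using that Pbar_zero[OF assms(1)] by metis
  ultimately show ?thesis
    using True unfolding Eser_def Let_def fracs_in_def supp_in_def by simp
qed (simp add: Eser_def)

text \<open>The empty string is the unit series, and \<open>P\<close> fixes 1: write 1 as 1 * 1 with
  factors in \<open>U_f_minus\<close> and \<open>U_F_plus\<close>, the second having counit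
  1.\<close>

lemma Eser_zero:
  assumes Uq: "is_Uq_gl_hat N q \<phi>" and \<epsilon>: "is_counit N \<phi> \<epsilon>" and P: "is_minus_projection N q \<phi> \<epsilon> P"
  shows "Eser N q \<phi> P (\<lambda>_. 0) = fone"
proof -
  interpret scalar_algebra "uscale \<phi>" using Uq by (rule scalar_algebra_uscale)
  have one: "\<phi> (gcst 1) = 1" "\<phi> (gmon []) = 1"
    using Uq by (simp_all add: is_Uq_gl_hat_def gcst_def gmon_def flip: zero_word_def)
  have "1 \<in> subalgebra \<phi> G" for G
    using subalgebra.scalar[of \<phi> 1 G] by (simp add: one)
  then have "1 \<in> U_f_minus N q \<phi>" "1 \<in> U_F_plus N q \<phi>"
    by (simp_all add: U_f_minus_def U_F_plus_def U_F_def U_F'_def Uq_b_plus_def Uq_b_minus_def)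
  then have "P (1 * 1) = uscale \<phi> (\<epsilon> 1) 1"
    using P unfolding is_minus_projection_def by blast
  moreover have "\<epsilon> (\<phi> (gcst 1)) = 1"
    using \<epsilon> unfolding is_counit_def by blast
  ultimately have P1: "P 1 = 1" by (simp add: one)
  have "Pbar \<phi> P wone = 1"
    unfolding Pbar_def by (subst Sum_any.expand_superset[of "{[]}"]) (auto simp: wone_def one P1)
  moreover have "noninc N (\<lambda>_. 0)" by (simp add: noninc_def mindices_def)
  ultimately show ?thesis
    by (simp add: Eser_def scalar_module.qsym_zero_index[OF scalar_module_wscale] dual_string_zero
        fone_def fun_eq_iff Pbar_zero scalar_module_axioms)
qed

section \<open>Shifted rows and the product over the rows of a tableau\<close>

lemma inj_shift: "inj (\<lambda>(a, i). (a, i + s a :: nat))"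
  by (auto intro: injI)

lemma shift_fracs_in:
  assumes "X \<in> fracs_in (tvars0 N m)"
  shows "shift s X \<in> fracs_in (tvars N s (\<lambda>a. s a + m a))"
proof -
  have "(\<lambda>(a, i). (a, i + s a)) ` tvars0 N m \<subseteq> tvars N s (\<lambda>a. s a + m a)"
    by (auto simp: tvars_def)
  then show ?thesis
    using fracs_in_ren[OF inj_shift assms] fracs_in_mono unfolding shift_def by blast
qed

text \<open>The shift is injective but in general not surjective, so the rules for bijective
  substitutions do not apply and exponents outside its range are treated apart. The exponent 0 is in
  the range.\<close>

lemma shift_fone [simp]: "shift s fone = (fone :: 'b::zero_neq_one frac)"
proof -
  let ?r = "\<lambda>(a, i). (a, i + s a)"
  have "ren_dist ?r (\<lambda>e. if e = 0 then 1 else 0 :: 'b) e = (if e = 0 then 1 else 0)" for e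
  proof (cases "e \<in> range (ren_expo ?r)")
    case True
    then obtain d where e: "e = ren_expo ?r d" by blast
    have "e = 0 \<longleftrightarrow> d = 0"
      using inj_eq[OF inj_ren_expo[OF inj_shift[of s]], of d 0] by (simp only: e ren_expo_zero)
    then show ?thesis
      by (simp only: e ren_dist_ren_expo[OF inj_shift])
  next
    case False
    then have "e \<noteq> 0" by (metis ren_expo_zero rangeI)
    with False show ?thesis by (simp add: ren_dist_def)
  qed
  then show ?thesis
    unfolding shift_def ren_def fone_def by (simp add: fun_eq_iff)
qed

lemma shift_fzero [simp]: "shift s fzero = fzero"
  by (simp add: shift_def ren_def fzero_def ren_dist_def)

lemma Etableau_snoc:
  "Etableau N q \<phi> P (\<chi> @ [row]) =
    fmult (shift (weight N \<chi>) (Eser N q \<phi> P (row_count N row))) (Etableau N q \<phi> P \<chi>)"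
proof -
  let ?f = "\<lambda>\<chi> i. shift (row_sums N \<chi> i) (Eser N q \<phi> P (row_count N (\<chi> ! i)))"
  have "map (?f (\<chi> @ [row])) [0..<length \<chi>] = map (?f \<chi>) [0..<length \<chi>]"
    by (simp add: row_sums_append nth_append)
  then have eq: "map (?f (\<chi> @ [row])) [0..<length (\<chi> @ [row])] =
      map (?f \<chi>) [0..<length \<chi>] @ [?f (\<chi> @ [row]) (length \<chi>)]"
    by (simp only: length_append_singleton upt_Suc_append[OF le0] map_append list.map)
  show ?thesis
    unfolding Etableau_def eq by (simp add: weight_def row_sums_append)
qed

lemma tvars_union: "(\<And>a. s a \<le> n a) \<Longrightarrow> tvars N s n \<union> tvars0 N s = tvars0 N n"
  by (auto simp: tvars_def not_less intro: order_trans)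

lemma Etableau_fracs_in:
  assumes "scalar_module (uscale \<phi>)" "2 \<le> N" "q \<noteq> 0"
  shows "Etableau N q \<phi> P \<chi> \<in> fracs_in (tvars0 N (weight N \<chi>))"
proof (induction \<chi> rule: rev_induct)
  case (snoc row \<chi>)
  have "shift (weight N \<chi>) (Eser N q \<phi> P (row_count N row)) \<in> fracs_in (tvars N (weight N \<chi>) (weight N (\<chi> @ [row])))"
    unfolding weight_snoc using assms by (intro shift_fracs_in Eser_fracs_in)
  from fracs_in_fmult[OF this snoc] show ?case
    using tvars_union[of "weight N \<chi>" "weight N (\<chi> @ [row])" N]
    by (simp add: Etableau_snoc weight_snoc)
qed (simp add: Etableau_def)

lemma Ztableau_in:
  assumes "q \<noteq> 0"
  shows "fst (Ztableau N q \<chi>) \<in> laurents_in (tvars0 N (weight N \<chi>)) \<and>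
    snd (Ztableau N q \<chi>) \<in> dens (tvars0 N (weight N \<chi>))"
proof (induction \<chi> rule: rev_induct)
  case Nil
  show ?case by (simp add: Ztableau_def dens.one)
next
  case (snoc row \<chi>)
  have le: "weight N \<chi> a \<le> weight N (\<chi> @ [row]) a" for a
    by (simp add: weight_snoc)
  have "tvars0 N (weight N \<chi>) \<subseteq> tvars0 N (weight N (\<chi> @ [row]))"
    using tvars_union[of "weight N \<chi>" "weight N (\<chi> @ [row])" N] le by blast
  then show ?case
    using snoc Zfactor_in[OF assms, of "weight N \<chi>" "weight N (\<chi> @ [row])" N] le
      laurents_in_mono[of "tvars0 N (weight N \<chi>)" "tvars0 N (weight N (\<chi> @ [row]))"]
      dens_mono[of "tvars0 N (weight N \<chi>)" "tvars0 N (weight N (\<chi> @ [row]))"]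
    by (auto simp: Ztableau_snoc Let_def intro!: laurents_in_mult dens_mult)
qed

section \<open>The recursion for the star inverse\<close>

context scalar_algebra
begin

text \<open>One summand of \<open>star\<close> as a function of its two factors, so that the right
  one can be replaced by a sum of tableau terms.\<close>

definition star_term :: "nat \<Rightarrow> complex \<Rightarrow> mindex \<Rightarrow> mindex \<Rightarrow> 'a frac \<Rightarrow> 'a frac \<Rightarrow> 'a frac" where
  "star_term N q n s A X = qsym0 scl N q n (rmult scl (Zfactor N q s n) (fmult A X))"

context
  fixes N :: nat and q :: complex and n s :: mindex and A :: "'a frac"
  assumes q: "q \<noteq> 0" and le: "\<And>a. s a \<le> n a" and A: "A \<in> fracs_in (tvars N s n)"
begin

lemma tvars_disjoint: "tvars N s n \<inter> tvars0 N s = {}"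
  by (auto simp: tvars_def)

lemma fmult_fracs_in_tvars: "X \<in> fracs_in (tvars0 N s) \<Longrightarrow> fmult A X \<in> fracs_in (tvars0 N n)"
  using fracs_in_fmult[OF A, of X "tvars0 N s"] tvars_union[of s n N, OF le] by simp

lemma Z_fmult_fracs_in: "X \<in> fracs_in (tvars0 N s) \<Longrightarrow> rmult scl (Zfactor N q s n) (fmult A X) \<in> fracs_in (tvars0 N n)"
  by (intro fracs_in_rmult' Zfactor_in q le fmult_fracs_in_tvars)

lemma star_term_fracs_in: "X \<in> fracs_in (tvars0 N s) \<Longrightarrow> star_term N q n s A X \<in> fracs_in (tvars0 N n)"
  unfolding star_term_def by (intro qsym_fracs_in q Z_fmult_fracs_in)

lemma star_term_cong:
  assumes "X \<in> fracs_in (tvars0 N s)" "Y \<in> fracs_in (tvars0 N s)" "series_eq scl (tvars0 N s) X Y"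
  shows "series_eq scl (tvars0 N n) (star_term N q n s A X) (star_term N q n s A Y)"
  unfolding star_term_def
  using fmult_cong[OF A assms(1,2) tvars_disjoint assms(3)] tvars_union[of s n N, OF le]
  by (intro qsym_cong q Z_fmult_fracs_in assms rmult_cong) simp

lemma star_term_fsum:
  assumes I: "finite I" and X: "\<And>i. i \<in> I \<Longrightarrow> X i \<in> fracs_in (tvars0 N s)"
  shows "series_eq scl (tvars0 N n) (star_term N q n s A (fsum scl I X)) (fsum scl I (\<lambda>i. star_term N q n s A (X i)))"
proof -
  let ?V = "tvars0 N n" and ?Z = "Zfactor N q s n"
  have XV: "fmult A (X i) \<in> fracs_in ?V" if "i \<in> I" for i
    using X[OF that] by (rule fmult_fracs_in_tvars)
  have "series_eq scl ?V (fmult A (fsum scl I X)) (fsum scl I (\<lambda>i. fmult A (X i)))"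
    using fmult_fsum[OF A I X tvars_disjoint] tvars_union[of s n N, OF le] by simp
  then have "series_eq scl ?V (rmult scl ?Z (fmult A (fsum scl I X))) (rmult scl ?Z (fsum scl I (\<lambda>i. fmult A (X i))))"
    by (rule rmult_cong)
  also have "series_eq scl ?V \<dots> (fsum scl I (\<lambda>i. rmult scl ?Z (fmult A (X i))))"
    using Zfactor_in[of q s n N, OF q le] by (intro rmult_fsum I XV)
  finally have *: "series_eq scl ?V (rmult scl ?Z (fmult A (fsum scl I X))) (fsum scl I (\<lambda>i. rmult scl ?Z (fmult A (X i))))"
    using Zfactor_in[of q s n N, OF q le] XV by (blast intro: fracs_inD)
  have "series_eq scl ?V (star_term N q n s A (fsum scl I X)) (qsym0 scl N q n (fsum scl I (\<lambda>i. rmult scl ?Z (fmult A (X i)))))"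
    unfolding star_term_def using X by (intro qsym_cong q Z_fmult_fracs_in fracs_in_fsum' *)
  also have "series_eq scl ?V \<dots> (fsum scl I (\<lambda>i. star_term N q n s A (X i)))"
    unfolding star_term_def using X by (intro qsym_fsum q I Z_fmult_fracs_in)
  finally show ?thesis
    using X q Z_fmult_fracs_in by (blast intro: fracs_inD qsym_fracs_in)
qed

lemma star_term_scale:
  assumes X: "X \<in> fracs_in (tvars0 N s)"
  shows "series_eq scl (tvars0 N n) (star_term N q n s A (rmult scl (lcst c, 1) X))
    (rmult scl (lcst c, 1) (star_term N q n s A X))"
proof -
  let ?V = "tvars0 N n" and ?Z = "Zfactor N q s n"
  have "fmult A (rmult scl (lcst c, 1) X) = rmult scl (lcst c, 1) (fmult A X)"
    using A X tvars_disjoint by (intro fmult_rmult[of "tvars N s n" _ "tvars0 N s"]) (auto simp: fracs_in_def)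
  then have *: "rmult scl ?Z (fmult A (rmult scl (lcst c, 1) X)) = rmult scl (lcst c, 1) (rmult scl ?Z (fmult A X))"
    by (simp add: rmult_rmult mult.commute)
  let ?Y = "rmult scl ?Z (fmult A X)" and ?T = "tperms N (\<lambda>_. 0) n" and ?S = "sym_factor N q (\<lambda>_. 0) n"
  have "rmult scl (?S \<sigma>) (ren \<sigma> (rmult scl (lcst c, 1) ?Y)) = rmult scl (lcst c, 1) (rmult scl (?S \<sigma>) (ren \<sigma> ?Y))"
    if "\<sigma> \<in> ?T" for \<sigma>
    by (simp add: ren_rmult[OF tpermsD(2)[OF that]] rmult_rmult ren_laurent_mult mult_ac)
  then have "qsym0 scl N q n (rmult scl (lcst c, 1) ?Y) = fsum scl ?T (\<lambda>\<sigma>. rmult scl (lcst c, 1) (rmult scl (?S \<sigma>) (ren \<sigma> ?Y)))"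
    unfolding qsym_def by (rule fsum_cong_eq)
  then show ?thesis
    unfolding star_term_def * unfolding qsym_def[of scl N q _ n ?Y]
    using Z_fmult_fracs_in[OF X] by (auto intro!: series_eq_sym[OF rmult_fsum] sym_term_fracs_in q dens.one)
qed

end

end

lemma tableau_term_fracs_in:
  assumes "scalar_module (uscale \<phi>)" "2 \<le> N" "q \<noteq> 0"
  shows "tableau_term N q \<phi> P \<chi> \<in> fracs_in (tvars0 N (weight N \<chi>))"
proof -
  interpret scalar_module "uscale \<phi>" by fact
  show ?thesis
    unfolding tableau_term_def using Ztableau_in[OF assms(3), of N \<chi>] Etableau_fracs_in[OF assms, of P \<chi>]
    by (intro fracs_in_scale qsym_fracs_in assms fracs_in_rmult') auto
qed

lemma star_term_tableau_term:
  fixes \<phi> :: "free \<Rightarrow> 'a::ring_1" and \<chi> :: "nat list list" and row :: "nat list"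
  assumes Uq: "is_Uq_gl_hat N q \<phi>" and N: "2 \<le> N" and q: "q \<noteq> 0"
  defines "s \<equiv> weight N \<chi>" and "n \<equiv> weight N (\<chi> @ [row])"
  shows "series_eq (uscale \<phi>) (tvars0 N n)
    (rmult (uscale \<phi>) (lcst (- 1), 1)
      (scalar_algebra.star_term (uscale \<phi>) N q n s (shift s (Eser N q \<phi> P (row_count N row))) (tableau_term N q \<phi> P \<chi>)))
    (tableau_term N q \<phi> P (\<chi> @ [row]))"
proof -
  interpret scalar_algebra "uscale \<phi>" using Uq by (rule scalar_algebra_uscale)
  let ?V = "tvars0 N n" and ?A = "shift s (Eser N q \<phi> P (row_count N row))"
  have le: "s a \<le> n a" for a
    by (simp add: s_def n_def weight_snoc)
  have A: "?A \<in> fracs_in (tvars N s n)"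
    unfolding s_def n_def weight_snoc using scalar_module_axioms N q by (intro shift_fracs_in Eser_fracs_in)
  define X where "X = rmult (uscale \<phi>) (Ztableau N q \<chi>) (Etableau N q \<phi> P \<chi>)"
  have E: "Etableau N q \<phi> P \<chi> \<in> fracs_in (tvars0 N s)"
    unfolding s_def using scalar_module_axioms N q by (rule Etableau_fracs_in)
  have X: "X \<in> fracs_in (tvars0 N s)"
    unfolding X_def using E Ztableau_in[OF q, of N \<chi>] by (intro fracs_in_rmult') (auto simp: s_def)
  have Q: "qsym0 (uscale \<phi>) N q s X \<in> fracs_in (tvars0 N s)"
    using q X by (rule qsym_fracs_in)
  have t: "tableau_term N q \<phi> P \<chi> = rmult (uscale \<phi>) (lcst ((- 1) ^ length \<chi>), 1) (qsym0 (uscale \<phi>) N q s X)"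
    by (simp add: tableau_term_def X_def s_def)
  \<comment> \<open>\<open>Ztableau N q \<chi>\<close> involves only variables of the smaller
    tableau, hence it passes the factor of the new row.\<close>
  have "fmult ?A X = rmult (uscale \<phi>) (Ztableau N q \<chi>) (fmult ?A (Etableau N q \<phi> P \<chi>))"
    unfolding X_def using A E Ztableau_in[OF q, of N \<chi>]
    by (intro fmult_rmult[of "tvars N s n" _ "tvars0 N s"]) (auto simp: fracs_in_def s_def tvars_def)
  then have ZX: "rmult (uscale \<phi>) (Zfactor N q s n) (fmult ?A X) =
      rmult (uscale \<phi>) (Ztableau N q (\<chi> @ [row])) (Etableau N q \<phi> P (\<chi> @ [row]))"
    by (simp add: Ztableau_snoc Etableau_snoc rmult_rmult Let_def s_def n_def)
  have ZXV: "rmult (uscale \<phi>) (Zfactor N q s n) (fmult ?A X) \<in> fracs_in ?V"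
    using q le A X by (rule Z_fmult_fracs_in)
  have "series_eq (uscale \<phi>) ?V (star_term N q n s ?A (tableau_term N q \<phi> P \<chi>))
      (rmult (uscale \<phi>) (lcst ((- 1) ^ length \<chi>), 1) (star_term N q n s ?A (qsym0 (uscale \<phi>) N q s X)))"
    unfolding t using q le A Q by (rule star_term_scale)
  also have "series_eq (uscale \<phi>) ?V \<dots> (rmult (uscale \<phi>) (lcst ((- 1) ^ length \<chi>), 1)
      (qsym0 (uscale \<phi>) N q n (rmult (uscale \<phi>) (Zfactor N q s n) (fmult ?A X))))"
    unfolding star_term_def
    by (intro rmult_cong qsym_absorb q le A X Zfactor_in Zfactor_invariant)
  finally have "series_eq (uscale \<phi>) ?V (star_term N q n s ?A (tableau_term N q \<phi> P \<chi>))
      (rmult (uscale \<phi>) (lcst ((- 1) ^ length \<chi>), 1)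
      (qsym0 (uscale \<phi>) N q n (rmult (uscale \<phi>) (Zfactor N q s n) (fmult ?A X))))"
    using star_term_fracs_in[OF q le A Q] by (blast intro: fracs_inD)
  from rmult_cong[OF this, of "(lcst (- 1), 1)"] show ?thesis
    unfolding ZX by (simp add: tableau_term_def rmult_rmult n_def flip: lcst_mult)
qed

text \<open>Stated for all multi-indices because the recursion leaves the non-increasing ones: for
  \<open>n = (2, 1)\<close> and \<open>s = (0, 1)\<close> both \<open>n\<close> and
  \<open>n - s\<close> are non-increasing, but \<open>s\<close> is not. Weights of tableaux are
  non-increasing, so at such an index the sum is empty and the claim is that the coefficient
  vanishes.\<close>

theorem star_inverse_tableaux:
  assumes N: "2 \<le> N" and q: "q \<noteq> 0" and Uq: "is_Uq_gl_hat N q \<phi>"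
    and \<epsilon>: "is_counit N \<phi> \<epsilon>" and P: "is_minus_projection N q \<phi> \<epsilon> P"
    and D: "is_star_inverse (uscale \<phi>) N q (Eser N q \<phi> P) D"
    and n: "n \<in> mindices N"
  shows "series_eq (uscale \<phi>) (tvars0 N n) (D n) (fsum (uscale \<phi>) (tableaux_of_weight N n) (tableau_term N q \<phi> P))"
proof -
  interpret scalar_algebra "uscale \<phi>" using Uq by (rule scalar_algebra_uscale)
  let ?E = "Eser N q \<phi> P" and ?t = "tableau_term N q \<phi> P"
  have D_in: "D n \<in> fracs_in (tvars0 N n)" if "n \<in> mindices N" for n
    using D that by (auto simp: is_star_inverse_def qsym_series_def fracs_in_def supp_in_def)
  have t_in: "?t \<chi> \<in> fracs_in (tvars0 N s)" if "\<chi> \<in> tableaux_of_weight N s" for \<chi> s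
    using tableau_term_fracs_in[OF scalar_module_axioms N q, of P \<chi>] that by (auto simp: tableaux_of_weight_def)
  show ?thesis
    using n
  proof (induction rule: mindices_induct)
    case zero
    have "?t [] = fone"
      by (simp add: tableau_term_def qsym_zero_index Ztableau_def Etableau_def)
    then have "fsum (uscale \<phi>) (tableaux_of_weight N (\<lambda>_. 0)) ?t = fone"
      by (simp add: tableaux_of_weight_zero fsum_def)
    moreover have "series_eq (uscale \<phi>) {} (D (\<lambda>_. 0)) fone"
      using D by (simp add: is_star_inverse_def qsym_series_def)
    ultimately show ?case
      by (auto elim: series_eq_mono)
  next
    case (nonzero n)
    let ?V = "tvars0 N n"
    define A where "A s = shift s (?E (\<lambda>a. n a - s a))" for s
    define Y where "Y s = star_term N q n s (A s) (D s)" for s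
    define L where "L = {s \<in> mindices N. \<forall>a. s a \<le> n a}"
    have finL: "finite L" unfolding L_def using nonzero(1) by (rule finite_mindices_le)
    have L: "L - {n} = lower_weights N n" by (auto simp: L_def lower_weights_def)
    have nL: "n \<in> L" using nonzero(1) by (simp add: L_def)
    have A_in: "A s \<in> fracs_in (tvars N s n)" if "s \<in> L" for s
    proof -
      have "(\<lambda>a. s a + (n a - s a)) = n" using that by (auto simp: L_def)
      then show ?thesis
        unfolding A_def using shift_fracs_in[OF Eser_fracs_in[OF scalar_module_axioms N q], of s P "\<lambda>a. n a - s a"] by simp
    qed
    have Y_in: "Y s \<in> fracs_in ?V" if "s \<in> L" for s
      unfolding Y_def using that q A_in D_in by (intro star_term_fracs_in) (auto simp: L_def)
    have "star (uscale \<phi>) N q ?E D n = fsum (uscale \<phi>) L Y"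
      unfolding star_def L_def Y_def star_term_def A_def ..
    then have "series_eq (uscale \<phi>) ?V (fsum (uscale \<phi>) L Y) fzero"
      using D nonzero(1,2) by (auto simp: is_star_inverse_def is_star_one_def)
    then have 1: "series_eq (uscale \<phi>) ?V (Y n) (fsum (uscale \<phi>) (lower_weights N n) (\<lambda>s. rmult (uscale \<phi>) (lcst (- 1), 1) (Y s)))"
      using fsum_remove_eq_zero[OF finL nL, of Y ?V] Y_in unfolding L by blast
    \<comment> \<open>At \<open>s = n\<close> both \<open>Zfactor\<close> and the constant
      coefficient of the string series are 1.\<close>
    have "Y n = qsym0 (uscale \<phi>) N q n (D n)"
      by (simp add: Y_def star_term_def A_def Zfactor_same Eser_zero[OF Uq \<epsilon> P])
    moreover have "series_eq (uscale \<phi>) ?V (qsym0 (uscale \<phi>) N q n (D n)) (D n)"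
      using D nonzero(1,2) by (auto simp: is_star_inverse_def qsym_series_def)
    ultimately have 2: "series_eq (uscale \<phi>) ?V (D n) (Y n)"
      by (simp add: series_eq_sym)
    let ?K = "lower_tableaux N n" and ?app = "\<lambda>s \<chi>. \<chi> @ [row_of N (\<lambda>a. n a - s a)]"
    have fin_low: "finite (lower_weights N n)" using nonzero(1) by (rule finite_lower_weights)
    have finK: "finite (?K s)" if "s \<in> lower_weights N n" for s
      using that finite_tableaux_of_weight[of s N] by (auto simp: lower_tableaux_def lower_weights_def)
    have bij: "bij_betw (\<lambda>(s, \<chi>). ?app s \<chi>) (Sigma (lower_weights N n) ?K) (tableaux_of_weight N n)"
      using nonzero(2) by (rule bij_betw_tableaux)
    have app: "?app s \<chi> \<in> tableaux_of_weight N n" if "s \<in> lower_weights N n" "\<chi> \<in> ?K s" for s \<chi>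
      using bij_betwE[OF bij] that by auto
    have 3: "series_eq (uscale \<phi>) ?V (fsum (uscale \<phi>) (lower_weights N n) (\<lambda>s. rmult (uscale \<phi>) (lcst (- 1), 1) (Y s)))
       (fsum (uscale \<phi>) (lower_weights N n) (\<lambda>s. fsum (uscale \<phi>) (?K s) (\<lambda>\<chi>. ?t (?app s \<chi>))))"
    proof (rule fsum_cong[OF fin_low])
      fix s assume s: "s \<in> lower_weights N n"
      then have sL: "s \<in> L" and le: "\<And>a. s a \<le> n a" using L by (auto simp: lower_weights_def)
      show "rmult (uscale \<phi>) (lcst (- 1), 1) (Y s) \<in> fracs_in ?V"
        using Y_in[OF sL] by (rule fracs_in_scale)
      show "fsum (uscale \<phi>) (?K s) (\<lambda>\<chi>. ?t (?app s \<chi>)) \<in> fracs_in ?V"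
        using t_in[OF app[OF s]] by (rule fracs_in_fsum')
      show "series_eq (uscale \<phi>) ?V (rmult (uscale \<phi>) (lcst (- 1), 1) (Y s)) (fsum (uscale \<phi>) (?K s) (\<lambda>\<chi>. ?t (?app s \<chi>)))"
      proof (cases "noninc N (\<lambda>a. n a - s a)")
        \<comment> \<open>No row has weight \<open>n - s\<close>. The numerator of
          \<open>Y s\<close> vanishes while its denominator stays, so \<open>Y s\<close> is zero up
          to \<open>series_eq\<close> only.\<close>
        case False
        then have "A s = fzero"
          by (simp add: A_def Eser_def)
        then have "fst (Y s) = (\<lambda>_. 0)"
          by (simp add: Y_def star_term_def qsym_def fsum_def rmult_def fmult_fzero ren_def ren_dist_def)
        moreover have "fsum (uscale \<phi>) (?K s) (\<lambda>\<chi>. ?t (?app s \<chi>)) = fzero"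
          using False by (simp add: lower_tableaux_def fsum_def fzero_def)
        ultimately show ?thesis
          using dens.one by (auto simp: series_eq_def rmult_def fzero_def)
      next
        case True
        then have K: "?K s = tableaux_of_weight N s" by (simp add: lower_tableaux_def)
        have m0: "(\<lambda>a. n a - s a) \<noteq> (\<lambda>_. 0)"
          using s le by (auto simp: lower_weights_def fun_eq_iff intro: le_antisym)
        let ?r = "row_of N (\<lambda>a. n a - s a)"
        have st_in: "star_term N q n s (A s) (?t \<chi>) \<in> fracs_in ?V" if "\<chi> \<in> ?K s" for \<chi>
          using star_term_fracs_in[OF q le A_in[OF sL]] t_in that K by blast
        have "series_eq (uscale \<phi>) ?V (Y s) (star_term N q n s (A s) (fsum (uscale \<phi>) (?K s) ?t))"
          unfolding Y_def using nonzero(3)[OF s] s t_in D_in unfolding K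
          by (intro star_term_cong[OF q le A_in[OF sL]] fracs_in_fsum') (auto simp: lower_weights_def)
        also have "series_eq (uscale \<phi>) ?V \<dots> (fsum (uscale \<phi>) (?K s) (\<lambda>\<chi>. star_term N q n s (A s) (?t \<chi>)))"
          using t_in K by (intro star_term_fsum[OF q le A_in[OF sL]] finK s) auto
        finally have "series_eq (uscale \<phi>) ?V (Y s) (fsum (uscale \<phi>) (?K s) (\<lambda>\<chi>. star_term N q n s (A s) (?t \<chi>)))"
          using star_term_fracs_in[OF q le A_in[OF sL], of "fsum (uscale \<phi>) (?K s) ?t"] t_in K
          by (blast intro: fracs_inD)
        then have "series_eq (uscale \<phi>) ?V (rmult (uscale \<phi>) (lcst (- 1), 1) (Y s))
            (rmult (uscale \<phi>) (lcst (- 1), 1) (fsum (uscale \<phi>) (?K s) (\<lambda>\<chi>. star_term N q n s (A s) (?t \<chi>))))"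
          by (rule rmult_cong)
        also have "series_eq (uscale \<phi>) ?V \<dots>
            (fsum (uscale \<phi>) (?K s) (\<lambda>\<chi>. rmult (uscale \<phi>) (lcst (- 1), 1) (star_term N q n s (A s) (?t \<chi>))))"
          using st_in by (intro rmult_fsum finK s) (auto intro: dens.one)
        finally have 4: "series_eq (uscale \<phi>) ?V (rmult (uscale \<phi>) (lcst (- 1), 1) (Y s))
            (fsum (uscale \<phi>) (?K s) (\<lambda>\<chi>. rmult (uscale \<phi>) (lcst (- 1), 1) (star_term N q n s (A s) (?t \<chi>))))"
          using st_in by (blast intro: fracs_inD)
        have 5: "series_eq (uscale \<phi>) ?V (rmult (uscale \<phi>) (lcst (- 1), 1) (star_term N q n s (A s) (?t \<chi>))) (?t (?app s \<chi>))"
          if \<chi>: "\<chi> \<in> ?K s" for \<chi>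
        proof -
          have "weight N \<chi> = s" "weight N (\<chi> @ [?r]) = n"
            using \<chi> app[OF s \<chi>] K by (auto simp: tableaux_of_weight_def)
          then show ?thesis
            using star_term_tableau_term[OF Uq N q, of \<chi> ?r P] row_of(2)[OF True m0] by (simp add: A_def)
        qed
        have "series_eq (uscale \<phi>) ?V
            (fsum (uscale \<phi>) (?K s) (\<lambda>\<chi>. rmult (uscale \<phi>) (lcst (- 1), 1) (star_term N q n s (A s) (?t \<chi>))))
            (fsum (uscale \<phi>) (?K s) (\<lambda>\<chi>. ?t (?app s \<chi>)))"
          using st_in t_in[OF app[OF s]] by (intro fsum_cong 5 finK s) auto
        with 4 show ?thesis
          using st_in by (blast intro: series_eq_trans fracs_inD)
      qed
    qed
    have 4: "series_eq (uscale \<phi>) ?V (fsum (uscale \<phi>) (lower_weights N n) (\<lambda>s. fsum (uscale \<phi>) (?K s) (\<lambda>\<chi>. ?t (?app s \<chi>))))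
        (fsum (uscale \<phi>) (Sigma (lower_weights N n) ?K) (\<lambda>(s, \<chi>). ?t (?app s \<chi>)))"
      using t_in[OF app] by (intro fsum_Sigma fin_low finK)
    have 5: "fsum (uscale \<phi>) (Sigma (lower_weights N n) ?K) (\<lambda>(s, \<chi>). ?t (?app s \<chi>)) = fsum (uscale \<phi>) (tableaux_of_weight N n) ?t"
      by (rule fsum_bij[OF bij, symmetric]) auto
    have Yn: "snd (Y n) \<in> dens ?V" using Y_in[OF nL] by (rule fracs_inD)
    have "snd (fsum (uscale \<phi>) (lower_weights N n) (\<lambda>s. rmult (uscale \<phi>) (lcst (- 1), 1) (Y s))) \<in> dens ?V"
      using Y_in L by (intro fracs_inD fracs_in_fsum' fracs_in_scale) auto
    moreover have "snd (fsum (uscale \<phi>) (lower_weights N n) (\<lambda>s. fsum (uscale \<phi>) (?K s) (\<lambda>\<chi>. ?t (?app s \<chi>)))) \<in> dens ?V"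
      using t_in[OF app] by (intro fracs_inD fracs_in_fsum') auto
    ultimately show ?case
      using series_eq_trans[OF series_eq_trans[OF series_eq_trans[OF 2 1 Yn] 3] 4] unfolding 5 by blast
  qed
qed

theorem proposition6:
  fixes N :: nat and q :: complex
    and \<phi> :: "free \<Rightarrow> 'a::ring_1" and \<epsilon> :: "'a \<Rightarrow> complex" and P :: "'a \<Rightarrow> 'a"
    and D :: "mindex \<Rightarrow> 'a frac" and n :: mindex
  assumes "2 \<le> N"
    and "q \<noteq> 0" and "\<And>k::nat. 0 < k \<Longrightarrow> q ^ k \<noteq> 1"
    and "is_Uq_gl_hat N q \<phi>"
    and "is_counit N \<phi> \<epsilon>"
    and "is_minus_projection N q \<phi> \<epsilon> P"
    and "is_star_inverse (uscale \<phi>) N q (Eser N q \<phi> P) D"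
    and "noninc N n" and "n \<noteq> (\<lambda>_. 0)"
  shows "series_eq (uscale \<phi>) (tvars0 N n) (D n)
           (fsum (uscale \<phi>) {\<chi>. connected_tableau N \<chi> \<and> weight N \<chi> = n} (tableau_term N q \<phi> P))"
proof -
  \<comment> \<open>As \<open>n\<close> is not 0, the empty list, which is not a connected tableau,
    does not have weight \<open>n\<close>.\<close>
  have "{\<chi>. connected_tableau N \<chi> \<and> weight N \<chi> = n} = tableaux_of_weight N n"
    using assms(9) by (auto simp: connected_tableau_def tableaux_of_weight_def tableau_rows_def)
  then show ?thesis
    using star_inverse_tableaux[OF assms(1,2,4-7)] assms(8) by (simp add: noninc_def)
qed

end
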